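(* Let $M$ be a matroid of rank $r$ on a ground set $E$ with $n=|E|$ elements, and assume $M$ has no coloops. Let $k$ be a field of characteristic zero and let $R=k[x_e : e\in E]$. Identify elements of $k^n$ with one-forms (homogeneous linear forms) in $R$ in the canonical way, and write elements of $k^{n\times(r+1)}$ as pairs $(\Theta,\omega)$, where $\Theta=(\theta_1,\dots,\theta_r)$ consists of $r$ elements of $k^n$ and $\omega\in k^n$. Let $U$ be the set of all pairs $(\Theta,\omega)\in k^{n\times(r+1)}$ such that $\Theta$ is a linear set of parameters for the face ring $k[\Delta(M)]$ and $\omega$ is a $g$-element for $R(\Delta(M),\Theta)=k[\Delta(M)]/\langle\Theta\rangle$. Then $U$ is a non-empty Zariski open subset of $k^{n\times(r+1)}$.
   Context: The independence complex $\Delta(M)$ is the simplicial complex whose vertices are the non-loop elements of $E$ and whose faces are the independent subsets of $E$; it has dimension $r-1$. The face ring is $k[\Delta(M)]=R/I_{\Delta(M)}$, where $I_{\Delta(M)}$ is the ideal generated by all squarefree monomials $x_{e_1}\cdots x_{e_l}$ such that $\{e_1,\dots,e_l\}$ is not a face of $\Delta(M)$ (i.e. is dependent). Write $\theta_i=\sum_{e\in E}k_{ie}x_e$ and let $K=(k_{ie})$ be the $r\times n$ coefficient matrix. $\Theta$ is a linear set of parameters (l.s.o.p.) for $k[\Delta(M)]$ if for every face of $\Delta(M)$ the corresponding set of columns of $K$ is linearly independent. The quotient $R(\Delta(M),\Theta)=k[\Delta(M)]/\langle\Theta\rangle$ is a graded $k$-algebra (and $R$-module) of finite $k$-dimension.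 Definition ($g$-element): for a non-negatively graded $R$-module $N$ of finite $k$-dimension, let $d$ be the largest degree with $N_d\neq 0$; a one-form $\omega\in R$ is a $g$-element for $N$ if for every $i$ with $0\le i\le d/2$, multiplication by $\omega^{d-2i}$ is an injective map $N_i\to N_{d-i}$. *)

theory Defs
  imports
    "HOL-Library.Poly_Mapping"
    "HOL-Library.FuncSet"
    "HOL-Algebra.QuotRing"
    "HOL-Algebra.Module"
    "HOL-Analysis.Abstract_Topology"
begin

section \<open>Matroids\<close>

locale matroid =
  fixes E :: "'a set" and indep :: "'a set \<Rightarrow> bool"
  assumes finite_ground: "finite E"
    and indep_ground: "indep X \<Longrightarrow> X \<subseteq> E"
    and indep_empty: "indep {}"
    and indep_subset: "indep X \<Longrightarrow> Y \<subseteq> X \<Longrightarrow> indep Y"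
    and indep_augment:
      "indep X \<Longrightarrow> indep Y \<Longrightarrow> card X < card Y \<Longrightarrow> \<exists>y\<in>Y - X. indep (insert y X)"

definition matroid_rank :: "'a set \<Rightarrow> ('a set \<Rightarrow> bool) \<Rightarrow> nat" where
  "matroid_rank E indep = Max (card ` {X. X \<subseteq> E \<and> indep X})"

definition matroid_basis :: "'a set \<Rightarrow> ('a set \<Rightarrow> bool) \<Rightarrow> 'a set \<Rightarrow> bool" where
  "matroid_basis E indep B \<longleftrightarrow>
     B \<subseteq> E \<and> indep B \<and> (\<forall>X. X \<subseteq> E \<longrightarrow> indep X \<longrightarrow> B \<subseteq> X \<longrightarrow> X = B)"

definition coloop :: "'a set \<Rightarrow> ('a set \<Rightarrow> bool) \<Rightarrow> 'a \<Rightarrow> bool" where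
  "coloop E indep e \<longleftrightarrow> e \<in> E \<and> (\<forall>B. matroid_basis E indep B \<longrightarrow> e \<in> B)"

text \<open>
  A simplicial complex is given by its set of faces. The vertices of the independence complex
  are the \<open>e\<close> with \<open>{e}\<close> a face, i.e. the non-loops.
\<close>

definition independence_complex :: "'a set \<Rightarrow> ('a set \<Rightarrow> bool) \<Rightarrow> 'a set set" where
  "independence_complex E indep = {X. X \<subseteq> E \<and> indep X}"


section \<open>Polynomial rings\<close>

text \<open>
  Exponent vectors are finitely supported maps from variables to naturals, polynomials are
  finitely supported maps from exponent vectors to coefficients. The type has all of \<open>'v\<close> as
  variables; \<open>k[x\<^sub>v : v \<in> V]\<close> is the subring of those polynomials that only involve variables
  in \<open>V\<close>.
\<close>

type_synonym ('v, 'k) mpoly = "('v \<Rightarrow>\<^sub>0 nat) \<Rightarrow>\<^sub>0 'k"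

definition polys_in :: "'v set \<Rightarrow> ('v, 'k::field) mpoly set" where
  "polys_in V = {f. \<forall>m\<in>Poly_Mapping.keys f. Poly_Mapping.keys m \<subseteq> V}"

definition poly_ring :: "'v set \<Rightarrow> ('v, 'k::field) mpoly ring" where
  "poly_ring V = \<lparr>carrier = polys_in V, mult = (*), one = 1, zero = 0, add = (+)\<rparr>"

definition var :: "'v \<Rightarrow> ('v, 'k::field) mpoly" where
  "var v = Poly_Mapping.single (Poly_Mapping.single v 1) 1"

definition const :: "'k \<Rightarrow> ('v, 'k::field) mpoly" where
  "const c = Poly_Mapping.single 0 c"

definition total_degree_monom :: "('v \<Rightarrow>\<^sub>0 nat) \<Rightarrow> nat" where
  "total_degree_monom m = (\<Sum>v\<in>Poly_Mapping.keys m. Poly_Mapping.lookup m v)"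

definition homogeneous :: "'v set \<Rightarrow> nat \<Rightarrow> ('v, 'k::field) mpoly set" where
  "homogeneous V i =
     {f \<in> polys_in V. \<forall>m\<in>Poly_Mapping.keys f. total_degree_monom m = i}"

definition one_form :: "'v set \<Rightarrow> ('v \<Rightarrow> 'k) \<Rightarrow> ('v, 'k::field) mpoly" where
  "one_form V a = (\<Sum>v\<in>V. const (a v) * var v)"

definition poly_eval :: "('v \<Rightarrow> 'k) \<Rightarrow> ('v, 'k::field) mpoly \<Rightarrow> 'k" where
  "poly_eval p f =
     (\<Sum>m\<in>Poly_Mapping.keys f.
        Poly_Mapping.lookup f m * (\<Prod>v\<in>Poly_Mapping.keys m. p v ^ Poly_Mapping.lookup m v))"

lemma polys_in_simps [simp]: "0 \<in> polys_in V" "1 \<in> polys_in V"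
  by (auto simp: polys_in_def)

lemma polys_in_add: "f \<in> polys_in V \<Longrightarrow> g \<in> polys_in V \<Longrightarrow> f + g \<in> polys_in V"
  unfolding polys_in_def using Poly_Mapping.keys_add[of f g] by blast

lemma polys_in_uminus: "f \<in> polys_in V \<Longrightarrow> - f \<in> polys_in V"
  by (simp add: polys_in_def in_keys_iff)

lemma polys_in_mult:
  assumes "f \<in> polys_in V" "g \<in> polys_in V"
  shows "f * g \<in> polys_in V"
proof -
  have "Poly_Mapping.keys m \<subseteq> V" if m: "m \<in> Poly_Mapping.keys (f * g)" for m
  proof -
    obtain a b where "a \<in> Poly_Mapping.keys f" "b \<in> Poly_Mapping.keys g" "m = a + b"
      using m keys_mult[of f g] by blast
    then show ?thesis
      using assms Poly_Mapping.keys_add[of a b] unfolding polys_in_def by blast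
  qed
  then show ?thesis by (simp add: polys_in_def)
qed

lemma cring_poly_ring: "cring (poly_ring V :: ('v, 'k::field) mpoly ring)"
proof (rule cringI)
  show "abelian_group (poly_ring V :: ('v, 'k) mpoly ring)"
  proof (rule abelian_groupI)
    fix x :: "('v, 'k) mpoly"
    assume "x \<in> carrier (poly_ring V)"
    then show "\<exists>y\<in>carrier (poly_ring V). y \<oplus>\<^bsub>poly_ring V\<^esub> x = \<zero>\<^bsub>poly_ring V\<^esub>"
      by (intro bexI[of _ "- x"]) (auto simp: poly_ring_def polys_in_uminus)
  qed (auto simp: poly_ring_def polys_in_add algebra_simps)
  show "comm_monoid (poly_ring V :: ('v, 'k) mpoly ring)"
    by (rule comm_monoidI) (auto simp: poly_ring_def polys_in_mult algebra_simps)
qed (auto simp: poly_ring_def algebra_simps)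


section \<open>Face rings, linear systems of parameters and g-elements\<close>

definition face_ideal :: "'a set \<Rightarrow> 'a set set \<Rightarrow> ('a, 'k::field) mpoly set" where
  "face_ideal E \<Delta> = genideal (poly_ring E) {\<Prod>e\<in>A. var e | A. A \<subseteq> E \<and> A \<notin> \<Delta>}"

definition face_ring :: "'a set \<Rightarrow> 'a set set \<Rightarrow> ('a, 'k::field) mpoly set ring" where
  "face_ring E \<Delta> = poly_ring E Quot face_ideal E \<Delta>"

definition to_face_ring ::
    "'a set \<Rightarrow> 'a set set \<Rightarrow> ('a, 'k::field) mpoly \<Rightarrow> ('a, 'k) mpoly set" where
  "to_face_ring E \<Delta> f = face_ideal E \<Delta> +>\<^bsub>poly_ring E\<^esub> f"

text \<open>
  The rows of the coefficient matrix \<open>K\<close> are \<open>\<theta> 0, \<dots>, \<theta> (r - 1)\<close>. Independence of the columns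
  indexed by a face is that of the family \<open>(K\<^sub>e)\<close>, \<open>e\<close> in the face: two equal columns count as
  dependent.
\<close>

definition is_lsop :: "'a set set \<Rightarrow> nat \<Rightarrow> (nat \<Rightarrow> 'a \<Rightarrow> 'k::field) \<Rightarrow> bool" where
  "is_lsop \<Delta> r \<theta> \<longleftrightarrow>
     (\<forall>F\<in>\<Delta>. \<forall>c. (\<forall>i<r. (\<Sum>e\<in>F. c e * \<theta> i e) = 0) \<longrightarrow> (\<forall>e\<in>F. c e = 0))"

definition param_ideal ::
    "'a set \<Rightarrow> 'a set set \<Rightarrow> nat \<Rightarrow> (nat \<Rightarrow> 'a \<Rightarrow> 'k::field) \<Rightarrow> ('a, 'k) mpoly set set" where
  "param_ideal E \<Delta> r \<theta> =
     genideal (face_ring E \<Delta>) {to_face_ring E \<Delta> (one_form E (\<theta> i)) | i. i < r}"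

definition artinian_reduction ::
    "'a set \<Rightarrow> 'a set set \<Rightarrow> nat \<Rightarrow> (nat \<Rightarrow> 'a \<Rightarrow> 'k::field) \<Rightarrow> ('a, 'k) mpoly set set ring" where
  "artinian_reduction E \<Delta> r \<theta> = face_ring E \<Delta> Quot param_ideal E \<Delta> r \<theta>"

definition to_artinian_reduction ::
    "'a set \<Rightarrow> 'a set set \<Rightarrow> nat \<Rightarrow> (nat \<Rightarrow> 'a \<Rightarrow> 'k::field) \<Rightarrow>
     ('a, 'k) mpoly \<Rightarrow> ('a, 'k) mpoly set set" where
  "to_artinian_reduction E \<Delta> r \<theta> f =
     param_ideal E \<Delta> r \<theta> +>\<^bsub>face_ring E \<Delta>\<^esub> to_face_ring E \<Delta> f"

text \<open>A ring \<open>S\<close> as a module over the source of a ring homomorphism \<open>\<phi>\<close> into \<open>S\<close>.\<close>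

definition module_via :: "('p \<Rightarrow> 's) \<Rightarrow> 's ring \<Rightarrow> ('p, 's) module" where
  "module_via \<phi> S =
     \<lparr>carrier = carrier S, mult = mult S, one = one S, zero = zero S, add = add S,
      smult = (\<lambda>a x. \<phi> a \<otimes>\<^bsub>S\<^esub> x)\<rparr>"

definition reduction_module ::
    "'a set \<Rightarrow> 'a set set \<Rightarrow> nat \<Rightarrow> (nat \<Rightarrow> 'a \<Rightarrow> 'k::field) \<Rightarrow>
     (('a, 'k) mpoly, ('a, 'k) mpoly set set) module" where
  "reduction_module E \<Delta> r \<theta> =
     module_via (to_artinian_reduction E \<Delta> r \<theta>) (artinian_reduction E \<Delta> r \<theta>)"

definition reduction_grading ::
    "'a set \<Rightarrow> 'a set set \<Rightarrow> nat \<Rightarrow> (nat \<Rightarrow> 'a \<Rightarrow> 'k::field) \<Rightarrow> nat \<Rightarrow>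
     ('a, 'k) mpoly set set set" where
  "reduction_grading E \<Delta> r \<theta> i = to_artinian_reduction E \<Delta> r \<theta> ` homogeneous E i"

lemma var_in: "v \<in> V \<Longrightarrow> var v \<in> polys_in V"
  by (simp add: var_def polys_in_def)

lemma const_in: "const c \<in> polys_in V"
  by (simp add: const_def polys_in_def)

lemma polys_in_prod: "(\<And>a. a \<in> A \<Longrightarrow> f a \<in> polys_in V) \<Longrightarrow> prod f A \<in> polys_in V"
  by (induction A rule: infinite_finite_induct) (auto intro: polys_in_mult)

lemma polys_in_sum: "(\<And>a. a \<in> A \<Longrightarrow> f a \<in> polys_in V) \<Longrightarrow> sum f A \<in> polys_in V"
  by (induction A rule: infinite_finite_induct) (auto intro: polys_in_add)

lemma one_form_in: "one_form V a \<in> polys_in V"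
  unfolding one_form_def by (intro polys_in_sum polys_in_mult var_in const_in)

lemma ideal_face_ideal: "ideal (face_ideal E \<Delta>) (poly_ring E :: ('a, 'k::field) mpoly ring)"
  unfolding face_ideal_def
proof (rule ring.genideal_ideal[OF cring.axioms(1)[OF cring_poly_ring]])
  show "{\<Prod>e\<in>A. var e | A. A \<subseteq> E \<and> A \<notin> \<Delta>} \<subseteq> carrier (poly_ring E :: ('a, 'k) mpoly ring)"
    by (clarsimp simp: poly_ring_def) (rule polys_in_prod, rule var_in, auto)
qed

lemma cring_face_ring: "cring (face_ring E \<Delta> :: ('a, 'k::field) mpoly set ring)"
  unfolding face_ring_def by (rule ideal.quotient_is_cring[OF ideal_face_ideal cring_poly_ring])

lemma to_face_ring_hom:
  "to_face_ring E \<Delta> \<in> ring_hom (poly_ring E :: ('a, 'k::field) mpoly ring) (face_ring E \<Delta>)"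
  using ideal.rcos_ring_hom[OF ideal_face_ideal[of E \<Delta>]]
  by (simp add: face_ring_def to_face_ring_def[abs_def])

lemma ideal_param_ideal:
  fixes \<theta> :: "nat \<Rightarrow> 'a \<Rightarrow> 'k::field"
  shows "ideal (param_ideal E \<Delta> r \<theta>) (face_ring E \<Delta>)"
  unfolding param_ideal_def
proof (rule ring.genideal_ideal[OF cring.axioms(1)[OF cring_face_ring]])
  have "to_face_ring E \<Delta> (one_form E (\<theta> i)) \<in> carrier (face_ring E \<Delta>)" for i
    by (rule ring_hom_closed[OF to_face_ring_hom]) (simp add: poly_ring_def one_form_in)
  then show "{to_face_ring E \<Delta> (one_form E (\<theta> i)) | i. i < r} \<subseteq> carrier (face_ring E \<Delta>)"
    by auto
qed

lemma cring_artinian_reduction: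
  fixes \<theta> :: "nat \<Rightarrow> 'a \<Rightarrow> 'k::field"
  shows "cring (artinian_reduction E \<Delta> r \<theta>)"
  unfolding artinian_reduction_def
  by (rule ideal.quotient_is_cring[OF ideal_param_ideal cring_face_ring])

lemma to_artinian_reduction_hom:
  fixes \<theta> :: "nat \<Rightarrow> 'a \<Rightarrow> 'k::field"
  shows "to_artinian_reduction E \<Delta> r \<theta> \<in> ring_hom (poly_ring E) (artinian_reduction E \<Delta> r \<theta>)"
  using ring_hom_trans[OF to_face_ring_hom ideal.rcos_ring_hom[OF ideal_param_ideal[of E \<Delta> r \<theta>]]]
  by (simp add: artinian_reduction_def to_artinian_reduction_def[abs_def] comp_def)

lemma module_via_module:
  assumes "cring R" "cring S" "\<phi> \<in> ring_hom R S"
  shows "Module.module R (module_via \<phi> S)"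
proof -
  interpret R: cring R by fact
  interpret S: cring S by fact
  have cl: "\<phi> a \<in> carrier S" if "a \<in> carrier R" for a
    using ring_hom_closed[OF assms(3) that] .
  show ?thesis
  proof (rule Module.moduleI)
    show "abelian_group (module_via \<phi> S)"
    proof (rule abelian_groupI)
      fix x assume "x \<in> carrier (module_via \<phi> S)"
      then show "\<exists>y\<in>carrier (module_via \<phi> S). y \<oplus>\<^bsub>module_via \<phi> S\<^esub> x = \<zero>\<^bsub>module_via \<phi> S\<^esub>"
        by (intro bexI[of _ "\<ominus>\<^bsub>S\<^esub> x"]) (auto simp: module_via_def S.l_neg)
    qed (auto simp: module_via_def S.a_ac)
  qed (auto simp: module_via_def assms cl ring_hom_add[OF assms(3)] ring_hom_mult[OF assms(3)]
      ring_hom_one[OF assms(3)] S.l_distr S.r_distr S.m_assoc)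
qed

lemma module_reduction_module:
  fixes \<theta> :: "nat \<Rightarrow> 'a \<Rightarrow> 'k::field"
  shows "Module.module (poly_ring E) (reduction_module E \<Delta> r \<theta>)"
  unfolding reduction_module_def
  by (rule module_via_module[OF cring_poly_ring cring_artinian_reduction to_artinian_reduction_hom])

text \<open>
  \<open>N\<close> is a module over \<open>poly_ring E\<close> with graded pieces \<open>gr i\<close>. The top degree is required to
  exist, so nothing is a g-element for the zero module or for a module that is nonzero in
  arbitrarily large degrees.
\<close>

definition top_degree :: "('p, 'n) module \<Rightarrow> (nat \<Rightarrow> 'n set) \<Rightarrow> nat \<Rightarrow> bool" where
  "top_degree N gr d \<longleftrightarrow> gr d \<noteq> {\<zero>\<^bsub>N\<^esub>} \<and> (\<forall>j>d. gr j = {\<zero>\<^bsub>N\<^esub>})"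

definition g_element ::
    "'a set \<Rightarrow> (('a, 'k::field) mpoly, 'n) module \<Rightarrow> (nat \<Rightarrow> 'n set) \<Rightarrow> ('a, 'k) mpoly \<Rightarrow> bool"
  where
  "g_element E N gr \<omega> \<longleftrightarrow>
     \<omega> \<in> homogeneous E 1 \<and>
     (\<exists>d. top_degree N gr d \<and>
        (\<forall>i. 2 * i \<le> d \<longrightarrow>
           (\<lambda>x. (\<omega> ^ (d - 2 * i)) \<odot>\<^bsub>N\<^esub> x) ` gr i \<subseteq> gr (d - i) \<and>
           inj_on (\<lambda>x. (\<omega> ^ (d - 2 * i)) \<odot>\<^bsub>N\<^esub> x) (gr i)))"


section \<open>Zariski topology\<close>

text \<open>The points of \<open>k\<^sup>J\<close> are the functions on \<open>J\<close>, normalised to be \<open>undefined\<close> off \<open>J\<close>.\<close>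

definition affine_space :: "'j set \<Rightarrow> ('j \<Rightarrow> 'k) set" where
  "affine_space J = J \<rightarrow>\<^sub>E UNIV"

definition zero_locus :: "'j set \<Rightarrow> ('j, 'k::field) mpoly set \<Rightarrow> ('j \<Rightarrow> 'k) set" where
  "zero_locus J S = {p \<in> affine_space J. \<forall>f\<in>S. poly_eval p f = 0}"

definition zariski_open :: "'j set \<Rightarrow> ('j \<Rightarrow> 'k::field) set \<Rightarrow> bool" where
  "zariski_open J U \<longleftrightarrow> (\<exists>S\<subseteq>polys_in J. U = affine_space J - zero_locus J S)"

definition zariski_topology :: "'j set \<Rightarrow> ('j \<Rightarrow> 'k::field) topology" where
  "zariski_topology J = topology (zariski_open J)"

lemma poly_eval_superset:
  assumes "finite S" "Poly_Mapping.keys f \<subseteq> S"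
  shows "poly_eval p f =
    (\<Sum>m\<in>S. Poly_Mapping.lookup f m * (\<Prod>v\<in>Poly_Mapping.keys m. p v ^ Poly_Mapping.lookup m v))"
  unfolding poly_eval_def
  by (rule sum.mono_neutral_left) (use assms in \<open>auto simp: in_keys_iff\<close>)

lemma poly_eval_zero [simp]: "poly_eval p 0 = 0"
  by (simp add: poly_eval_def)

lemma poly_eval_one [simp]: "poly_eval p 1 = 1"
  by (simp add: poly_eval_def)

lemma poly_eval_add: "poly_eval p (f + g) = poly_eval p f + poly_eval p g"
proof -
  let ?S = "Poly_Mapping.keys f \<union> Poly_Mapping.keys g"
  have "Poly_Mapping.keys (f + g) \<subseteq> ?S" by (rule Poly_Mapping.keys_add)
  then show ?thesis
    by (simp add: poly_eval_superset[of ?S] lookup_add distrib_right sum.distrib)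
qed

lemma poly_eval_single:
  "poly_eval p (Poly_Mapping.single m c) =
     c * (\<Prod>v\<in>Poly_Mapping.keys m. p v ^ Poly_Mapping.lookup m v)"
  by (simp add: poly_eval_def)

lemma monom_eval_add:
  fixes p :: "'v \<Rightarrow> 'k::field"
  shows "(\<Prod>v\<in>Poly_Mapping.keys (m + n). p v ^ Poly_Mapping.lookup (m + n) v) =
   (\<Prod>v\<in>Poly_Mapping.keys m. p v ^ Poly_Mapping.lookup m v) *
   (\<Prod>v\<in>Poly_Mapping.keys n. p v ^ Poly_Mapping.lookup n v)"
proof -
  let ?S = "Poly_Mapping.keys m \<union> Poly_Mapping.keys n"
  have *: "(\<Prod>v\<in>Poly_Mapping.keys q. p v ^ Poly_Mapping.lookup q v) =
      (\<Prod>v\<in>?S. p v ^ Poly_Mapping.lookup q v)" if "Poly_Mapping.keys q \<subseteq> ?S" for q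
    by (rule prod.mono_neutral_left) (use that in \<open>auto simp: in_keys_iff\<close>)
  show ?thesis
    unfolding *[OF Poly_Mapping.keys_add] *[OF Un_upper1] *[OF Un_upper2]
    by (simp add: lookup_add power_add prod.distrib)
qed

lemma mpoly_induct [case_names zero add]:
  assumes "P 0" "\<And>m c f. P f \<Longrightarrow> P (Poly_Mapping.single m c + f)"
  shows "P (f :: ('v, 'k::field) mpoly)"
proof (induction "Poly_Mapping.keys f" arbitrary: f rule: infinite_finite_induct)
  case (insert m A)
  let ?g = "f - Poly_Mapping.single m (Poly_Mapping.lookup f m)"
  have "Poly_Mapping.keys ?g = Poly_Mapping.keys f - {m}"
    by (auto simp: in_keys_iff lookup_minus lookup_single when_def split: if_splits)
  then have "A = Poly_Mapping.keys ?g" using insert.hyps by auto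
  then have "P ?g" by (rule insert.hyps(3))
  from assms(2)[OF this, of m "Poly_Mapping.lookup f m"] show ?case by simp
next
  case empty
  then have "f = 0" by (metis keys_eq_empty)
  with assms(1) show ?case by simp
qed auto

lemma poly_eval_mult: "poly_eval p (f * g) = poly_eval p f * poly_eval p g"
proof (induction f rule: mpoly_induct)
  case (add m c f)
  have "poly_eval p (Poly_Mapping.single m c * g) =
      poly_eval p (Poly_Mapping.single m c) * poly_eval p g"
  proof (induction g rule: mpoly_induct)
    case (add n d g)
    then show ?case
      by (simp add: distrib_left poly_eval_add mult_single poly_eval_single monom_eval_add)
  qed simp
  with add show ?case by (simp add: distrib_right poly_eval_add)
qed simp

lemma istopology_zariski: "istopology (zariski_open J)"
  unfolding istopology_def
proof (intro conjI allI impI)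
  fix U W :: "('a \<Rightarrow> 'b) set"
  assume U: "zariski_open J U" and W: "zariski_open J W"
  from U obtain S where S: "S \<subseteq> polys_in J" "U = affine_space J - zero_locus J S"
    unfolding zariski_open_def by (elim exE conjE)
  from W obtain T where T: "T \<subseteq> polys_in J" "W = affine_space J - zero_locus J T"
    unfolding zariski_open_def by (elim exE conjE)
  let ?P = "(\<lambda>(f, g). f * g) ` (S \<times> T)"
  have "?P \<subseteq> polys_in J"
    by (clarify, rule polys_in_mult) (use S(1) T(1) in \<open>auto dest: subsetD\<close>)
  moreover have "U \<inter> W = affine_space J - zero_locus J ?P"
    unfolding S(2) T(2) zero_locus_def by (auto simp: poly_eval_mult)
  ultimately show "zariski_open J (U \<inter> W)"
    unfolding zariski_open_def by (intro exI[of _ ?P] conjI)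
next
  fix \<U> :: "('a \<Rightarrow> 'b) set set"
  assume "\<forall>U\<in>\<U>. zariski_open J U"
  then have "\<exists>S. \<forall>U\<in>\<U>. S U \<subseteq> polys_in J \<and> U = affine_space J - zero_locus J (S U)"
    unfolding zariski_open_def by (rule bchoice)
  then obtain S where
    "\<forall>U\<in>\<U>. S U \<subseteq> polys_in J \<and> U = affine_space J - zero_locus J (S U)" ..
  then have S: "\<And>U. U \<in> \<U> \<Longrightarrow> S U \<subseteq> polys_in J"
    "\<And>U. U \<in> \<U> \<Longrightarrow> U = affine_space J - zero_locus J (S U)"
    by (simp_all add: Ball_def)
  have "\<Union>\<U> = (\<Union>U\<in>\<U>. affine_space J - zero_locus J (S U))"
    using S(2) by auto
  also have "\<dots> = affine_space J - zero_locus J (\<Union>U\<in>\<U>. S U)"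
    unfolding zero_locus_def by blast
  finally show "zariski_open J (\<Union>\<U>)"
    using S(1) unfolding zariski_open_def
    by (intro exI[of _ "\<Union>U\<in>\<U>. S U"] conjI UN_least)
qed

lemma openin_zariski: "openin (zariski_topology J) U \<longleftrightarrow> zariski_open J U"
  by (simp add: zariski_topology_def topology_inverse'[OF istopology_zariski])

lemma topspace_zariski: "topspace (zariski_topology J) = affine_space J"
proof -
  have "zariski_open J (affine_space J :: ('a \<Rightarrow> 'b) set)"
    unfolding zariski_open_def zero_locus_def by (rule exI[of _ "{1}"]) auto
  moreover have "U \<subseteq> affine_space J" if "zariski_open J U" for U :: "('a \<Rightarrow> 'b) set"
    using that unfolding zariski_open_def by blast
  ultimately show ?thesis unfolding topspace_def openin_zariski by blast
qed


text \<open>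
  A pair \<open>(\<Theta>, \<omega>)\<close> is an \<open>n \<times> (r + 1)\<close> matrix \<open>p\<close> with entries indexed by \<open>E \<times> {0, \<dots>, r}\<close>; its
  columns \<open>0, \<dots>, r - 1\<close> are \<open>\<theta>\<^sub>1, \<dots>, \<theta>\<^sub>r\<close> and its column \<open>r\<close> is \<open>\<omega>\<close>.
\<close>

definition lsop_g_element_set ::
    "'a set \<Rightarrow> ('a set \<Rightarrow> bool) \<Rightarrow> nat \<Rightarrow> ('a \<times> nat \<Rightarrow> 'k::field) set" where
  "lsop_g_element_set E indep r =
     {p \<in> affine_space (E \<times> {..r}).
        let \<Delta> = independence_complex E indep;
            \<theta> = (\<lambda>i e. p (e, i));
            \<omega> = one_form E (\<lambda>e. p (e, r))
        in is_lsop \<Delta> r \<theta> \<and>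
           g_element E (reduction_module E \<Delta> r \<theta>) (reduction_grading E \<Delta> r \<theta>) \<omega>}"

end

theory Submission
  imports Defs "Jordan_Normal_Form.Determinant"
begin

text \<open>
  All complexes in the argument are matroid complexes of rank \<open>r\<close> on the same set \<open>E\<close>, with coloops
  (cone points) allowed, so that the same pair \<open>(\<Theta>, \<omega>)\<close> can be used throughout. For a face \<open>S\<close> of
  \<open>D\<close> the star of \<open>S\<close> and the faces not containing \<open>S\<close> give an exact sequence
  \[0 \to k[star D S](-|S|) \to k[D] \to k[avoiding D S] \to 0.\]
  If the Koszul relations generate the syzygies of \<open>\<Theta>\<close> on both ends then they do so in the middle, and
  the sequence stays exact modulo \<open>\<Theta>\<close>. By deletion and contraction down to a simplex this holds for every
  l.s.o.p., and the reduction has a monomial basis independent of \<open>\<Theta>\<close>. Hence both being an l.s.o.p. and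
  injectivity of the powers of \<open>\<omega>\<close> are spanning conditions, which are open.

  For non-emptiness take \<open>S\<close> to be a series class. If \<open>S\<close> is independent, the star gains exactly the
  cone points \<open>S\<close> and the other complex gains none, so a pair that is good for both ends is good for \<open>D\<close>;
  non-empty open sets meet. If every series class is dependent, \<open>D\<close> is a join of boundaries of simplices
  and a simplex. An explicit \<open>\<Theta>\<close> turns the reduction into \<open>k[y\<^sub>1, \<dots>, y\<^sub>m]\<close> modulo powers of the
  variables, where the sum of the variables is a g-element by an sl2 commutator argument.
\<close>

section \<open>Coefficients, projections and monomial ideals\<close>

text \<open>Single elements suffice for the Koszul relations but not for the g-element: deleting
  \<open>e\<close> turns everything in series with \<open>e\<close> into cone points, and each cone
  point lowers the top degree by one, so the largest power of \<omega> would be zero there. Removing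
  a whole series class keeps the top degree. On the star, the monomial of \<open>S\<close> shifts
  degrees by \<open>card S\<close> while the bound falls from \<open>t\<close> to
  \<open>t - card S\<close>; the middle degree thereby moves up, so injectivity below the middle of
  the star covers all that is needed. The reductions need not have symmetric Hilbert functions, so
  injectivity alone is carried along, never bijectivity.

  Regularity of the parameters enters only as vanishing of the first Koszul homology H_1, which an
  extension inherits from its two ends and which makes the connecting map zero. A basis common to
  all parameters fixes the dimensions of the graded pieces, so injectivity amounts to spanning
  together with a fixed set of extra monomials. Being an l.s.o.p. is itself detected by the
  vanishing of degree \<open>r + 1\<close>.\<close>

abbreviation "keys \<equiv> Poly_Mapping.keys"
abbreviation "lookup \<equiv> Poly_Mapping.lookup"
abbreviation "single \<equiv> Poly_Mapping.single"

lemma keys_add_nat: "keys (m + n) = keys m \<union> keys (n :: 'v \<Rightarrow>\<^sub>0 nat)"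
  by (auto simp: in_keys_iff lookup_add)

text \<open>Subtraction of exponent vectors truncates at zero, so divisibility is stated
  coordinatewise; under it \<open>n - m\<close> is a true quotient of monomials.\<close>

lemma add_eq_iff_diff:
  fixes m n q :: "'v \<Rightarrow>\<^sub>0 nat"
  shows "m + q = n \<longleftrightarrow> (\<forall>v. lookup m v \<le> lookup n v) \<and> q = n - m"
proof -
  have "a + q = b \<longleftrightarrow> a \<le> b \<and> q = b - a" for a b q :: nat by arith
  then show ?thesis by (simp add: poly_mapping_eq_iff fun_eq_iff lookup_add lookup_minus all_conj_distrib)
qed

lemma lookup_single_mult:
  "lookup (single m c * f) n =
    (if \<forall>v. lookup m v \<le> lookup n v then c * lookup f (n - m) else 0)"
  for f :: "('v, 'k::field) mpoly"
proof (induction f rule: mpoly_induct)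
  case (add q d f)
  have "lookup (single m c * single q d) n =
      (if \<forall>v. lookup m v \<le> lookup n v then c * lookup (single q d) (n - m) else 0)"
    by (auto simp: mult_single lookup_single when_def add_eq_iff_diff)
  with add show ?case by (simp add: distrib_left lookup_add)
qed simp

lemma lookup_single_mult_add:
  "lookup (single m c * f) (m + n) = c * lookup f n" for f :: "('v, 'k::field) mpoly"
  by (simp add: lookup_single_mult lookup_add)

lemma keys_single_mult: "keys (single m 1 * f) = (+) m ` keys f" for f :: "('v, 'k::field) mpoly"
proof -
  have "n \<in> (+) m ` keys f" if "n \<in> keys (single m 1 * f)" for n
  proof -
    have "\<forall>v. lookup m v \<le> lookup n v" "n - m \<in> keys f"
      using that by (auto simp: in_keys_iff lookup_single_mult split: if_splits)
    moreover have "m + (n - m) = n" using calculation(1) add_eq_iff_diff by blast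
    ultimately show ?thesis by (metis image_eqI)
  qed
  then show ?thesis by (auto simp: in_keys_iff lookup_single_mult_add)
qed

lemma lookup_const_mult: "lookup (const c * f) n = c * lookup f n"
  by (simp add: const_def lookup_single_mult)

lemma lookup_var_mult:
  "lookup (var v * f) n = (if v \<in> keys n then lookup f (n - single v 1) else 0)"
  for f :: "('v, 'k::field) mpoly"
  by (auto simp: var_def lookup_single_mult lookup_single when_def in_keys_iff)

lemma lookup_one_form_mult:
  "lookup (one_form E a * f) n =
    (\<Sum>e\<in>E. a e * (if e \<in> keys n then lookup f (n - single e 1) else 0))"
  by (simp add: one_form_def sum_distrib_right lookup_sum mult.assoc lookup_const_mult
      lookup_var_mult)

lemma poly_sum_monomials: "f = (\<Sum>n\<in>keys f. single n (lookup f n))"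
  by (rule poly_mapping_eqI) (auto simp: lookup_sum lookup_single when_def in_keys_iff)

lemma total_degree_superset:
  "finite A \<Longrightarrow> keys m \<subseteq> A \<Longrightarrow> total_degree_monom m = (\<Sum>v\<in>A. lookup m v)"
  unfolding total_degree_monom_def by (rule sum.mono_neutral_left) (auto simp: in_keys_iff)

lemma total_degree_add: "total_degree_monom (m + n) = total_degree_monom m + total_degree_monom n"
  using total_degree_superset[of "keys m \<union> keys n"]
  by (simp add: keys_add_nat lookup_add sum.distrib)

lemma total_degree_single [simp]: "total_degree_monom (single v k) = k"
  by (cases "k = 0") (simp_all add: total_degree_monom_def)

lemma total_degree_zero [simp]: "total_degree_monom 0 = 0"
  by (simp add: total_degree_monom_def)

lemma diff_single_add: "v \<in> keys n \<Longrightarrow> single v 1 + (n - single v 1) = n" for n :: "'v \<Rightarrow>\<^sub>0 nat"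
  using add_eq_iff_diff[of "single v 1" "n - single v 1" n]
  by (simp add: lookup_single when_def in_keys_iff)

section \<open>Homogeneous components\<close>

definition poly_filter :: "(('v \<Rightarrow>\<^sub>0 nat) \<Rightarrow> bool) \<Rightarrow> ('v, 'k::field) mpoly \<Rightarrow> ('v, 'k) mpoly" where
  "poly_filter P f = Abs_poly_mapping (\<lambda>n. if P n then lookup f n else 0)"

lemma lookup_poly_filter: "lookup (poly_filter P f) n = (if P n then lookup f n else 0)"
proof -
  have "finite {n. (if P n then lookup f n else 0) \<noteq> 0}"
    by (rule finite_subset[of _ "keys f"]) (auto simp: in_keys_iff split: if_splits)
  then show ?thesis by (simp add: poly_filter_def)
qed

lemma keys_poly_filter: "keys (poly_filter P f) = {n \<in> keys f. P n}"
  by (auto simp: in_keys_iff lookup_poly_filter split: if_splits)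

lemma poly_filter_split: "f = poly_filter P f + poly_filter (\<lambda>n. \<not> P n) f"
  by (rule poly_mapping_eqI) (simp add: lookup_add lookup_poly_filter)

text \<open>Polynomials of this type may involve variables outside \<open>E\<close>; dropping those
  monomials as well puts every component into \<open>homogeneous E j\<close>, whatever the
  input.\<close>

definition hpart :: "'v set \<Rightarrow> nat \<Rightarrow> ('v, 'k::field) mpoly \<Rightarrow> ('v, 'k) mpoly" where
  "hpart E j = poly_filter (\<lambda>n. keys n \<subseteq> E \<and> total_degree_monom n = j)"

lemma lookup_hpart:
  "lookup (hpart E j f) n = (if keys n \<subseteq> E \<and> total_degree_monom n = j then lookup f n else 0)"
  by (simp add: hpart_def lookup_poly_filter)

lemma hpart_add: "hpart E j (f + g) = hpart E j f + hpart E j g"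
  by (rule poly_mapping_eqI) (simp add: lookup_add lookup_hpart)

lemma hpart_diff: "hpart E j (f - g) = hpart E j f - hpart E j g"
  by (rule poly_mapping_eqI) (simp add: lookup_minus lookup_hpart)

lemma hpart_zero [simp]: "hpart E j 0 = 0"
  by (rule poly_mapping_eqI) (simp add: lookup_hpart)

lemma hpart_sum: "hpart E j (\<Sum>x\<in>A. f x) = (\<Sum>x\<in>A. hpart E j (f x))"
  by (induction A rule: infinite_finite_induct) (auto simp: hpart_add)

lemma homogeneous_iff:
  "f \<in> homogeneous E j \<longleftrightarrow> (\<forall>n\<in>keys f. keys n \<subseteq> E \<and> total_degree_monom n = j)"
  by (auto simp: homogeneous_def polys_in_def)

lemma hpart_homogeneous: "hpart E j f \<in> homogeneous E j"
  by (auto simp: homogeneous_iff hpart_def keys_poly_filter)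

lemma hpart_id: "f \<in> homogeneous E j \<Longrightarrow> hpart E j f = f"
  by (rule poly_mapping_eqI) (auto simp: homogeneous_iff lookup_hpart in_keys_iff)

lemma homogeneous_add: "f \<in> homogeneous E j \<Longrightarrow> g \<in> homogeneous E j \<Longrightarrow> f + g \<in> homogeneous E j"
  by (metis hpart_add hpart_homogeneous hpart_id)

lemma homogeneous_diff: "f \<in> homogeneous E j \<Longrightarrow> g \<in> homogeneous E j \<Longrightarrow> f - g \<in> homogeneous E j"
  by (metis hpart_diff hpart_homogeneous hpart_id)

lemma homogeneous_zero [simp]: "0 \<in> homogeneous E j"
  by (metis hpart_homogeneous hpart_zero)

lemma homogeneous_sum: "(\<And>x. x \<in> A \<Longrightarrow> f x \<in> homogeneous E j) \<Longrightarrow> sum f A \<in> homogeneous E j"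
  by (induction A rule: infinite_finite_induct) (auto intro: homogeneous_add)

lemma homogeneous_mult:
  assumes "f \<in> homogeneous E i" "g \<in> homogeneous E j"
  shows "f * g \<in> homogeneous E (i + j)"
proof -
  have "keys n \<subseteq> E \<and> total_degree_monom n = i + j" if n: "n \<in> keys (f * g)" for n
  proof -
    obtain a b where "a \<in> keys f" "b \<in> keys g" "n = a + b"
      using n keys_mult[of f g] by blast
    with assms show ?thesis by (auto simp: homogeneous_iff keys_add_nat total_degree_add)
  qed
  then show ?thesis by (simp add: homogeneous_iff)
qed

lemma homogeneous_single:
  "keys n \<subseteq> E \<Longrightarrow> total_degree_monom n = j \<Longrightarrow> single n c \<in> homogeneous E j"
  by (auto simp: homogeneous_iff)

lemma homogeneous_const_mult: "f \<in> homogeneous E j \<Longrightarrow> const c * f \<in> homogeneous E j"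
  by (auto simp: homogeneous_iff in_keys_iff lookup_const_mult)

lemma one_form_homogeneous: "one_form E a \<in> homogeneous E 1"
  unfolding one_form_def var_def
  by (intro homogeneous_sum homogeneous_const_mult homogeneous_single) auto

lemma homogeneous_power: "f \<in> homogeneous E 1 \<Longrightarrow> f ^ k \<in> homogeneous E k"
proof (induction k)
  case 0
  have "(1 :: ('a, 'b) mpoly) = single 0 1" by simp
  then show ?case by (metis homogeneous_single keys_zero empty_subsetI total_degree_zero power_0)
next
  case (Suc k)
  then show ?case using homogeneous_mult[of f E 1 "f ^ k" k] by simp
qed

text \<open>Dividing a monomial by a variable of \<open>E\<close> lowers the degree by one and does
  not change whether all its variables lie in \<open>E\<close>.\<close>

lemma hpart_Suc_mult:
  assumes "t = one_form E a"
  shows "hpart E (Suc j) (t * f) = t * hpart E j f"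
proof (rule poly_mapping_eqI)
  fix n :: "'a \<Rightarrow>\<^sub>0 nat"
  have *: "keys n \<subseteq> E \<and> total_degree_monom n = Suc j \<longleftrightarrow>
      keys (n - single e 1) \<subseteq> E \<and> total_degree_monom (n - single e 1) = j"
    if "e \<in> E" "e \<in> keys n" for e
    using diff_single_add[OF that(2)] keys_add_nat[of "single e 1" "n - single e 1"]
      total_degree_add[of "single e 1" "n - single e 1"] that(1) by auto
  have "lookup (t * hpart E j f) n = (\<Sum>e\<in>E. a e * (if e \<in> keys n then
      if keys n \<subseteq> E \<and> total_degree_monom n = Suc j then lookup f (n - single e 1) else 0 else 0))"
    unfolding lookup_hpart assms lookup_one_form_mult using * by (auto intro!: sum.cong)
  also have "\<dots> = lookup (hpart E (Suc j) (t * f)) n"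
    unfolding lookup_hpart assms lookup_one_form_mult
    by (cases "keys n \<subseteq> E \<and> total_degree_monom n = Suc j")
      (auto intro!: sum.cong sum.neutral)
  finally show "lookup (hpart E (Suc j) (t * f)) n = lookup (t * hpart E j f) n" ..
qed

lemma hpart_0_mult:
  assumes "t = one_form E a"
  shows "hpart E 0 (t * f) = 0"
proof (rule poly_mapping_eqI)
  fix n :: "'a \<Rightarrow>\<^sub>0 nat"
  have "n = 0" if "total_degree_monom n = 0"
    using that by (intro poly_mapping_eqI) (auto simp: total_degree_monom_def in_keys_iff)
  then show "lookup (hpart E 0 (t * f)) n = lookup 0 n"
    unfolding lookup_hpart assms lookup_one_form_mult by auto
qed

lemma var_as_one_form:
  assumes "finite E" "e \<in> E"
  shows "var e = one_form E (\<lambda>x. if x = e then 1 else 0)"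
proof -
  have "const (if x = e then 1 else 0) * var x = (if x = e then var e else 0 :: ('a, 'b) mpoly)" for x
    by (simp add: const_def)
  then show ?thesis using assms by (simp add: one_form_def)
qed

definition mon_of :: "'v set \<Rightarrow> ('v \<Rightarrow>\<^sub>0 nat)" where
  "mon_of S = (\<Sum>e\<in>S. single e 1)"

lemma lookup_mon_of: "finite S \<Longrightarrow> lookup (mon_of S) v = (if v \<in> S then 1 else 0)"
  by (simp add: mon_of_def lookup_sum lookup_single when_def)

lemma keys_mon_of: "finite S \<Longrightarrow> keys (mon_of S) = S"
  by (auto simp: in_keys_iff lookup_mon_of split: if_splits)

lemma total_degree_mon_of: "finite S \<Longrightarrow> total_degree_monom (mon_of S) = card S"
  by (simp add: total_degree_monom_def keys_mon_of lookup_mon_of)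

lemma prod_var: "finite S \<Longrightarrow> (\<Prod>e\<in>S. var e) = (single (mon_of S) 1 :: ('v, 'k::field) mpoly)"
  by (induction S rule: finite_induct) (simp_all add: mon_of_def var_def mult_single)

text \<open>Each variable is a one-form, so \<open>hpart_Suc_mult\<close> and
  \<open>hpart_0_mult\<close> apply once for every element of \<open>S\<close>.\<close>

lemma hpart_prod_var_mult:
  assumes "finite E" "S \<subseteq> E"
  shows "hpart E j ((\<Prod>e\<in>S. var e) * f) =
    (if card S \<le> j then (\<Prod>e\<in>S. var e) * hpart E (j - card S) f else 0)"
proof -
  have "finite S" using assms finite_subset by blast
  then show ?thesis using assms(2)
  proof (induction S arbitrary: j rule: finite_induct)
    case (insert e S)
    have v: "var e = (one_form E (\<lambda>x. if x = e then 1 else 0) :: ('a, 'b) mpoly)"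
      using var_as_one_form[OF assms(1)] insert.prems by blast
    show ?case
    proof (cases j)
      case 0
      then show ?thesis using insert hpart_0_mult[OF v] by (simp add: mult.assoc)
    next
      case (Suc i)
      then show ?thesis using insert hpart_Suc_mult[OF v] by (auto simp: mult.assoc)
    qed
  qed simp
qed

section \<open>Face ideals, stars and avoiding complexes\<close>

definition down_closed :: "'v set set \<Rightarrow> bool" where
  "down_closed D \<longleftrightarrow> (\<forall>F\<in>D. \<forall>G\<subseteq>F. G \<in> D)"

text \<open>The Stanley-Reisner ideal, described by supports, in the ring on all variables of the
  type. When the faces lie in \<open>E\<close> it contains every variable outside \<open>E\<close>,
  so the quotient is that of the ring on \<open>E\<close>.\<close>

definition nonface_ideal :: "'v set set \<Rightarrow> ('v, 'k::field) mpoly set" where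
  "nonface_ideal D = {f. \<forall>n\<in>keys f. keys n \<notin> D}"

lemma nonface_ideal_iff: "f \<in> nonface_ideal D \<longleftrightarrow> (\<forall>n. keys n \<in> D \<longrightarrow> lookup f n = 0)"
  by (auto simp: nonface_ideal_def in_keys_iff)

lemma nonface_ideal_zero [simp]: "0 \<in> nonface_ideal D"
  by (simp add: nonface_ideal_def)

lemma nonface_ideal_add: "f \<in> nonface_ideal D \<Longrightarrow> g \<in> nonface_ideal D \<Longrightarrow> f + g \<in> nonface_ideal D"
  by (simp add: nonface_ideal_iff lookup_add)

lemma nonface_ideal_diff: "f \<in> nonface_ideal D \<Longrightarrow> g \<in> nonface_ideal D \<Longrightarrow> f - g \<in> nonface_ideal D"
  by (simp add: nonface_ideal_iff lookup_minus)

lemma nonface_ideal_sum: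
  "(\<And>x. x \<in> A \<Longrightarrow> f x \<in> nonface_ideal D) \<Longrightarrow> sum f A \<in> nonface_ideal D"
  by (induction A rule: infinite_finite_induct) (auto intro: nonface_ideal_add)

lemma nonface_ideal_mult:
  assumes "down_closed D" "f \<in> nonface_ideal D"
  shows "g * f \<in> nonface_ideal D" "f * g \<in> nonface_ideal D"
proof -
  have "keys n \<notin> D" if n: "n \<in> keys (f * g)" for n
  proof -
    obtain a b where "a \<in> keys f" "n = a + b"
      using n keys_mult[of f g] by blast
    with assms show ?thesis by (auto simp: keys_add_nat nonface_ideal_def down_closed_def)
  qed
  then show "f * g \<in> nonface_ideal D" by (simp add: nonface_ideal_def)
  then show "g * f \<in> nonface_ideal D" by (simp add: mult.commute)
qed

lemma nonface_ideal_mono: "D \<subseteq> D' \<Longrightarrow> nonface_ideal D' \<subseteq> nonface_ideal D"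
  by (auto simp: nonface_ideal_def)

lemma nonface_ideal_hpart: "f \<in> nonface_ideal D \<Longrightarrow> hpart E j f \<in> nonface_ideal D"
  by (simp add: nonface_ideal_iff lookup_hpart)

text \<open>For a matroid and a face \<open>S\<close> this is the contraction of \<open>S\<close>
  with \<open>S\<close> added back as coloops, which keeps both \<open>E\<close> and the
  rank.\<close>

definition star :: "'v set set \<Rightarrow> 'v set \<Rightarrow> 'v set set" where
  "star D S = {F. F \<union> S \<in> D}"

text \<open>The complex of the quotient by the monomial of \<open>S\<close>. For a single element it
  is the deletion, with the element kept as a loop.\<close>

definition avoiding :: "'v set set \<Rightarrow> 'v set \<Rightarrow> 'v set set" where
  "avoiding D S = {F \<in> D. \<not> S \<subseteq> F}"

lemma down_closed_star: "down_closed D \<Longrightarrow> down_closed (star D S)"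
  unfolding down_closed_def star_def by (metis (mono_tags) Un_mono mem_Collect_eq order_refl)

lemma down_closed_avoiding: "down_closed D \<Longrightarrow> down_closed (avoiding D S)"
  unfolding down_closed_def avoiding_def by blast

lemma star_subset: "down_closed D \<Longrightarrow> star D S \<subseteq> D"
  unfolding down_closed_def star_def by blast

lemma avoiding_subset: "avoiding D S \<subseteq> D"
  unfolding avoiding_def by blast

text \<open>Multiplying by the monomial of \<open>S\<close> adds \<open>S\<close> to every support:
  the colon of the face ideal by this monomial is the face ideal of the star. This is exactness on
  the left.\<close>

lemma prod_var_mult_nonface_iff:
  assumes "finite S"
  shows "(\<Prod>e\<in>S. var e) * f \<in> nonface_ideal D \<longleftrightarrow> f \<in> nonface_ideal (star D S)"
  by (auto simp: prod_var[OF assms] nonface_ideal_def keys_single_mult keys_add_nat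
      keys_mon_of[OF assms] star_def Un_commute)

text \<open>Split off the terms whose support contains \<open>S\<close>; they are divisible by its
  monomial. Any other support that were a face of \<open>D\<close> would be a face of
  \<open>avoiding D S\<close>.\<close>

lemma nonface_ideal_avoiding:
  assumes "finite S" "f \<in> nonface_ideal (avoiding D S)"
  shows "\<exists>h. f - (\<Prod>e\<in>S. var e) * h \<in> nonface_ideal D"
proof -
  let ?P = "\<lambda>n. S \<subseteq> keys n"
  let ?u = "poly_filter ?P f"
  have *: "(\<Prod>e\<in>S. var e) * single (n - mon_of S) (lookup ?u n) = single n (lookup ?u n)"
    if "n \<in> keys ?u" for n
  proof -
    have "S \<subseteq> keys n" using that by (simp add: keys_poly_filter)
    then have "\<forall>v. lookup (mon_of S) v \<le> lookup n v"
      by (auto simp: lookup_mon_of[OF assms(1)] in_keys_iff Suc_le_eq)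
    then have "mon_of S + (n - mon_of S) = n" using add_eq_iff_diff by blast
    then show ?thesis by (simp add: prod_var[OF assms(1)] mult_single)
  qed
  let ?h = "\<Sum>n\<in>keys ?u. single (n - mon_of S) (lookup ?u n)"
  have "(\<Prod>e\<in>S. var e) * ?h = ?u"
    using * poly_sum_monomials[of ?u] by (simp add: sum_distrib_left)
  moreover have "f - ?u = poly_filter (\<lambda>n. \<not> ?P n) f"
    using poly_filter_split[of f ?P] by (metis add_diff_cancel_left')
  moreover have "\<dots> \<in> nonface_ideal D"
    using assms(2) by (auto simp: nonface_ideal_def keys_poly_filter avoiding_def)
  ultimately have "f - (\<Prod>e\<in>S. var e) * ?h \<in> nonface_ideal D" by simp
  then show ?thesis ..
qed

text \<open>The preimage in the polynomial ring of the ideal that \<open>T\<close> generates in the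
  face ring of \<open>D\<close>. The cofactors \<open>g\<close> are arbitrary, possibly with
  variables outside \<open>E\<close>.\<close>

definition rel_ideal :: "'v set set \<Rightarrow> nat \<Rightarrow> (nat \<Rightarrow> ('v, 'k::field) mpoly) \<Rightarrow> ('v, 'k) mpoly set" where
  "rel_ideal D r T = {f. \<exists>g. f - (\<Sum>l<r. T l * g l) \<in> nonface_ideal D}"

lemma rel_idealI: "f - (\<Sum>l<r. T l * g l) \<in> nonface_ideal D \<Longrightarrow> f \<in> rel_ideal D r T"
  by (auto simp: rel_ideal_def)

lemma rel_idealE:
  assumes "f \<in> rel_ideal D r T"
  obtains g where "f - (\<Sum>l<r. T l * g l) \<in> nonface_ideal D"
  using assms by (auto simp: rel_ideal_def)

lemma nonface_rel_ideal: "f \<in> nonface_ideal D \<Longrightarrow> f \<in> rel_ideal D r T"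
  by (rule rel_idealI[where g = "\<lambda>_. 0"]) simp

lemma zero_rel_ideal [simp]: "0 \<in> rel_ideal D r T"
  by (simp add: nonface_rel_ideal)

lemma rel_ideal_add:
  assumes "f \<in> rel_ideal D r T" "g \<in> rel_ideal D r T"
  shows "f + g \<in> rel_ideal D r T"
proof -
  obtain u v where "f - (\<Sum>l<r. T l * u l) \<in> nonface_ideal D" "g - (\<Sum>l<r. T l * v l) \<in> nonface_ideal D"
    using assms by (auto simp: rel_ideal_def)
  from nonface_ideal_add[OF this] show ?thesis
    by (intro rel_idealI[where g = "\<lambda>l. u l + v l"]) (simp add: algebra_simps sum.distrib)
qed

lemma rel_ideal_mult:
  assumes "down_closed D" "f \<in> rel_ideal D r T"
  shows "g * f \<in> rel_ideal D r T"
proof -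
  obtain u where "f - (\<Sum>l<r. T l * u l) \<in> nonface_ideal D"
    using assms by (auto simp: rel_ideal_def)
  from nonface_ideal_mult(1)[OF assms(1) this, of g] show ?thesis
    by (intro rel_idealI[where g = "\<lambda>l. g * u l"])
      (simp add: algebra_simps sum_distrib_left)
qed

lemma rel_ideal_uminus: "f \<in> rel_ideal D r T \<Longrightarrow> - f \<in> rel_ideal D r T"
proof -
  assume "f \<in> rel_ideal D r T"
  then obtain u where "f - (\<Sum>l<r. T l * u l) \<in> nonface_ideal D"
    by (auto simp: rel_ideal_def)
  from nonface_ideal_diff[OF nonface_ideal_zero this] show ?thesis
    by (intro rel_idealI[where g = "\<lambda>l. - u l"]) (simp add: sum_negf algebra_simps)
qed

lemma rel_ideal_diff: "f \<in> rel_ideal D r T \<Longrightarrow> g \<in> rel_ideal D r T \<Longrightarrow> f - g \<in> rel_ideal D r T"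
  using rel_ideal_add[of f D r T "- g"] rel_ideal_uminus[of g D r T] by simp

lemma rel_ideal_sum:
  "(\<And>x. x \<in> A \<Longrightarrow> f x \<in> rel_ideal D r T) \<Longrightarrow> sum f A \<in> rel_ideal D r T"
  by (induction A rule: infinite_finite_induct) (auto intro: rel_ideal_add)

lemma rel_ideal_mono: "D \<subseteq> D' \<Longrightarrow> rel_ideal D' r T \<subseteq> rel_ideal D r T"
  using nonface_ideal_mono[of D D'] unfolding rel_ideal_def by blast

lemma generator_rel_ideal: "l < r \<Longrightarrow> T l \<in> rel_ideal D r T"
proof (rule rel_idealI[where g = "\<lambda>j. if j = l then 1 else 0"])
  assume "l < r"
  have "(\<Sum>j<r. T j * (if j = l then 1 else 0)) = (\<Sum>j<r. if j = l then T l else 0)"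
    by (rule sum.cong) auto
  with \<open>l < r\<close> show "T l - (\<Sum>j<r. T j * (if j = l then 1 else 0)) \<in> nonface_ideal D"
    by simp
qed

text \<open>The forms have degree one, so a homogeneous component uses cofactors of one degree less,
  and in degree zero the forms contribute nothing.\<close>

lemma hpart_rel_ideal:
  assumes T: "\<And>l. l < r \<Longrightarrow> T l = one_form E (\<theta> l)"
    and f: "f - (\<Sum>l<r. T l * g l) \<in> nonface_ideal D"
  shows "hpart E (Suc j) f - (\<Sum>l<r. T l * hpart E j (g l)) \<in> nonface_ideal D"
    "hpart E 0 f \<in> nonface_ideal D"
proof -
  show "hpart E (Suc j) f - (\<Sum>l<r. T l * hpart E j (g l)) \<in> nonface_ideal D"
    using nonface_ideal_hpart[OF f, of E "Suc j"] hpart_Suc_mult[OF T]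
    by (simp add: hpart_diff hpart_sum)
  show "hpart E 0 f \<in> nonface_ideal D"
    using nonface_ideal_hpart[OF f, of E 0] hpart_0_mult[OF T]
    by (simp add: hpart_diff hpart_sum)
qed

lemma rel_ideal_hpart:
  assumes "\<And>l. l < r \<Longrightarrow> T l = one_form E (\<theta> l)" "f \<in> rel_ideal D r T"
  shows "hpart E j f \<in> rel_ideal D r T"
proof -
  obtain g where g: "f - (\<Sum>l<r. T l * g l) \<in> nonface_ideal D"
    using assms(2) by (rule rel_idealE)
  show ?thesis
  proof (cases j)
    case 0
    then show ?thesis using nonface_rel_ideal[OF hpart_rel_ideal(2)[OF assms(1) g]] by simp
  next
    case (Suc i)
    then show ?thesis using rel_idealI[OF hpart_rel_ideal(1)[OF assms(1) g]] by simp
  qed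
qed

text \<open>The left-hand map of the exact sequence is well defined modulo the forms.\<close>

lemma rel_ideal_star_mult:
  assumes "finite S" "f \<in> rel_ideal (star D S) r T"
  shows "(\<Prod>e\<in>S. var e) * f \<in> rel_ideal D r T"
proof -
  obtain g where "f - (\<Sum>l<r. T l * g l) \<in> nonface_ideal (star D S)"
    using assms(2) by (rule rel_idealE)
  then have "(\<Prod>e\<in>S. var e) * (f - (\<Sum>l<r. T l * g l)) \<in> nonface_ideal D"
    using prod_var_mult_nonface_iff[OF assms(1)] by blast
  then show ?thesis
    by (intro rel_idealI[where g = "\<lambda>l. (\<Prod>e\<in>S. var e) * g l"])
      (simp add: algebra_simps sum_distrib_left)
qed

text \<open>Exactness in the middle modulo the forms: what dies on \<open>avoiding D S\<close> is a
  multiple of the monomial of \<open>S\<close>.\<close>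

lemma rel_ideal_avoiding:
  assumes "finite S" "f \<in> rel_ideal (avoiding D S) r T"
  obtains h where "f - (\<Prod>e\<in>S. var e) * h \<in> rel_ideal D r T"
proof -
  obtain g where "f - (\<Sum>l<r. T l * g l) \<in> nonface_ideal (avoiding D S)"
    using assms(2) by (rule rel_idealE)
  then obtain h where "f - (\<Sum>l<r. T l * g l) - (\<Prod>e\<in>S. var e) * h \<in> nonface_ideal D"
    using nonface_ideal_avoiding[OF assms(1)] by blast
  then have "f - (\<Prod>e\<in>S. var e) * h \<in> rel_ideal D r T"
    by (intro rel_idealI[where g = g]) (simp add: algebra_simps)
  then show ?thesis by (rule that)
qed

section \<open>Koszul relations and the colon ideal\<close>

text \<open>Vanishing of the first Koszul homology of \<open>T\<close> on the face ring of
  \<open>D\<close>; it stands in for \<open>T\<close> being a regular sequence.\<close>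

definition koszul :: "'v set set \<Rightarrow> nat \<Rightarrow> (nat \<Rightarrow> ('v, 'k::field) mpoly) \<Rightarrow> bool" where
  "koszul D r T \<longleftrightarrow> (\<forall>g. (\<Sum>l<r. T l * g l) \<in> nonface_ideal D \<longrightarrow>
     (\<exists>a. (\<forall>l j. a l j = - a j l) \<and>
          (\<forall>l<r. g l - (\<Sum>j<r. a l j * T j) \<in> nonface_ideal D)))"

lemma koszulE:
  assumes "koszul D r T" "(\<Sum>l<r. T l * g l) \<in> nonface_ideal D"
  obtains a where "\<And>l j. a l j = - a j l"
    "\<And>l. l < r \<Longrightarrow> g l - (\<Sum>j<r. a l j * T j) \<in> nonface_ideal D"
  using assms(1) unfolding koszul_def using assms(2) that by blast

text \<open>Exchanging the two indices shows that the sum equals its negative; characteristic zero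
  allows division by two, which is carried out on coefficients.\<close>

lemma antisymmetric_sum_zero:
  fixes T :: "nat \<Rightarrow> ('v, 'k::field_char_0) mpoly"
  assumes a: "\<And>l j. a l j = - a j l"
  shows "(\<Sum>l<r. T l * (\<Sum>j<r. a l j * T j)) = 0"
proof -
  let ?S = "\<Sum>l<r. T l * (\<Sum>j<r. a l j * T j)"
  have "?S = (\<Sum>l<r. \<Sum>j<r. T l * (a l j * T j))" by (simp add: sum_distrib_left)
  also have "\<dots> = (\<Sum>j<r. \<Sum>l<r. T l * (a l j * T j))" by (rule sum.swap)
  also have "\<dots> = (\<Sum>j<r. \<Sum>l<r. - (T j * (a j l * T l)))"
  proof (intro sum.cong refl)
    fix j l
    show "T l * (a l j * T j) = - (T j * (a j l * T l))"
      by (subst a) (simp add: algebra_simps)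
  qed
  also have "\<dots> = - ?S" by (simp add: sum_distrib_left sum_negf)
  finally have "?S = - ?S" .
  then have "lookup ?S n = lookup (- ?S) n" for n
    by (rule arg_cong[where f = "\<lambda>f. lookup f n"])
  moreover have "x = 0" if "x = - x" for x :: 'k
  proof -
    have "2 * x = x + - x" using that by (simp only: mult_2)
    then show ?thesis by simp
  qed
  ultimately show ?thesis unfolding lookup_uminus by (intro poly_mapping_eqI) (simp only: lookup_zero)
qed

text \<open>By antisymmetry the Koszul relation may be subtracted from the cofactors \<open>g\<close>, after which
  they are all divisible by the monomial of \<open>S\<close>.\<close>

lemma cofactor_reduction:
  fixes T :: "nat \<Rightarrow> ('v, 'k::field_char_0) mpoly"
  assumes D: "down_closed D" and S: "finite S" and av: "koszul (avoiding D S) r T"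
    and g: "(\<Sum>l<r. T l * g l) \<in> nonface_ideal (avoiding D S)"
  obtains a h where "\<And>l j. a l j = - a j l"
    "\<And>l. l < r \<Longrightarrow> g l - (\<Sum>j<r. a l j * T j) - (\<Prod>e\<in>S. var e) * h l \<in> nonface_ideal D"
    "(\<Sum>l<r. T l * g l) - (\<Prod>e\<in>S. var e) * (\<Sum>l<r. T l * h l) \<in> nonface_ideal D"
proof -
  let ?x = "\<Prod>e\<in>S. var e :: ('v, 'k) mpoly"
  obtain a where a: "\<And>l j. a l j = - a j l"
    "\<And>l. l < r \<Longrightarrow> g l - (\<Sum>j<r. a l j * T j) \<in> nonface_ideal (avoiding D S)"
    using g by (rule koszulE[OF av]) blast
  then have "\<forall>l<r. \<exists>h. g l - (\<Sum>j<r. a l j * T j) - ?x * h \<in> nonface_ideal D"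
    using nonface_ideal_avoiding[OF S] by blast
  then obtain h where h: "\<And>l. l < r \<Longrightarrow> g l - (\<Sum>j<r. a l j * T j) - ?x * h l \<in> nonface_ideal D"
    by metis
  have "(\<Sum>l<r. T l * g l) - (\<Sum>l<r. T l * (\<Sum>j<r. a l j * T j)) - ?x * (\<Sum>l<r. T l * h l) =
      (\<Sum>l<r. T l * (g l - (\<Sum>j<r. a l j * T j) - ?x * h l))"
    by (simp add: right_diff_distrib sum_subtractf sum_distrib_left mult.left_commute)
  also have "\<dots> \<in> nonface_ideal D"
    using h by (intro nonface_ideal_sum nonface_ideal_mult[OF D]) auto
  finally have "(\<Sum>l<r. T l * g l) - ?x * (\<Sum>l<r. T l * h l) \<in> nonface_ideal D"
    using antisymmetric_sum_zero[OF a(1)] by simp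
  with a(1) h show ?thesis by (rule that)
qed

text \<open>H_1 of \<open>D\<close> lies between H_1 of the star and H_1 of the avoiding complex.
  The matrix \<open>a\<close> comes from the avoiding end; \<open>b\<close> comes from the star and
  is carried to \<open>D\<close> by the monomial of \<open>S\<close>.\<close>

lemma koszul_step:
  fixes T :: "nat \<Rightarrow> ('v, 'k::field_char_0) mpoly"
  assumes D: "down_closed D" and S: "finite S"
    and st: "koszul (star D S) r T" and av: "koszul (avoiding D S) r T"
  shows "koszul D r T"
  unfolding koszul_def
proof (intro allI impI)
  fix g assume g: "(\<Sum>l<r. T l * g l) \<in> nonface_ideal D"
  let ?x = "\<Prod>e\<in>S. var e :: ('v, 'k) mpoly"
  have "(\<Sum>l<r. T l * g l) \<in> nonface_ideal (avoiding D S)"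
    using g nonface_ideal_mono[OF avoiding_subset] by blast
  then obtain a h where a: "\<And>l j. a l j = - a j l"
    and h: "\<And>l. l < r \<Longrightarrow> g l - (\<Sum>j<r. a l j * T j) - ?x * h l \<in> nonface_ideal D"
    and gh: "(\<Sum>l<r. T l * g l) - ?x * (\<Sum>l<r. T l * h l) \<in> nonface_ideal D"
    by (rule cofactor_reduction[OF D S av]) blast
  from nonface_ideal_diff[OF g gh] have "?x * (\<Sum>l<r. T l * h l) \<in> nonface_ideal D"
    by simp
  then have "(\<Sum>l<r. T l * h l) \<in> nonface_ideal (star D S)"
    using prod_var_mult_nonface_iff[OF S] by blast
  then obtain b where b: "\<And>l j. b l j = - b j l"
    "\<And>l. l < r \<Longrightarrow> h l - (\<Sum>j<r. b l j * T j) \<in> nonface_ideal (star D S)"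
    by (rule koszulE[OF st]) blast
  show "\<exists>a. (\<forall>l j. a l j = - a j l) \<and> (\<forall>l<r. g l - (\<Sum>j<r. a l j * T j) \<in> nonface_ideal D)"
  proof (intro exI[of _ "\<lambda>l j. a l j + ?x * b l j"] conjI allI impI)
    fix l j
    have "- (a j l + ?x * b j l) = - a j l + ?x * (- b j l)" by simp
    then show "a l j + ?x * b l j = - (a j l + ?x * b j l)"
      unfolding a[of l j, symmetric] b(1)[of l j, symmetric] by (rule sym)
  next
    fix l assume l: "l < r"
    have "?x * (h l - (\<Sum>j<r. b l j * T j)) \<in> nonface_ideal D"
      using b(2)[OF l] prod_var_mult_nonface_iff[OF S] by blast
    from nonface_ideal_add[OF h[OF l] this]
    show "g l - (\<Sum>j<r. (a l j + ?x * b l j) * T j) \<in> nonface_ideal D"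
      by (simp add: algebra_simps sum.distrib sum_distrib_left)
  qed
qed

text \<open>Injectivity on the left modulo the forms: its failure would come from H_1 of the
  avoiding complex through the connecting map, and that group is zero.\<close>

lemma rel_ideal_colon:
  fixes T :: "nat \<Rightarrow> ('v, 'k::field_char_0) mpoly"
  assumes D: "down_closed D" and S: "finite S" and av: "koszul (avoiding D S) r T"
    and f: "(\<Prod>e\<in>S. var e) * f \<in> rel_ideal D r T"
  shows "f \<in> rel_ideal (star D S) r T"
proof -
  let ?x = "\<Prod>e\<in>S. var e :: ('v, 'k) mpoly"
  obtain g where g: "?x * f - (\<Sum>l<r. T l * g l) \<in> nonface_ideal D"
    using f by (rule rel_idealE)
  \<comment> \<open>No face of \<open>avoiding D S\<close> contains \<open>S\<close>, so all
    multiples of the monomial of \<open>S\<close> vanish there.\<close>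
  have "star (avoiding D S) S = {}" by (auto simp: star_def avoiding_def)
  then have "?x * f \<in> nonface_ideal (avoiding D S)"
    using prod_var_mult_nonface_iff[OF S, of f "avoiding D S"] by (simp add: nonface_ideal_def)
  from nonface_ideal_diff[OF this subsetD[OF nonface_ideal_mono[OF avoiding_subset] g]]
  have "(\<Sum>l<r. T l * g l) \<in> nonface_ideal (avoiding D S)" by simp
  then obtain h where "(\<Sum>l<r. T l * g l) - ?x * (\<Sum>l<r. T l * h l) \<in> nonface_ideal D"
    by (rule cofactor_reduction[OF D S av]) blast
  from nonface_ideal_add[OF g this] have "?x * (f - (\<Sum>l<r. T l * h l)) \<in> nonface_ideal D"
    by (simp add: algebra_simps)
  then have "f - (\<Sum>l<r. T l * h l) \<in> nonface_ideal (star D S)"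
    using prod_var_mult_nonface_iff[OF S] by blast
  then show ?thesis by (rule rel_idealI)
qed

section \<open>Relations among the variables on a simplex\<close>

lemma avoiding_Pow: "avoiding (Pow C) {x} = Pow (C - {x})"
  by (auto simp: avoiding_def)

text \<open>Removing one vertex from a simplex amounts to adding its variable to the face ideal, so
  the variables can be split off one at a time.\<close>

lemma vars_nonface_ideal:
  fixes b :: "nat \<Rightarrow> 'v" and f :: "('v, 'k::field) mpoly"
  shows "f \<in> nonface_ideal (Pow (B - b ` {..<n})) \<Longrightarrow>
    \<exists>c. f - (\<Sum>l<n. var (b l) * c l) \<in> nonface_ideal (Pow B)"
proof (induction n arbitrary: f)
  case (Suc n)
  have "Pow (B - b ` {..<Suc n}) = avoiding (Pow (B - b ` {..<n})) {b n}"
    unfolding avoiding_Pow lessThan_Suc by auto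
  with Suc.prems obtain h where "f - var (b n) * h \<in> nonface_ideal (Pow (B - b ` {..<n}))"
    using nonface_ideal_avoiding[of "{b n}" f] by auto
  from Suc.IH[OF this] obtain c where
    "f - var (b n) * h - (\<Sum>l<n. var (b l) * c l) \<in> nonface_ideal (Pow B)" ..
  then show ?case
    by (intro exI[of _ "c(n := h)"]) (simp add: algebra_simps)
qed simp

lemma nonface_ideal_vars:
  fixes b :: "nat \<Rightarrow> 'v"
  assumes "l < n"
  shows "var (b l) * f \<in> nonface_ideal (Pow (B - b ` {..<n}))"
proof -
  have "star (Pow (B - b ` {..<n})) {b l} = {}" using assms by (auto simp: star_def)
  then show ?thesis
    using prod_var_mult_nonface_iff[of "{b l}" f "Pow (B - b ` {..<n})"]
    by (simp add: nonface_ideal_def)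
qed

text \<open>The last variable is a nonzerodivisor modulo the earlier ones, so its cofactor
  \<open>g n\<close> is a combination of the earlier variables. Moving this part into the other
  cofactors leaves a relation among fewer variables.\<close>

lemma koszul_vars:
  assumes "inj_on b {..<n}" "b ` {..<n} \<subseteq> B"
  shows "koszul (Pow B) n (\<lambda>l. var (b l) :: ('v, 'k::field) mpoly)"
  using assms
proof (induction n)
  case 0
  show ?case unfolding koszul_def by (auto intro: exI[of _ "\<lambda>_ _. 0"])
next
  case (Suc n)
  let ?I = "nonface_ideal (Pow B) :: ('v, 'k) mpoly set"
  have IH: "koszul (Pow B) n (\<lambda>l. var (b l) :: ('v, 'k) mpoly)"
    using Suc by (auto intro!: Suc.IH simp: lessThan_Suc)
  have dc: "down_closed (Pow B)" by (auto simp: down_closed_def)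
  show ?case unfolding koszul_def
  proof (intro allI impI)
    fix g :: "nat \<Rightarrow> ('v, 'k) mpoly"
    assume g: "(\<Sum>l<Suc n. var (b l) * g l) \<in> ?I"
    let ?C = "B - b ` {..<n}"
    have "(\<Sum>l<Suc n. var (b l) * g l) \<in> nonface_ideal (Pow ?C)"
      using g nonface_ideal_mono[of "Pow ?C" "Pow B"] by auto
    moreover have "(\<Sum>l<n. var (b l) * g l) \<in> nonface_ideal (Pow ?C)"
      by (intro nonface_ideal_sum nonface_ideal_vars) simp
    ultimately have "(\<Sum>l<Suc n. var (b l) * g l) - (\<Sum>l<n. var (b l) * g l)
        \<in> nonface_ideal (Pow ?C)"
      by (rule nonface_ideal_diff)
    then have "var (b n) * g n \<in> nonface_ideal (Pow ?C)" by simp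
    \<comment> \<open>As a vertex of the simplex on \<open>?C\<close>, \<open>b n\<close> is a cone
      point, so multiplication by its variable is injective there.\<close>
    moreover have "star (Pow ?C) {b n} = Pow ?C"
    proof -
      have "b n \<in> ?C" using Suc.prems by (auto simp: lessThan_Suc)
      then show ?thesis by (auto simp: star_def)
    qed
    ultimately have "g n \<in> nonface_ideal (Pow ?C)"
      using prod_var_mult_nonface_iff[of "{b n}" "g n" "Pow ?C"] by simp
    then obtain c where c: "g n - (\<Sum>l<n. var (b l) * c l) \<in> ?I"
      using vars_nonface_ideal by blast
    have "(\<Sum>l<n. var (b l) * (g l + var (b n) * c l)) =
        (\<Sum>l<Suc n. var (b l) * g l) - var (b n) * (g n - (\<Sum>l<n. var (b l) * c l))"
      by (simp add: algebra_simps sum.distrib sum_distrib_left)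
    also have "\<dots> \<in> ?I"
      by (rule nonface_ideal_diff[OF g nonface_ideal_mult(1)[OF dc c]])
    finally obtain a where a: "\<And>l j. a l j = - a j l"
      "\<And>l. l < n \<Longrightarrow> g l + var (b n) * c l - (\<Sum>j<n. a l j * var (b j)) \<in> ?I"
      by (rule koszulE[OF IH]) blast
    \<comment> \<open>Border the antisymmetric matrix of the shorter relation by the row
      \<open>c\<close> and the column \<open>- c\<close>.\<close>
    let ?a = "\<lambda>l j. if l < n \<and> j < n then a l j else if l = n \<and> j < n then c j
      else if j = n \<and> l < n then - c l else 0"
    show "\<exists>a. (\<forall>l j. a l j = - a j l) \<and>
        (\<forall>l<Suc n. g l - (\<Sum>j<Suc n. a l j * var (b j)) \<in> ?I)"
    proof (intro exI[of _ ?a] conjI allI impI)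
      fix l j show "?a l j = - ?a j l" using a(1)[of l j] by simp
    next
      fix l assume "l < Suc n"
      then consider "l < n" | "l = n" by linarith
      then show "g l - (\<Sum>j<Suc n. ?a l j * var (b j)) \<in> ?I"
      proof cases
        case 1
        then show ?thesis using a(2)[of l] by (simp add: algebra_simps)
      next
        case 2
        then show ?thesis using c by (simp add: mult.commute)
      qed
    qed
  qed
qed

section \<open>Linear changes of the forms\<close>

lemma const_mult: "const (a * b) = const a * const b"
  by (simp add: const_def mult_single)

lemma const_sum: "const (\<Sum>x\<in>A. f x) = (\<Sum>x\<in>A. const (f x))"
  by (induction A rule: infinite_finite_induct) (auto simp: const_def single_add)

lemma const_0 [simp]: "const 0 = 0" and const_1 [simp]: "const 1 = 1"
  by (simp_all add: const_def)

lemma const_minus: "const (- c) = - const c"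
  by (simp add: const_def single_uminus)

lemma inverse_matrix_sum:
  fixes K L :: "nat \<Rightarrow> nat \<Rightarrow> 'k::field" and X :: "nat \<Rightarrow> ('v, 'k) mpoly"
  assumes "\<And>j. j < r \<Longrightarrow> (\<Sum>b<r. L i b * K b j) = (if i = j then 1 else 0)" "i < r"
  shows "(\<Sum>b<r. const (L i b) * (\<Sum>j<r. const (K b j) * X j)) = X i"
proof -
  have "(\<Sum>b<r. const (L i b) * (\<Sum>j<r. const (K b j) * X j)) =
      (\<Sum>j<r. \<Sum>b<r. const (L i b * K b j) * X j)"
    unfolding sum_distrib_left const_mult mult.assoc by (rule sum.swap)
  also have "\<dots> = (\<Sum>j<r. const (\<Sum>b<r. L i b * K b j) * X j)"
    by (simp add: const_sum sum_distrib_right)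
  also have "\<dots> = (\<Sum>j<r. (if i = j then X j else 0))"
    using assms by (intro sum.cong) auto
  finally show ?thesis using assms(2) by simp
qed

text \<open>Syzygies of \<open>T\<close> become syzygies of \<open>X\<close> through the transpose
  of \<open>K\<close>, and the antisymmetric matrix found there returns by congruence with
  \<open>L\<close>, which preserves antisymmetry. \<open>T\<close> and \<open>X\<close> are related
  only modulo the face ideal because on a simplex the variables of the other elements drop
  out.\<close>

lemma koszul_linear_change:
  fixes K L :: "nat \<Rightarrow> nat \<Rightarrow> 'k::field" and X T :: "nat \<Rightarrow> ('v, 'k) mpoly"
  assumes D: "down_closed D" and X: "koszul D r X"
    and T: "\<And>l. l < r \<Longrightarrow> T l - (\<Sum>b<r. const (K l b) * X b) \<in> nonface_ideal D"
    and KL: "\<And>i j. i < r \<Longrightarrow> j < r \<Longrightarrow> (\<Sum>b<r. K i b * L b j) = (if i = j then 1 else 0)"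
    and LK: "\<And>i j. i < r \<Longrightarrow> j < r \<Longrightarrow> (\<Sum>b<r. L i b * K b j) = (if i = j then 1 else 0)"
  shows "koszul D r T"
  unfolding koszul_def
proof (intro allI impI)
  fix g assume g: "(\<Sum>l<r. T l * g l) \<in> nonface_ideal D"
  note mult = nonface_ideal_mult[OF D]
  let ?I = "nonface_ideal D :: ('v, 'k) mpoly set"
  define G where "G b = (\<Sum>j<r. const (K j b) * g j)" for b
  have "(\<Sum>b<r. X b * G b) = (\<Sum>b<r. \<Sum>j<r. X b * (const (K j b) * g j))"
    unfolding G_def sum_distrib_left ..
  also have "\<dots> = (\<Sum>j<r. \<Sum>b<r. X b * (const (K j b) * g j))"
    by (rule sum.swap)
  also have "\<dots> = (\<Sum>j<r. (\<Sum>b<r. const (K j b) * X b) * g j)"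
    unfolding sum_distrib_right by (intro sum.cong refl) (simp only: mult_ac)
  also have "\<dots> = (\<Sum>j<r. T j * g j) - (\<Sum>j<r. (T j - (\<Sum>b<r. const (K j b) * X b)) * g j)"
    by (simp add: algebra_simps sum_subtractf)
  also have "\<dots> \<in> ?I"
    by (rule nonface_ideal_diff[OF g nonface_ideal_sum]) (auto intro: mult(2) T)
  finally obtain a where a: "\<And>l j. a l j = - a j l"
    "\<And>l. l < r \<Longrightarrow> G l - (\<Sum>j<r. a l j * X j) \<in> ?I"
    by (rule koszulE[OF X]) blast
  \<comment> \<open>\<open>A\<close> is the transpose of \<open>L\<close> times \<open>a\<close>
    times \<open>L\<close>; \<open>Y\<close> recovers \<open>X\<close> from \<open>T\<close> up to
    the face ideal.\<close>
  define A where "A l j = (\<Sum>b<r. \<Sum>b'<r. const (L b l * L b' j) * a b b')" for l j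
  define Y where "Y b = (\<Sum>j<r. const (L b j) * T j)" for b
  have Y: "Y b - X b \<in> ?I" if "b < r" for b
  proof -
    have "Y b - X b = (\<Sum>j<r. const (L b j) * (T j - (\<Sum>i<r. const (K j i) * X i)))"
      using inverse_matrix_sum[of r L b K X] LK that
      by (simp add: Y_def right_diff_distrib sum_subtractf)
    also have "\<dots> \<in> ?I" using T by (intro nonface_ideal_sum mult) auto
    finally show ?thesis .
  qed
  show "\<exists>a. (\<forall>l j. a l j = - a j l) \<and> (\<forall>l<r. g l - (\<Sum>j<r. a l j * T j) \<in> ?I)"
  proof (intro exI[of _ A] conjI allI impI)
    fix l j
    have "A l j = (\<Sum>b'<r. \<Sum>b<r. const (L b l * L b' j) * a b b')"
      unfolding A_def by (rule sum.swap)
    also have "\<dots> = (\<Sum>b'<r. \<Sum>b<r. - (const (L b' j * L b l) * a b' b))"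
    proof (intro sum.cong refl)
      fix b b'
      show "const (L b l * L b' j) * a b b' = - (const (L b' j * L b l) * a b' b)"
        by (subst a) (simp add: mult.commute)
    qed
    also have "\<dots> = - A j l" by (simp add: A_def sum_negf)
    finally show "A l j = - A j l" .
  next
    fix l assume l: "l < r"
    have gl: "(\<Sum>b<r. const (L b l) * G b) = g l"
      using inverse_matrix_sum[of r "\<lambda>i j. L j i" l "\<lambda>i j. K j i" g] KL l
      by (simp add: G_def mult.commute eq_commute)
    have "(\<Sum>j<r. A l j * T j) =
        (\<Sum>j<r. \<Sum>b<r. \<Sum>b'<r. const (L b l) * (a b b' * (const (L b' j) * T j)))"
      unfolding A_def sum_distrib_right
      by (intro sum.cong refl) (simp only: const_mult mult_ac)
    also have "\<dots> = (\<Sum>b<r. \<Sum>j<r. \<Sum>b'<r. const (L b l) * (a b b' * (const (L b' j) * T j)))"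
      by (rule sum.swap)
    also have "\<dots> = (\<Sum>b<r. \<Sum>b'<r. \<Sum>j<r. const (L b l) * (a b b' * (const (L b' j) * T j)))"
      by (intro sum.cong refl sum.swap)
    also have "\<dots> = (\<Sum>b<r. const (L b l) * (\<Sum>b'<r. a b b' * Y b'))"
      by (simp add: Y_def sum_distrib_left)
    finally have AT: "(\<Sum>j<r. A l j * T j) = (\<Sum>b<r. const (L b l) * (\<Sum>b'<r. a b b' * Y b'))" .
    have "g l - (\<Sum>j<r. A l j * T j) = (\<Sum>b<r. const (L b l) *
        ((G b - (\<Sum>j<r. a b j * X j)) - (\<Sum>j<r. a b j * (Y j - X j))))"
      unfolding AT gl[symmetric] by (simp add: algebra_simps sum_subtractf)
    also have "\<dots> \<in> ?I"
      by (rule nonface_ideal_sum, rule mult(1), rule nonface_ideal_diff[OF _ nonface_ideal_sum])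
        (auto intro: mult(1) a(2) Y)
    finally show "g l - (\<Sum>j<r. A l j * T j) \<in> ?I" .
  qed
qed

text \<open>Index functions and finite sums combine directly with coefficients of polynomials. The
  determinant stays as a factor, since in the openness argument it varies with the point.\<close>

lemma adjugate_entries:
  fixes W :: "nat \<Rightarrow> nat \<Rightarrow> 'c::comm_ring_1" and n :: nat
  defines "d \<equiv> Determinant.det (Matrix.mat n n (\<lambda>(i, j). W i j))"
  obtains M where
    "\<And>i j. i < n \<Longrightarrow> j < n \<Longrightarrow> (\<Sum>k<n. W i k * M k j) = (if i = j then d else 0)"
    "\<And>i j. i < n \<Longrightarrow> j < n \<Longrightarrow> (\<Sum>k<n. M i k * W k j) = (if i = j then d else 0)"
proof -
  let ?A = "Matrix.mat n n (\<lambda>(i, j). W i j)"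
  let ?B = "adj_mat ?A"
  have A: "?A \<in> carrier_mat n n" by simp
  note B = adj_mat[OF A]
  have "(?A * ?B) $$ (i, j) = (\<Sum>k<n. W i k * ?B $$ (k, j))"
    "(?B * ?A) $$ (i, j) = (\<Sum>k<n. ?B $$ (i, k) * W k j)"
    if "i < n" "j < n" for i j
    using that B(1) by (auto simp: scalar_prod_def atLeast0LessThan)
  moreover have "(d \<cdot>\<^sub>m 1\<^sub>m n) $$ (i, j) = (if i = j then d else 0)" if "i < n" "j < n" for i j
    using that by simp
  ultimately show ?thesis
    using B(2,3) by (intro that[of "\<lambda>i j. ?B $$ (i, j)"]) (simp_all flip: d_def)
qed

lemma inverse_matrix:
  fixes K :: "nat \<Rightarrow> nat \<Rightarrow> 'k::field"
  assumes inj: "\<And>c. (\<And>i. i < r \<Longrightarrow> (\<Sum>j<r. c j * K i j) = 0) \<Longrightarrow> \<forall>j<r. c j = 0"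
  obtains L where
    "\<And>i j. i < r \<Longrightarrow> j < r \<Longrightarrow> (\<Sum>b<r. K i b * L b j) = (if i = j then 1 else 0)"
    "\<And>i j. i < r \<Longrightarrow> j < r \<Longrightarrow> (\<Sum>b<r. L i b * K b j) = (if i = j then 1 else 0)"
proof -
  let ?A = "Matrix.mat r r (\<lambda>(i, j). K i j)"
  let ?d = "Determinant.det ?A"
  have A: "?A \<in> carrier_mat r r" by simp
  have d: "?d \<noteq> 0"
  proof
    assume "?d = 0"
    then obtain v where v: "v \<in> carrier_vec r" "v \<noteq> 0\<^sub>v r" "?A *\<^sub>v v = 0\<^sub>v r"
      using det_0_iff_vec_prod_zero_field[OF A] by blast
    have "(\<Sum>j<r. v $ j * K i j) = 0" if "i < r" for i
    proof -
      have "(?A *\<^sub>v v) $ i = (\<Sum>j<r. v $ j * K i j)"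
        using that v(1) by (auto simp: scalar_prod_def atLeast0LessThan mult.commute)
      then show ?thesis using v(3) that by simp
    qed
    then have "\<forall>j<r. v $ j = 0" by (rule inj)
    then have "v = 0\<^sub>v r" using v(1) by (intro eq_vecI) auto
    with v(2) show False ..
  qed
  obtain M where M:
    "\<And>i j. i < r \<Longrightarrow> j < r \<Longrightarrow> (\<Sum>k<r. K i k * M k j) = (if i = j then ?d else 0)"
    "\<And>i j. i < r \<Longrightarrow> j < r \<Longrightarrow> (\<Sum>k<r. M i k * K k j) = (if i = j then ?d else 0)"
    by (rule adjugate_entries[where W = K and n = r]) blast
  have "(\<Sum>b<r. K i b * (M b j / ?d)) = (if i = j then 1 else 0)"
    "(\<Sum>b<r. M i b / ?d * K b j) = (if i = j then 1 else 0)" if "i < r" "j < r" for i j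
    using M[OF that] d by (auto simp flip: sum_divide_distrib)
  then show ?thesis by (rule that)
qed

text \<open>As \<B> consists of exponent vectors, one set can serve for many ideals; this is how
  dimensions are seen to be independent of the parameters.\<close>

definition monomial_basis :: "('v, 'k::field) mpoly set \<Rightarrow> ('v \<Rightarrow>\<^sub>0 nat) set \<Rightarrow> bool" where
  "monomial_basis J \<B> \<longleftrightarrow> finite \<B> \<and>
     (\<forall>f. \<exists>c. f - (\<Sum>m\<in>\<B>. single m (c m)) \<in> J) \<and>
     (\<forall>c. (\<Sum>m\<in>\<B>. single m (c m)) \<in> J \<longrightarrow> (\<forall>m\<in>\<B>. c m = 0))"

lemma monomial_basis_indep:
  "monomial_basis J \<B> \<Longrightarrow> (\<Sum>m\<in>\<B>. single m (c m)) \<in> J \<Longrightarrow> m \<in> \<B> \<Longrightarrow> c m = 0"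
  unfolding monomial_basis_def by blast

text \<open>Modulo the forms the sequence is still short exact, so a basis of the right end and the
  shifted basis of the left end form one of the middle. The condition on \<open>keys\<close> keeps
  the two families disjoint; \<open>rel_ideal_colon\<close> gives independence of the shifted
  part.\<close>

lemma monomial_basis_step:
  fixes T :: "nat \<Rightarrow> ('v, 'k::field_char_0) mpoly"
  assumes D: "down_closed D" and S: "finite S" and av: "koszul (avoiding D S) r T"
    and B1: "monomial_basis (rel_ideal (avoiding D S) r T) \<B>1"
    and B2: "monomial_basis (rel_ideal (star D S) r T) \<B>2"
    and keys: "\<And>m. m \<in> \<B>1 \<Longrightarrow> \<not> S \<subseteq> keys m"
  shows "monomial_basis (rel_ideal D r T) (\<B>1 \<union> (+) (mon_of S) ` \<B>2)"
proof -
  let ?x = "\<Prod>e\<in>S. var e :: ('v, 'k) mpoly"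
  let ?B = "(+) (mon_of S) ` \<B>2"
  have fin: "finite \<B>1" "finite \<B>2" using B1 B2 by (auto simp: monomial_basis_def)
  have disj: "\<B>1 \<inter> ?B = {}"
    using keys keys_add_nat[of "mon_of S"] keys_mon_of[OF S] by auto
  have inj: "inj_on ((+) (mon_of S)) \<B>2" by (auto intro: inj_onI)
  have split: "(\<Sum>m\<in>\<B>1 \<union> ?B. single m (c m)) =
      (\<Sum>m\<in>\<B>1. single m (c m)) + ?x * (\<Sum>m\<in>\<B>2. single m (c (mon_of S + m)))" for c
    using fin disj inj
    by (simp add: sum.union_disjoint sum.reindex sum_distrib_left prod_var[OF S] mult_single)
  have "\<exists>c. f - (\<Sum>m\<in>\<B>1 \<union> ?B. single m (c m)) \<in> rel_ideal D r T" for f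
  proof -
    obtain c where "f - (\<Sum>m\<in>\<B>1. single m (c m)) \<in> rel_ideal (avoiding D S) r T"
      using B1 unfolding monomial_basis_def by blast
    then obtain h where h: "f - (\<Sum>m\<in>\<B>1. single m (c m)) - ?x * h \<in> rel_ideal D r T"
      using rel_ideal_avoiding[OF S] by blast
    obtain d where "h - (\<Sum>m\<in>\<B>2. single m (d m)) \<in> rel_ideal (star D S) r T"
      using B2 unfolding monomial_basis_def by blast
    then have "?x * (h - (\<Sum>m\<in>\<B>2. single m (d m))) \<in> rel_ideal D r T"
      by (rule rel_ideal_star_mult[OF S])
    from rel_ideal_add[OF h this]
    have *: "f - ((\<Sum>m\<in>\<B>1. single m (c m)) + ?x * (\<Sum>m\<in>\<B>2. single m (d m))) \<in> rel_ideal D r T"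
      by (simp add: algebra_simps)
    let ?c = "\<lambda>m. if m \<in> \<B>1 then c m else d (m - mon_of S)"
    have "(\<Sum>m\<in>\<B>2. single m (?c (mon_of S + m))) = (\<Sum>m\<in>\<B>2. single m (d m))"
      using disj by (intro sum.cong) auto
    then have "f - (\<Sum>m\<in>\<B>1 \<union> ?B. single m (?c m)) \<in> rel_ideal D r T"
      using * unfolding split by simp
    then show ?thesis by (intro exI[of _ ?c])
  qed
  moreover have "\<forall>m\<in>\<B>1 \<union> ?B. c m = 0"
    if c: "(\<Sum>m\<in>\<B>1 \<union> ?B. single m (c m)) \<in> rel_ideal D r T" for c
  proof -
    have "star (avoiding D S) S = {}" by (auto simp: star_def avoiding_def)
    then have x: "?x * g \<in> rel_ideal (avoiding D S) r T" for g
      using prod_var_mult_nonface_iff[OF S, of g "avoiding D S"]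
      by (intro nonface_rel_ideal) (simp add: nonface_ideal_def)
    have "(\<Sum>m\<in>\<B>1. single m (c m)) \<in> rel_ideal (avoiding D S) r T"
      using rel_ideal_diff[OF subsetD[OF rel_ideal_mono[OF avoiding_subset] c]
          x[of "\<Sum>m\<in>\<B>2. single m (c (mon_of S + m))"]]
      unfolding split add_diff_cancel_right' .
    then have c1: "\<forall>m\<in>\<B>1. c m = 0" using B1 unfolding monomial_basis_def by blast
    then have "?x * (\<Sum>m\<in>\<B>2. single m (c (mon_of S + m))) \<in> rel_ideal D r T"
      using c unfolding split by simp
    from rel_ideal_colon[OF D S av this]
    have "\<forall>m\<in>\<B>2. c (mon_of S + m) = 0"
      using monomial_basis_indep[OF B2, of "\<lambda>m. c (mon_of S + m)"] by blast
    with c1 show ?thesis by auto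
  qed
  ultimately show ?thesis using fin unfolding monomial_basis_def by blast
qed

section \<open>Parameters on a simplex\<close>

lemma is_lsop_subset: "is_lsop D r \<theta> \<Longrightarrow> D' \<subseteq> D \<Longrightarrow> is_lsop D' r \<theta>"
  unfolding is_lsop_def by blast

text \<open>One-forms have no constant term and, the empty set being a face, neither do elements of
  the face ideal. In particular \<open>1\<close> is never in the ideal.\<close>

lemma lookup_rel_ideal_zero:
  assumes "{} \<in> D" "f \<in> rel_ideal D r (\<lambda>l. one_form E (\<theta> l))"
  shows "lookup f 0 = 0"
proof -
  obtain g where "f - (\<Sum>l<r. one_form E (\<theta> l) * g l) \<in> nonface_ideal D"
    using assms(2) by (rule rel_idealE)
  then have "lookup (f - (\<Sum>l<r. one_form E (\<theta> l) * g l)) 0 = 0"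
    using assms(1) by (simp add: nonface_ideal_iff)
  then show ?thesis by (simp add: lookup_minus lookup_sum lookup_one_form_mult)
qed

text \<open>On the full face \<open>B\<close> with \<open>r\<close> vertices the l.s.o.p. condition
  says that a square matrix is invertible, so modulo the face ideal the parameters are a linear
  change of coordinates from the variables of \<open>B\<close>.\<close>

lemma simplex_inverse:
  fixes \<theta> :: "nat \<Rightarrow> 'a \<Rightarrow> 'k::field"
  assumes b: "bij_betw b {..<r} B" and l: "is_lsop (Pow B) r \<theta>" and E: "finite E" "B \<subseteq> E"
  obtains L where
    "\<And>i j. i < r \<Longrightarrow> j < r \<Longrightarrow> (\<Sum>k<r. \<theta> i (b k) * L k j) = (if i = j then 1 else 0)"
    "\<And>i j. i < r \<Longrightarrow> j < r \<Longrightarrow> (\<Sum>k<r. L i k * \<theta> k (b j)) = (if i = j then 1 else 0)"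
    "\<And>i. one_form E (\<theta> i) - (\<Sum>k<r. const (\<theta> i (b k)) * var (b k)) \<in> nonface_ideal (Pow B)"
proof -
  have inj: "\<forall>j<r. c j = 0" if c: "\<And>i. i < r \<Longrightarrow> (\<Sum>j<r. c j * \<theta> i (b j)) = 0" for c
  proof -
    let ?c = "\<lambda>e. c (the_inv_into {..<r} b e)"
    have i: "the_inv_into {..<r} b (b j) = j" if "j < r" for j
      using b that by (simp add: bij_betw_def the_inv_into_f_f)
    have "(\<Sum>e\<in>B. ?c e * \<theta> i e) = (\<Sum>j<r. c j * \<theta> i (b j))" for i
      using i by (simp flip: sum.reindex_bij_betw[OF b])
    then have "\<forall>i<r. (\<Sum>e\<in>B. ?c e * \<theta> i e) = 0" using c by simp
    moreover have "\<forall>c. (\<forall>i<r. (\<Sum>e\<in>B. c e * \<theta> i e) = 0) \<longrightarrow> (\<forall>e\<in>B. c e = 0)"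
      using l unfolding is_lsop_def by blast
    ultimately have "\<forall>e\<in>B. ?c e = 0" by (elim allE[of _ ?c]) simp
    then show ?thesis using b i by (auto simp: bij_betw_def)
  qed
  have "one_form E (\<theta> i) - (\<Sum>k<r. const (\<theta> i (b k)) * var (b k)) \<in> nonface_ideal (Pow B)" for i
  proof -
    have "one_form E (\<theta> i) - (\<Sum>k<r. const (\<theta> i (b k)) * var (b k)) =
        (\<Sum>e\<in>E - B. const (\<theta> i e) * var e)"
      unfolding one_form_def sum.reindex_bij_betw[OF b, of "\<lambda>e. const (\<theta> i e) * var e"]
      using E by (simp add: sum_diff)
    also have "\<dots> \<in> nonface_ideal (Pow B)"
      by (intro nonface_ideal_sum)
        (auto simp: nonface_ideal_def var_def const_def mult_single)
    finally show ?thesis .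
  qed
  note forms = this
  obtain L where L:
    "\<And>i j. i < r \<Longrightarrow> j < r \<Longrightarrow> (\<Sum>k<r. \<theta> i (b k) * L k j) = (if i = j then 1 else 0)"
    "\<And>i j. i < r \<Longrightarrow> j < r \<Longrightarrow> (\<Sum>k<r. L i k * \<theta> k (b j)) = (if i = j then 1 else 0)"
    by (rule inverse_matrix[of r "\<lambda>i j. \<theta> i (b j)", OF inj], assumption, rule that)
  show ?thesis by (rule that[OF L forms])
qed

lemma koszul_simplex:
  fixes \<theta> :: "nat \<Rightarrow> 'a \<Rightarrow> 'k::field"
  assumes B: "finite B" "card B = r" and l: "is_lsop (Pow B) r \<theta>" and E: "finite E" "B \<subseteq> E"
  shows "koszul (Pow B) r (\<lambda>l. one_form E (\<theta> l))"
proof -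
  obtain b where b: "bij_betw b {..<r} B"
    using ex_bij_betw_nat_finite[OF B(1)] B(2) by (auto simp: atLeast0LessThan)
  obtain L where L:
    "\<And>i j. i < r \<Longrightarrow> j < r \<Longrightarrow> (\<Sum>k<r. \<theta> i (b k) * L k j) = (if i = j then 1 else 0)"
    "\<And>i j. i < r \<Longrightarrow> j < r \<Longrightarrow> (\<Sum>k<r. L i k * \<theta> k (b j)) = (if i = j then 1 else 0)"
    "\<And>i. one_form E (\<theta> i) - (\<Sum>k<r. const (\<theta> i (b k)) * var (b k)) \<in> nonface_ideal (Pow B)"
    by (rule simplex_inverse[OF b l E], rule that)
  have k: "koszul (Pow B) r (\<lambda>l. var (b l) :: ('a, 'k) mpoly)"
    using b by (intro koszul_vars) (auto simp: bij_betw_def)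
  have dc: "down_closed (Pow B)" by (auto simp: down_closed_def)
  show ?thesis
    by (rule koszul_linear_change[where K = "\<lambda>i j. \<theta> i (b j)" and L = L, OF dc k L(3) L(1,2)])
qed

text \<open>Inverting the parameters puts every variable into the ideal, so the quotient is the
  field, with the empty monomial as basis.\<close>

lemma monomial_basis_simplex:
  fixes \<theta> :: "nat \<Rightarrow> 'a \<Rightarrow> 'k::field"
  assumes B: "finite B" "card B = r" and l: "is_lsop (Pow B) r \<theta>" and E: "finite E" "B \<subseteq> E"
  shows "monomial_basis (rel_ideal (Pow B) r (\<lambda>l. one_form E (\<theta> l))) {0}"
proof -
  let ?J = "rel_ideal (Pow B) r (\<lambda>l. one_form E (\<theta> l))"
  have dc: "down_closed (Pow B)" by (auto simp: down_closed_def)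
  obtain b where b: "bij_betw b {..<r} B"
    using ex_bij_betw_nat_finite[OF B(1)] B(2) by (auto simp: atLeast0LessThan)
  obtain L where L:
    "\<And>i j. i < r \<Longrightarrow> j < r \<Longrightarrow> (\<Sum>k<r. L i k * \<theta> k (b j)) = (if i = j then 1 else 0)"
    "\<And>i. one_form E (\<theta> i) - (\<Sum>k<r. const (\<theta> i (b k)) * var (b k)) \<in> nonface_ideal (Pow B)"
    by (rule simplex_inverse[OF b l E], rule that)
  have var: "var v \<in> ?J" for v
  proof (cases "v \<in> B")
    case False
    then show ?thesis by (intro nonface_rel_ideal) (auto simp: nonface_ideal_def var_def)
  next
    case True
    then obtain i where i: "i < r" "v = b i" using b by (auto simp: bij_betw_def)
    have "(\<Sum>k<r. const (\<theta> l (b k)) * var (b k)) \<in> ?J" if "l < r" for l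
      using rel_ideal_diff[OF generator_rel_ideal[OF that, of "\<lambda>l. one_form E (\<theta> l)"]
          nonface_rel_ideal[OF L(2)[of l]]] by simp
    then have "(\<Sum>l<r. const (L i l) * (\<Sum>k<r. const (\<theta> l (b k)) * var (b k))) \<in> ?J"
      by (intro rel_ideal_sum, intro rel_ideal_mult[OF dc]) simp
    moreover have "(\<Sum>l<r. const (L i l) * (\<Sum>k<r. const (\<theta> l (b k)) * var (b k))) = var (b i)"
      using inverse_matrix_sum[of r L i "\<lambda>l k. \<theta> l (b k)" "\<lambda>k. var (b k)"] L(1) i(1) by simp
    ultimately show ?thesis using i by simp
  qed
  have span: "f - single 0 (lookup f 0) \<in> ?J" for f
  proof (induction f rule: mpoly_induct)
    case (add m c f)
    show ?case
    proof (cases "m = 0")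
      case True
      then show ?thesis using add by (simp add: lookup_add single_add)
    next
      case False
      then obtain v where v: "v \<in> keys m" by (metis all_not_in_conv keys_eq_empty)
      have "single m c = single (m - single v 1) c * var v"
        using diff_single_add[OF v] by (simp add: var_def mult_single add.commute)
      then have "single m c \<in> ?J" using rel_ideal_mult[OF dc var] by metis
      from rel_ideal_add[OF add this] show ?thesis
        using False by (simp add: lookup_add lookup_single when_def algebra_simps)
    qed
  qed simp
  have "c = 0" if "single 0 c \<in> ?J" for c
    using lookup_rel_ideal_zero[OF _ that] by simp
  with span show ?thesis unfolding monomial_basis_def by auto
qed

section \<open>Matroid complexes and series classes\<close>

text \<open>\<open>E\<close> and \<open>r\<close> stay fixed while \<open>D\<close> varies: deleted
  elements remain as loops and contracted ones as coloops.\<close>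

locale matroid_complex =
  fixes E :: "'a set" and D :: "'a set set" and r :: nat
  assumes matroid_faces: "matroid E (\<lambda>X. X \<in> D)"
    and facet_exists: "\<exists>B\<in>D. card B = r"
    and card_face_le: "X \<in> D \<Longrightarrow> card X \<le> r"

definition cone_points :: "'a set \<Rightarrow> 'a set set \<Rightarrow> nat \<Rightarrow> 'a set" where
  "cone_points E D r = {e \<in> E. \<forall>B\<in>D. card B = r \<longrightarrow> e \<in> B}"

text \<open>No facet omits two elements of \<open>S\<close>; dually, \<open>S\<close> consists of
  pairwise parallel non-loops. A loop forms a series class on its own.\<close>

definition series :: "'a set \<Rightarrow> 'a set set \<Rightarrow> nat \<Rightarrow> 'a set \<Rightarrow> bool" where
  "series E D r S \<longleftrightarrow> S \<subseteq> E \<and> S \<noteq> {} \<and> S \<inter> cone_points E D r = {} \<and>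
     (\<forall>B\<in>D. card B = r \<longrightarrow> card (S - B) \<le> 1)"

definition series_class :: "'a set \<Rightarrow> 'a set set \<Rightarrow> nat \<Rightarrow> 'a set \<Rightarrow> bool" where
  "series_class E D r S \<longleftrightarrow> series E D r S \<and> (\<forall>S'. series E D r S' \<longrightarrow> S \<subseteq> S' \<longrightarrow> S' = S)"

context matroid_complex
begin

sublocale matroid E "\<lambda>X. X \<in> D" by (rule matroid_faces)

lemma down_closed_faces: "down_closed D"
  using indep_subset by (auto simp: down_closed_def)

lemma face_finite: "X \<in> D \<Longrightarrow> finite X"
  using indep_ground finite_ground finite_subset by blast

lemma finite_faces: "finite D"
  using indep_ground finite_ground by (intro finite_subset[of D "Pow E"]) auto

lemma extend_to_facet:
  assumes "X \<in> D" "Y \<in> D" "card Y = r"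
  shows "\<exists>B\<in>D. card B = r \<and> X \<subseteq> B \<and> B \<subseteq> X \<union> Y"
  using assms(1)
proof (induction "r - card X" arbitrary: X rule: less_induct)
  case less
  show ?case
  proof (cases "card X = r")
    case True
    then show ?thesis using less.prems by blast
  next
    case False
    then have lt: "card X < r" using card_face_le[OF less.prems] by simp
    then obtain y where y: "y \<in> Y - X" "insert y X \<in> D"
      using indep_augment[OF less.prems assms(2)] assms(3) by auto
    then have "card (insert y X) = Suc (card X)" using face_finite[OF less.prems] by simp
    then have "r - card (insert y X) < r - card X" using lt by simp
    from less.hyps[OF this y(2)] y(1) show ?thesis by blast
  qed
qed

lemma facet_avoiding:
  assumes "a \<in> E - cone_points E D r" "G \<in> D" "a \<notin> G"
  obtains B where "B \<in> D" "card B = r" "G \<subseteq> B" "a \<notin> B"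
proof -
  obtain B0 where "B0 \<in> D" "card B0 = r" "a \<notin> B0"
    using assms(1) by (auto simp: cone_points_def)
  then show ?thesis using extend_to_facet[OF assms(2)] assms(3) that by blast
qed

lemma series_finite: "series E D r S \<Longrightarrow> finite S"
  using finite_ground finite_subset by (auto simp: series_def)

lemma series_facet:
  assumes "series E D r S" "B \<in> D" "card B = r" "a \<in> S" "a \<notin> B"
  shows "S - {a} \<subseteq> B"
proof
  fix x assume x: "x \<in> S - {a}"
  show "x \<in> B"
  proof (rule ccontr)
    assume "x \<notin> B"
    then have "{a, x} \<subseteq> S - B" using x assms by auto
    moreover have "finite (S - B)" using series_finite[OF assms(1)] by simp
    ultimately have "card {a, x} \<le> card (S - B)" by (intro card_mono)
    moreover have "card (S - B) \<le> 1" using assms by (auto simp: series_def)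
    ultimately show False using x by (auto simp: card_insert_if split: if_splits)
  qed
qed

text \<open>A facet through \<open>G\<close> can be chosen to omit some \<open>a\<close> in
  \<open>S - A\<close>; it omits no second element of \<open>S\<close>, so it contains
  \<open>A\<close>.\<close>

lemma series_union:
  assumes S: "series E D r S" and A: "A \<subset> S" and G: "G \<in> D" "G \<inter> S = {}"
  shows "G \<union> A \<in> D"
proof -
  obtain a where a: "a \<in> S" "a \<notin> A" using A by blast
  then have "a \<in> E - cone_points E D r" "a \<notin> G" using S G by (auto simp: series_def)
  then obtain B where B: "B \<in> D" "card B = r" "G \<subseteq> B" "a \<notin> B"
    using facet_avoiding G(1) by metis
  have "G \<union> A \<subseteq> B" using series_facet[OF S B(1,2) a(1) B(4)] a A B(3) by blast
  then show ?thesis using indep_subset[OF B(1)] by blast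
qed

text \<open>Augment \<open>X \<union> S\<close> from \<open>Y \<union> S\<close> when the latter is
  larger. Otherwise \<open>Y\<close> is ahead inside \<open>S\<close>, whose elements can be added
  freely.\<close>

lemma matroid_complex_star:
  assumes S: "S \<in> D"
  shows "matroid_complex E (star D S) r"
proof
  note fin = face_finite
  show "finite E" by (rule finite_ground)
  show "{} \<in> star D S" using S by (simp add: star_def)
  show "X \<subseteq> E" if "X \<in> star D S" for X
    using that indep_ground by (auto simp: star_def)
  show Y: "Y \<in> star D S" if "X \<in> star D S" "Y \<subseteq> X" for X Y
    using that down_closed_star[OF down_closed_faces] by (auto simp: down_closed_def)
  obtain B0 where "B0 \<in> D" "card B0 = r" using facet_exists by blast
  then obtain B where B: "B \<in> D" "card B = r" "S \<subseteq> B" using extend_to_facet[OF S] by blast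
  then have "B \<in> star D S" by (simp add: star_def Un_absorb2)
  with B show "\<exists>B\<in>star D S. card B = r" by blast
  show "card X \<le> r" if "X \<in> star D S" for X
    using that star_subset[OF down_closed_faces] card_face_le by blast
  show "\<exists>y\<in>Y - X. insert y X \<in> star D S"
    if X: "X \<in> star D S" and Y: "Y \<in> star D S" and lt: "card X < card Y" for X Y
  proof -
    have XS: "X \<union> S \<in> D" and YS: "Y \<union> S \<in> D" using X Y by (auto simp: star_def)
    have f: "finite X" "finite Y" "finite S" using fin[OF XS] fin[OF YS] by auto
    show ?thesis
    proof (cases "card (X \<union> S) < card (Y \<union> S)")
      case True
      then obtain y where "y \<in> Y \<union> S - (X \<union> S)" "insert y (X \<union> S) \<in> D"
        using indep_augment[OF XS YS] by blast
      then show ?thesis by (auto simp: star_def)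
    next
      case False
      have "card (X \<union> S) + card (X \<inter> S) = card X + card S"
        "card (Y \<union> S) + card (Y \<inter> S) = card Y + card S"
        using f card_Un_Int by metis+
      then have "card (X \<inter> S) < card (Y \<inter> S)" using False lt by linarith
      then have "\<not> Y \<inter> S \<subseteq> X \<inter> S" using f card_mono[of "X \<inter> S" "Y \<inter> S"] by auto
      then obtain y where "y \<in> Y" "y \<in> S" "y \<notin> X" by blast
      then have "insert y X \<union> S = X \<union> S" by blast
      with XS have "insert y X \<in> star D S" by (simp add: star_def)
      then show ?thesis using \<open>y \<in> Y\<close> \<open>y \<notin> X\<close> by blast
    qed
  qed
qed

text \<open>By \<open>series_union\<close> this complex is the direct sum of the deletion of
  \<open>S\<close> and a circuit on \<open>S\<close>: a set is a face when its part outside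
  \<open>S\<close> is a face and it omits some element of \<open>S\<close>. Augmentation is checked
  on the two parts separately.\<close>

lemma matroid_complex_avoiding:
  assumes S: "series E D r S"
  shows "matroid_complex E (avoiding D S) r"
proof
  show "finite E" by (rule finite_ground)
  show "{} \<in> avoiding D S" using S indep_empty by (auto simp: avoiding_def series_def)
  show "X \<subseteq> E" if "X \<in> avoiding D S" for X
    using that indep_ground by (auto simp: avoiding_def)
  show "Y \<in> avoiding D S" if "X \<in> avoiding D S" "Y \<subseteq> X" for X Y
    using that down_closed_avoiding[OF down_closed_faces] by (auto simp: down_closed_def)
  obtain a where a: "a \<in> S" "a \<in> E - cone_points E D r" using S by (auto simp: series_def)
  then obtain B where "B \<in> D" "card B = r" "a \<notin> B"
    using facet_avoiding[of a "{}"] indep_empty by blast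
  then show "\<exists>B\<in>avoiding D S. card B = r" using a by (auto simp: avoiding_def)
  show "card X \<le> r" if "X \<in> avoiding D S" for X
    using that card_face_le by (auto simp: avoiding_def)
  show "\<exists>y\<in>Y - X. insert y X \<in> avoiding D S"
    if X: "X \<in> avoiding D S" and Y: "Y \<in> avoiding D S" and lt: "card X < card Y" for X Y
  proof -
    have XD: "X \<in> D" "\<not> S \<subseteq> X" and YD: "Y \<in> D" "\<not> S \<subseteq> Y"
      using X Y by (auto simp: avoiding_def)
    note f = face_finite[OF XD(1)] face_finite[OF YD(1)] series_finite[OF S]
    have c: "card (X - S) + card (X \<inter> S) = card X" "card (Y - S) + card (Y \<inter> S) = card Y"
      using f card_Int_Diff by (metis add.commute)+
    have ins: "insert y X \<in> D"
      if y: "insert y X - S \<in> D" "\<not> S \<subseteq> insert y X" for y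
      using series_union[OF S, of "insert y X \<inter> S" "insert y X - S"] y
      by (simp add: Un_Diff_Int) blast
    show ?thesis
    proof (cases "card (X - S) < card (Y - S)")
      case True
      have "X - S \<in> D" "Y - S \<in> D" using XD YD indep_subset by blast+
      then obtain y where y: "y \<in> Y - S" "y \<notin> X" "insert y (X - S) \<in> D"
        using indep_augment True by blast
      then have "insert y X - S = insert y (X - S)" "\<not> S \<subseteq> insert y X" using XD by auto
      then show ?thesis using y ins[of y] by (auto simp: avoiding_def)
    next
      case False
      then have lt': "card (X \<inter> S) < card (Y \<inter> S)" using c lt by linarith
      then have "\<not> Y \<inter> S \<subseteq> X \<inter> S" using f card_mono[of "X \<inter> S" "Y \<inter> S"] by auto
      then obtain y where y: "y \<in> Y" "y \<in> S" "y \<notin> X" by blast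
      \<comment> \<open>If \<open>y\<close> filled the last gap of \<open>S\<close>, then
        \<open>Y\<close>, which is strictly ahead on \<open>S\<close>, would contain all of
        \<open>S\<close>.\<close>
      have "\<not> S \<subseteq> insert y X"
      proof
        assume "S \<subseteq> insert y X"
        then have "S \<subseteq> insert y (X \<inter> S)" by blast
        then have "card S \<le> Suc (card (X \<inter> S))"
          using f card_mono[of "insert y (X \<inter> S)" S] y by simp
        then have "card S \<le> card (Y \<inter> S)" using lt' by simp
        then have "Y \<inter> S = S" using f by (intro card_seteq) auto
        then show False using YD by blast
      qed
      moreover have "insert y X - S \<in> D" using y XD indep_subset by auto
      ultimately show ?thesis using y ins[of y] by (auto simp: avoiding_def)
    qed
  qed
qed

text \<open>The facets of the star are exactly the facets of \<open>D\<close> containing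
  \<open>S\<close>, and any element outside \<open>S\<close> that is not a cone point is omitted by
  one of them.\<close>

lemma cone_points_star:
  assumes S: "S \<in> D"
  shows "cone_points E (star D S) r = cone_points E D r \<union> S"
proof (intro equalityI subsetI)
  fix e assume e: "e \<in> cone_points E (star D S) r"
  show "e \<in> cone_points E D r \<union> S"
  proof (rule ccontr)
    assume n: "e \<notin> cone_points E D r \<union> S"
    with e have "e \<in> E - cone_points E D r" by (simp add: cone_points_def)
    then obtain B where B: "B \<in> D" "card B = r" "S \<subseteq> B" "e \<notin> B"
      using facet_avoiding[OF _ S] n by blast
    then have "B \<in> star D S" by (simp add: star_def Un_absorb2)
    with B e show False by (auto simp: cone_points_def)
  qed
next
  fix e assume e: "e \<in> cone_points E D r \<union> S"
  have "e \<in> B" if B: "B \<in> star D S" "card B = r" for B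
  proof -
    have BS: "B \<union> S \<in> D" "B \<in> D" using B star_subset[OF down_closed_faces] by (auto simp: star_def)
    then have "B \<union> S = B"
      using card_face_le[OF BS(1)] B(2) face_finite[OF BS(1)] by (metis card_seteq sup_ge1)
    then show ?thesis using e BS B(2) by (auto simp: cone_points_def)
  qed
  moreover have "e \<in> E" using e S indep_ground by (auto simp: cone_points_def)
  ultimately show "e \<in> cone_points E (star D S) r" by (simp add: cone_points_def)
qed

lemma cone_points_avoiding_mono: "cone_points E D r \<subseteq> cone_points E (avoiding D S) r"
  by (auto simp: cone_points_def avoiding_def)

text \<open>A new cone point \<open>x\<close> lies in every facet that omits an element of
  \<open>S\<close>, so \<open>insert x S\<close> is still a series set. Maximality forces
  \<open>x\<close> into \<open>S\<close>; but then a facet omitting \<open>x\<close> does not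
  contain \<open>S\<close>, a contradiction. This is where a whole class is required.\<close>

lemma cone_points_avoiding:
  assumes S: "series_class E D r S"
  shows "cone_points E (avoiding D S) r \<subseteq> cone_points E D r"
proof
  fix x assume x: "x \<in> cone_points E (avoiding D S) r"
  have ser: "series E D r S" and max: "\<And>S'. series E D r S' \<Longrightarrow> S \<subseteq> S' \<Longrightarrow> S' = S"
    using S by (auto simp: series_class_def)
  show "x \<in> cone_points E D r"
  proof (rule ccontr)
    assume n: "x \<notin> cone_points E D r"
    have xE: "x \<in> E - cone_points E D r" using n x by (simp add: cone_points_def)
    have key: "card (insert x S - B) \<le> 1" if B: "B \<in> D" "card B = r" for B
    proof (cases "S \<subseteq> B")
      case True
      then have "insert x S - B \<subseteq> {x}" by blast
      then show ?thesis by (metis card_mono finite.emptyI finite.insertI is_singletonI is_singleton_altdef)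
    next
      case False
      with B x have "x \<in> B" by (auto simp: cone_points_def avoiding_def)
      then show ?thesis using ser B by (simp add: series_def insert_Diff_if)
    qed
    then have "series E D r (insert x S)"
      using ser xE by (auto simp: series_def)
    from max[OF this] have xS: "x \<in> S" by blast
    obtain B where B: "B \<in> D" "card B = r" "x \<notin> B"
      using facet_avoiding[OF xE, of "{}"] indep_empty by blast
    then have "B \<in> avoiding D S" using xS by (auto simp: avoiding_def)
    with B x show False by (auto simp: cone_points_def)
  qed
qed

lemma card_avoiding_less: "S \<in> D \<Longrightarrow> card (avoiding D S) < card D"
  by (rule psubset_card_mono[OF finite_faces]) (auto simp: avoiding_def)

text \<open>A facet omitting an element of \<open>S\<close> cannot be enlarged by it, so it is
  missing from the star. The number of faces is the measure of both inductions.\<close>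

lemma card_star_less:
  assumes S: "series E D r S"
  shows "card (star D S) < card D"
proof (rule psubset_card_mono[OF finite_faces])
  obtain a where a: "a \<in> S" "a \<in> E - cone_points E D r" using S by (auto simp: series_def)
  then obtain B where B: "B \<in> D" "card B = r" "a \<notin> B"
    using facet_avoiding[of a "{}"] indep_empty by blast
  have "B \<notin> star D S"
  proof
    assume "B \<in> star D S"
    then have "B \<union> S \<in> D" by (simp add: star_def)
    then have "insert a B \<in> D" using a indep_subset[of "B \<union> S"] by blast
    from card_face_le[OF this] show False using B face_finite[OF B(1)] by simp
  qed
  then show "star D S \<subset> D" using B star_subset[OF down_closed_faces] by blast
qed

lemma series_singleton:
  assumes "e \<in> E - cone_points E D r"
  shows "series E D r {e}"
proof -
  have "card ({e} - B) \<le> 1" for B by (simp add: insert_Diff_if)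
  then show ?thesis using assms by (simp add: series_def)
qed

lemma series_class_exists:
  assumes "e \<in> E - cone_points E D r"
  obtains S where "series_class E D r S" "e \<in> S"
proof -
  let ?F = "{S. series E D r S \<and> e \<in> S}"
  have "finite ?F" using finite_ground by (intro finite_subset[of ?F "Pow E"]) (auto simp: series_def)
  moreover have "{e} \<in> ?F" using series_singleton[OF assms] by simp
  ultimately obtain S where "S \<in> ?F" "\<forall>S'\<in>?F. S \<subseteq> S' \<longrightarrow> S = S'"
    using finite_has_maximal[of ?F] by blast
  then have "series_class E D r S" "e \<in> S" unfolding series_class_def by blast+
  then show ?thesis by (rule that)
qed

text \<open>Being in series is transitive, dually to parallelism: if two series sets share
  \<open>e\<close>, their union is again a series set.\<close>

lemma series_class_disjoint:
  assumes S: "series_class E D r S" "series_class E D r S'" and ne: "S \<noteq> S'"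
  shows "S \<inter> S' = {}"
proof (rule ccontr)
  assume "S \<inter> S' \<noteq> {}"
  then obtain e where e: "e \<in> S" "e \<in> S'" by blast
  have ser: "series E D r S" "series E D r S'" using S by (auto simp: series_class_def)
  have "card (S \<union> S' - B) \<le> 1" if B: "B \<in> D" "card B = r" for B
  proof (rule ccontr)
    assume "\<not> card (S \<union> S' - B) \<le> 1"
    moreover have "finite (S \<union> S' - B)" using series_finite ser by simp
    ultimately obtain x y where xy: "x \<in> S \<union> S'" "y \<in> S \<union> S'" "x \<notin> B" "y \<notin> B" "x \<noteq> y"
      by (auto simp: card_le_Suc0_iff_eq)
    \<comment> \<open>A facet omitting \<open>e\<close> would contain all other elements of both
      sets, hence one of \<open>x\<close> and \<open>y\<close>.\<close>
    have eB: "e \<in> B"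
      using series_facet[OF ser(1) B e(1)] series_facet[OF ser(2) B e(2)] xy by blast
    have "e \<in> E - cone_points E D r" using e ser(1) by (auto simp: series_def)
    then obtain B0 where B0: "B0 \<in> D" "card B0 = r" "e \<notin> B0"
      using facet_avoiding[of e "{}"] indep_empty by blast
    have "card (B - {e}) < card B0"
      using B B0(2) eB face_finite[OF B(1)] by (metis card_Diff1_less)
    \<comment> \<open>Exchanging \<open>e\<close> for \<open>z\<close> gives a facet that omits
      \<open>e\<close> and so contains everything else in the union; both \<open>x\<close> and
      \<open>y\<close> would have to be \<open>z\<close>.\<close>
    then obtain z where z: "z \<in> B0 - (B - {e})" "insert z (B - {e}) \<in> D"
      using indep_augment[of "B - {e}" B0] indep_subset[OF B(1)] B0(1) by blast
    let ?B = "insert z (B - {e})"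
    have "z \<noteq> e" "z \<notin> B" using z B0 by auto
    then have "card ?B = Suc (card (B - {e}))" using face_finite[OF B(1)] by simp
    then have cB: "card ?B = r" using card_Suc_Diff1[OF face_finite[OF B(1)] eB] B(2) by simp
    have eB': "e \<notin> ?B" using \<open>z \<noteq> e\<close> by simp
    have "S - {e} \<subseteq> ?B" "S' - {e} \<subseteq> ?B"
      using series_facet[OF ser(1) z(2) cB e(1) eB'] series_facet[OF ser(2) z(2) cB e(2) eB'] .
    then have "{x, y} \<subseteq> {z}" using xy eB by blast
    then show False using xy(5) by blast
  qed
  then have "series E D r (S \<union> S')" using ser by (auto simp: series_def)
  then have "S \<union> S' = S" "S \<union> S' = S'" using S by (auto simp: series_class_def)
  with ne show False by simp
qed

text \<open>Starting from the cone points, the classes are added one at a time by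
  \<open>series_union\<close>; disjointness keeps the part already built away from the next
  class.\<close>

lemma faces_of_dependent_classes:
  assumes dep: "\<And>S. series_class E D r S \<Longrightarrow> S \<notin> D"
  shows "D = {F. F \<subseteq> E \<and> (\<forall>S. series_class E D r S \<longrightarrow> \<not> S \<subseteq> F)}"
proof (intro equalityI subsetI)
  fix F assume "F \<in> D"
  then show "F \<in> {F. F \<subseteq> E \<and> (\<forall>S. series_class E D r S \<longrightarrow> \<not> S \<subseteq> F)}"
    using dep indep_ground indep_subset by blast
next
  fix F assume F: "F \<in> {F. F \<subseteq> E \<and> (\<forall>S. series_class E D r S \<longrightarrow> \<not> S \<subseteq> F)}"
  let ?P = "{S. series_class E D r S}"
  let ?C = "F \<inter> cone_points E D r"
  have finP: "finite ?P"
    using finite_ground by (intro finite_subset[of ?P "Pow E"]) (auto simp: series_class_def series_def)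
  have "?C \<union> (F \<inter> \<Union>Q) \<in> D" if "finite Q" "Q \<subseteq> ?P" for Q
    using that
  proof (induction Q rule: finite_induct)
    case empty
    obtain B where "B \<in> D" "card B = r" using facet_exists by blast
    then show ?case using indep_subset[of B ?C] by (auto simp: cone_points_def)
  next
    case (insert S Q)
    have S: "series_class E D r S" using insert.prems by blast
    then have ser: "series E D r S" by (simp add: series_class_def)
    have "S \<inter> S' = {}" if "S' \<in> Q" for S'
      using series_class_disjoint[OF S] insert.prems insert.hyps that by blast
    then have "(?C \<union> (F \<inter> \<Union>Q)) \<inter> S = {}" using ser by (auto simp: series_def)
    moreover have "F \<inter> S \<subset> S" using F S by blast
    ultimately have "?C \<union> (F \<inter> \<Union>Q) \<union> (F \<inter> S) \<in> D"
      using series_union[OF ser] insert by blast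
    moreover have "?C \<union> (F \<inter> \<Union>Q) \<union> (F \<inter> S) = ?C \<union> (F \<inter> \<Union>(insert S Q))" by blast
    ultimately show ?case by simp
  qed
  then have "?C \<union> (F \<inter> \<Union>?P) \<in> D" using finP by blast
  moreover have "?C \<union> (F \<inter> \<Union>?P) = F" using F series_class_exists by blast
  ultimately show "F \<in> D" by simp
qed

text \<open>Each facet omits exactly one element of every class: at most one by the series
  condition, at least one because the class is dependent. The classes partition everything outside
  the cone points.\<close>

lemma card_dependent_classes:
  assumes dep: "\<And>S. series_class E D r S \<Longrightarrow> S \<notin> D"
  shows "r + card {S. series_class E D r S} = card E"
proof -
  let ?P = "{S. series_class E D r S}"
  obtain B where B: "B \<in> D" "card B = r" using facet_exists by blast
  have finP: "finite ?P"
    using finite_ground by (intro finite_subset[of ?P "Pow E"]) (auto simp: series_class_def series_def)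
  have ser: "series E D r S" if "S \<in> ?P" for S using that by (simp add: series_class_def)
  have one: "card (S - B) = 1" if S: "S \<in> ?P" for S
  proof -
    have "\<not> S \<subseteq> B" using dep S indep_subset[OF B(1)] by blast
    then have "card (S - B) \<noteq> 0" using series_finite[OF ser[OF S]] by auto
    moreover have "card (S - B) \<le> 1" using ser[OF S] B by (auto simp: series_def)
    ultimately show ?thesis by simp
  qed
  have "E - B \<subseteq> (\<Union>S\<in>?P. S - B)"
  proof
    fix e assume e: "e \<in> E - B"
    then have "e \<in> E - cone_points E D r" using B by (auto simp: cone_points_def)
    then show "e \<in> (\<Union>S\<in>?P. S - B)" using series_class_exists e by blast
  qed
  moreover have "(\<Union>S\<in>?P. S - B) \<subseteq> E - B" using ser by (auto simp: series_def)
  ultimately have "E - B = (\<Union>S\<in>?P. S - B)" by (rule equalityI)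
  moreover have "card (\<Union>S\<in>?P. S - B) = (\<Sum>S\<in>?P. card (S - B))"
  proof (rule card_UN_disjoint[OF finP])
    show "\<forall>S\<in>?P. finite (S - B)" using series_finite[OF ser] by simp
    show "\<forall>S\<in>?P. \<forall>S'\<in>?P. S \<noteq> S' \<longrightarrow> (S - B) \<inter> (S' - B) = {}"
      using series_class_disjoint by blast
  qed
  ultimately have "card (E - B) = (\<Sum>S\<in>?P. card (S - B))" by simp
  also have "\<dots> = card ?P" using one by simp
  finally have "card (E - B) = card ?P" .
  moreover have "card (E - B) + card B = card E"
    using B indep_ground[OF B(1)] finite_ground
    by (metis card_Diff_subset card_mono face_finite le_add_diff_inverse2)
  ultimately show ?thesis using B(2) by simp
qed

text \<open>Every vertex is a cone point and all other elements are loops, so there is only one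
  facet.\<close>

lemma simplex_if_no_cocircuit:
  assumes "\<And>e. e \<in> E - cone_points E D r \<Longrightarrow> {e} \<notin> D"
  obtains B where "B \<subseteq> E" "finite B" "card B = r" "D = Pow B"
proof -
  obtain B where B: "B \<in> D" "card B = r" using facet_exists by blast
  have "F \<subseteq> cone_points E D r" if F: "F \<in> D" for F
    using assms indep_ground[OF F] indep_subset[OF F] by blast
  moreover have "cone_points E D r \<subseteq> B" using B by (auto simp: cone_points_def)
  ultimately have "D = Pow B" using indep_subset[OF B(1)] by blast
  then show ?thesis using that B indep_ground face_finite by blast
qed

end

text \<open>Deletion and contraction of one element that is neither a loop nor a coloop.\<close>

lemma matroid_complex_induct [consumes 1, case_names simplex step]:
  assumes "matroid_complex E D r"
    and simplex: "\<And>B. B \<subseteq> E \<Longrightarrow> finite B \<Longrightarrow> card B = r \<Longrightarrow> P (Pow B)"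
    and step: "\<And>D e. matroid_complex E D r \<Longrightarrow> {e} \<in> D \<Longrightarrow> e \<in> E - cone_points E D r \<Longrightarrow>
      P (star D {e}) \<Longrightarrow> P (avoiding D {e}) \<Longrightarrow> P D"
  shows "P D"
  using assms(1)
proof (induction "card D" arbitrary: D rule: less_induct)
  case less
  interpret matroid_complex E D r by (rule less.prems)
  show ?case
  proof (cases "\<exists>e\<in>E - cone_points E D r. {e} \<in> D")
    case True
    then obtain e where e: "e \<in> E - cone_points E D r" "{e} \<in> D" by blast
    note s = series_singleton[OF e(1)]
    show ?thesis
      by (rule step[OF less.prems e(2,1) less.hyps[OF card_star_less[OF s] matroid_complex_star[OF e(2)]]
            less.hyps[OF card_avoiding_less[OF e(2)] matroid_complex_avoiding[OF s]]])
  next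
    case False
    then have "{e} \<notin> D" if "e \<in> E - cone_points E D r" for e using that by blast
    then obtain B where B: "B \<subseteq> E" "finite B" "card B = r" "D = Pow B"
      by (rule simplex_if_no_cocircuit)
    show ?thesis unfolding B(4) by (rule simplex[OF B(1-3)])
  qed
qed

text \<open>Splitting off whole independent classes stops earlier, at complexes all of whose classes
  are dependent; these need a construction of their own.\<close>

lemma series_class_induct [consumes 1, case_names dependent step]:
  assumes "matroid_complex E D r"
    and dependent: "\<And>D. matroid_complex E D r \<Longrightarrow>
      (\<And>S. series_class E D r S \<Longrightarrow> S \<notin> D) \<Longrightarrow> P D"
    and step: "\<And>D S. matroid_complex E D r \<Longrightarrow> S \<in> D \<Longrightarrow> series_class E D r S \<Longrightarrow>
      P (star D S) \<Longrightarrow> P (avoiding D S) \<Longrightarrow> P D"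
  shows "P D"
  using assms(1)
proof (induction "card D" arbitrary: D rule: less_induct)
  case less
  interpret matroid_complex E D r by (rule less.prems)
  show ?case
  proof (cases "\<exists>S\<in>D. series_class E D r S")
    case True
    then obtain S where S: "S \<in> D" "series_class E D r S" by blast
    then have s: "series E D r S" by (simp add: series_class_def)
    show ?thesis
      by (rule step[OF less.prems S less.hyps[OF card_star_less[OF s] matroid_complex_star[OF S(1)]]
            less.hyps[OF card_avoiding_less[OF S(1)] matroid_complex_avoiding[OF s]]])
  next
    case False
    then have "S \<notin> D" if "series_class E D r S" for S using that by blast
    then show ?thesis by (rule dependent[OF less.prems])
  qed
qed

text \<open>The set \<B> is chosen before \<theta>, since the recursion that builds it looks only at
  \<open>D\<close>. In the degree bound the star has one more cone point, which pays for the extra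
  factor \<open>mon_of {e}\<close>, while new cone points of the deletion only sharpen it.\<close>

theorem koszul_and_basis:
  fixes D :: "'a set set"
  assumes "matroid_complex E D r"
  shows "(\<forall>\<theta> :: nat \<Rightarrow> 'a \<Rightarrow> 'k::field_char_0. is_lsop D r \<theta> \<longrightarrow>
      koszul D r (\<lambda>l. one_form E (\<theta> l))) \<and>
    (\<exists>\<B>. (\<forall>m\<in>\<B>. keys m \<in> D \<and> total_degree_monom m + card (cone_points E D r) \<le> r) \<and>
      (\<forall>\<theta> :: nat \<Rightarrow> 'a \<Rightarrow> 'k. is_lsop D r \<theta> \<longrightarrow>
        monomial_basis (rel_ideal D r (\<lambda>l. one_form E (\<theta> l))) \<B>))"
proof -
  have finE: "finite E"
    using assms unfolding matroid_complex_def matroid_def by blast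
  from assms show ?thesis
  proof (induction D rule: matroid_complex_induct)
    case (simplex B)
    have "cone_points E (Pow B) r \<subseteq> B" using simplex by (auto simp: cone_points_def)
    then have "card (cone_points E (Pow B) r) \<le> r" using simplex card_mono by metis
    then show ?case
      using koszul_simplex[OF simplex(2,3) _ finE simplex(1)]
        monomial_basis_simplex[OF simplex(2,3) _ finE simplex(1)]
      by (intro conjI exI[of _ "{0}"]) auto
  next
    case (step D e)
    interpret matroid_complex E D r by (rule step)
    note dc = down_closed_faces
    have lsop: "is_lsop (star D {e}) r \<theta>" "is_lsop (avoiding D {e}) r \<theta>"
      if "is_lsop D r \<theta>" for \<theta> :: "nat \<Rightarrow> 'a \<Rightarrow> 'k"
      using is_lsop_subset[OF that] star_subset[OF dc] avoiding_subset by blast+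
    have av: "koszul (avoiding D {e}) r (\<lambda>l. one_form E (\<theta> l))"
      if "is_lsop D r \<theta>" for \<theta> :: "nat \<Rightarrow> 'a \<Rightarrow> 'k"
      using step.IH(2) lsop[OF that] by blast
    have "koszul D r (\<lambda>l. one_form E (\<theta> l))"
      if "is_lsop D r \<theta>" for \<theta> :: "nat \<Rightarrow> 'a \<Rightarrow> 'k"
      using koszul_step[OF dc _ _ av[OF that]] step.IH(1) lsop[OF that] by simp
    moreover
    obtain \<B>1 where B1: "\<forall>m\<in>\<B>1. keys m \<in> avoiding D {e} \<and>
        total_degree_monom m + card (cone_points E (avoiding D {e}) r) \<le> r"
      "\<forall>\<theta> :: nat \<Rightarrow> 'a \<Rightarrow> 'k. is_lsop (avoiding D {e}) r \<theta> \<longrightarrow>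
        monomial_basis (rel_ideal (avoiding D {e}) r (\<lambda>l. one_form E (\<theta> l))) \<B>1"
      using step.IH(2) by blast
    obtain \<B>2 where B2: "\<forall>m\<in>\<B>2. keys m \<in> star D {e} \<and>
        total_degree_monom m + card (cone_points E (star D {e}) r) \<le> r"
      "\<forall>\<theta> :: nat \<Rightarrow> 'a \<Rightarrow> 'k. is_lsop (star D {e}) r \<theta> \<longrightarrow>
        monomial_basis (rel_ideal (star D {e}) r (\<lambda>l. one_form E (\<theta> l))) \<B>2"
      using step.IH(1) by blast
    let ?B = "\<B>1 \<union> (+) (mon_of {e}) ` \<B>2"
    have "keys m \<in> D \<and> total_degree_monom m + card (cone_points E D r) \<le> r" if m: "m \<in> ?B" for m
      using m
    proof
      assume m1: "m \<in> \<B>1"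
      have "finite (cone_points E (avoiding D {e}) r)"
        using finE by (rule finite_subset[rotated]) (auto simp: cone_points_def)
      then have "card (cone_points E D r) \<le> card (cone_points E (avoiding D {e}) r)"
        using cone_points_avoiding_mono by (rule card_mono)
      with B1(1) m1 show ?thesis using avoiding_subset[of D "{e}"] by fastforce
    next
      assume "m \<in> (+) (mon_of {e}) ` \<B>2"
      then obtain n where n: "n \<in> \<B>2" "m = mon_of {e} + n" by blast
      have "finite (cone_points E D r)"
        using finE by (rule finite_subset[rotated]) (auto simp: cone_points_def)
      then have "card (cone_points E (star D {e}) r) = Suc (card (cone_points E D r))"
        using cone_points_star[OF step.hyps(2)] step.hyps(3) by simp
      moreover have "keys n \<union> {e} \<in> D" using B2(1) n by (auto simp: star_def)
      ultimately show ?thesis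
        using B2(1) n by (auto simp: keys_add_nat keys_mon_of total_degree_add total_degree_mon_of)
    qed
    moreover have "monomial_basis (rel_ideal D r (\<lambda>l. one_form E (\<theta> l))) ?B"
      if l: "is_lsop D r \<theta>" for \<theta> :: "nat \<Rightarrow> 'a \<Rightarrow> 'k"
      using B1 B2(2) lsop[OF l] av[OF l]
      by (intro monomial_basis_step[OF dc]) (auto simp: avoiding_def)
    ultimately show ?case by (intro conjI exI[of _ ?B]) blast+
  qed
qed

section \<open>Injectivity as a spanning condition\<close>

text \<open>All exponents with \<open>2 * i + k \<le> t\<close> are allowed, not just the largest:
  along the degree shift to the star equality is lost.\<close>

definition lefschetz :: "'v set \<Rightarrow> ('v, 'k::field) mpoly set \<Rightarrow> ('v, 'k) mpoly \<Rightarrow> nat \<Rightarrow> bool" where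
  "lefschetz E J \<omega> t \<longleftrightarrow>
     (\<forall>i k f. 2 * i + k \<le> t \<longrightarrow> f \<in> homogeneous E i \<longrightarrow> \<omega> ^ k * f \<in> J \<longrightarrow> f \<in> J)"

lemma lefschetz_iff:
  assumes "\<And>f g. f \<in> J \<Longrightarrow> g * f \<in> J"
  shows "lefschetz E J \<omega> t \<longleftrightarrow>
    (\<forall>i. 2 * i \<le> t \<longrightarrow> (\<forall>f\<in>homogeneous E i. \<omega> ^ (t - 2 * i) * f \<in> J \<longrightarrow> f \<in> J))"
proof
  assume "lefschetz E J \<omega> t"
  then show "\<forall>i. 2 * i \<le> t \<longrightarrow> (\<forall>f\<in>homogeneous E i. \<omega> ^ (t - 2 * i) * f \<in> J \<longrightarrow> f \<in> J)"
    unfolding lefschetz_def by (metis le_add_diff_inverse order_refl)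
next
  assume *: "\<forall>i. 2 * i \<le> t \<longrightarrow> (\<forall>f\<in>homogeneous E i. \<omega> ^ (t - 2 * i) * f \<in> J \<longrightarrow> f \<in> J)"
  show "lefschetz E J \<omega> t"
    unfolding lefschetz_def
  proof (intro allI impI)
    fix i k f assume ik: "2 * i + k \<le> t" and f: "f \<in> homogeneous E i" "\<omega> ^ k * f \<in> J"
    have "t - 2 * i = (t - 2 * i - k) + k" using ik by simp
    then have "\<omega> ^ (t - 2 * i) * f = \<omega> ^ (t - 2 * i - k) * (\<omega> ^ k * f)"
      by (metis mult.assoc power_add)
    then have J: "\<omega> ^ (t - 2 * i) * f \<in> J" using assms[OF f(2)] by simp
    have "2 * i \<le> t" using ik by simp
    from *[rule_format, OF this f(1) J] show "f \<in> J" .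
  qed
qed

text \<open>Spans, independence and dimension for polynomials, on which the field acts through
  constants.\<close>

global_interpretation poly_vs: vector_space "\<lambda>(c::'k::field) (f::('v, 'k) mpoly). const c * f"
  defines poly_span = poly_vs.span
  by unfold_locales (simp_all add: algebra_simps const_def single_add mult_single)

lemma const_single: "const c * single m d = single m (c * d)"
  by (simp add: const_def mult_single)

lemma const_mult_left: "const c * (f * g) = f * (const c * g)"
  by (simp add: mult.left_commute)

lemma inj_monomials: "inj_on (\<lambda>m. single m (1::'k::zero_neq_one)) A"
  by (rule inj_onI) (metis lookup_single_eq lookup_single_not_eq zero_neq_one)

lemma monomials_independent:
  fixes A :: "('v \<Rightarrow>\<^sub>0 nat) set"
  assumes "finite A"
  shows "\<not> poly_vs.dependent ((\<lambda>m. single m (1::'k::field)) ` A)"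
proof (rule poly_vs.independent_if_scalars_zero)
  fix f :: "('v, 'k) mpoly \<Rightarrow> 'k" and x
  assume s: "(\<Sum>x\<in>(\<lambda>m. single m 1) ` A. const (f x) * x) = 0"
    and x: "x \<in> (\<lambda>m. single m (1::'k)) ` A"
  then obtain m where m: "m \<in> A" "x = single m 1" by blast
  have "(\<Sum>n\<in>A. single n (f (single n 1))) = 0"
    using s by (simp add: sum.reindex[OF inj_monomials] const_single)
  then have "lookup (\<Sum>n\<in>A. single n (f (single n 1))) m = 0" by simp
  then show "f x = 0" using m assms by (simp add: lookup_sum lookup_single when_def)
qed (use assms in simp)

text \<open>Dimensions of graded pieces of the quotient are counted in spans of basis monomials,
  which meet \<open>J\<close> only in zero.\<close>

locale graded_quotient =
  fixes E :: "'v set" and J :: "('v, 'k::field) mpoly set" and \<B> :: "('v \<Rightarrow>\<^sub>0 nat) set"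
  assumes ideal_add: "f \<in> J \<Longrightarrow> g \<in> J \<Longrightarrow> f + g \<in> J"
    and ideal_mult: "f \<in> J \<Longrightarrow> h * f \<in> J"
    and ideal_hpart: "f \<in> J \<Longrightarrow> hpart E j f \<in> J"
    and basis: "monomial_basis J \<B>"
    and basis_keys: "m \<in> \<B> \<Longrightarrow> keys m \<subseteq> E"
begin

lemma ideal_zero: "0 \<in> J"
  using basis ideal_mult[of _ 0] unfolding monomial_basis_def by fastforce

lemma ideal_diff: "f \<in> J \<Longrightarrow> g \<in> J \<Longrightarrow> f - g \<in> J"
  using ideal_add[of f "- g"] ideal_mult[of g "- 1"] by simp

lemma ideal_sum: "(\<And>x. x \<in> A \<Longrightarrow> f x \<in> J) \<Longrightarrow> sum f A \<in> J"
  by (induction A rule: infinite_finite_induct) (auto intro: ideal_add ideal_zero)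

definition graded_basis :: "nat \<Rightarrow> ('v \<Rightarrow>\<^sub>0 nat) set" where
  "graded_basis i = {m \<in> \<B>. total_degree_monom m = i}"

lemma finite_graded_basis: "finite (graded_basis i)"
  using basis by (simp add: graded_basis_def monomial_basis_def)

lemma graded_basis_homogeneous: "m \<in> graded_basis i \<Longrightarrow> single m c \<in> homogeneous E i"
  using basis_keys by (auto simp: graded_basis_def intro: homogeneous_single)

text \<open>As \<open>J\<close> is homogeneous, projecting a representation to degree
  \<open>i\<close> discards the basis monomials of other degrees.\<close>

lemma normal_form:
  assumes "f \<in> homogeneous E i"
  obtains c where "f - (\<Sum>m\<in>graded_basis i. single m (c m)) \<in> J"
proof -
  obtain c where c: "f - (\<Sum>m\<in>\<B>. single m (c m)) \<in> J"
    using basis unfolding monomial_basis_def by blast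
  have fin: "finite \<B>" using basis by (simp add: monomial_basis_def)
  have h: "hpart E i (single m (c m)) = (if total_degree_monom m = i then single m (c m) else 0)"
    if "m \<in> \<B>" for m
    using basis_keys[OF that]
    by (intro poly_mapping_eqI) (auto simp: lookup_hpart lookup_single when_def)
  have "hpart E i (\<Sum>m\<in>\<B>. single m (c m)) =
      (\<Sum>m\<in>\<B>. if total_degree_monom m = i then single m (c m) else 0)"
    unfolding hpart_sum using h by (intro sum.cong) auto
  also have "\<dots> = (\<Sum>m\<in>graded_basis i. single m (c m))"
    using fin by (simp add: graded_basis_def sum.inter_filter)
  finally have "f - (\<Sum>m\<in>graded_basis i. single m (c m)) \<in> J"
    using ideal_hpart[OF c, of i] hpart_id[OF assms] by (simp add: hpart_diff)
  then show ?thesis by (rule that)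
qed

lemma graded_basis_indep:
  assumes "(\<Sum>m\<in>graded_basis i. single m (c m)) \<in> J" "m \<in> graded_basis i"
  shows "c m = 0"
proof -
  have "(\<Sum>m\<in>\<B>. single m (if total_degree_monom m = i then c m else 0)) =
      (\<Sum>m\<in>\<B>. if total_degree_monom m = i then single m (c m) else 0)"
    by (intro sum.cong) auto
  also have "\<dots> = (\<Sum>m\<in>graded_basis i. single m (c m))"
    using basis by (simp add: graded_basis_def sum.inter_filter monomial_basis_def)
  finally show ?thesis
    using monomial_basis_indep[OF basis, of "\<lambda>m. if total_degree_monom m = i then c m else 0" m]
      assms by (simp add: graded_basis_def)
qed

abbreviation monomials :: "('v \<Rightarrow>\<^sub>0 nat) set \<Rightarrow> ('v, 'k) mpoly set" where
  "monomials A \<equiv> (\<lambda>m. single m 1) ` A"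

lemma span_monomials:
  assumes "finite A"
  shows "poly_vs.span (monomials A) = range (\<lambda>c. \<Sum>m\<in>A. single m (c m))"
proof -
  have "poly_vs.span (monomials A) = range (\<lambda>u. \<Sum>m\<in>A. single m (u (single m (1::'k))))"
    using assms by (simp add: poly_vs.span_finite sum.reindex[OF inj_monomials] const_single)
  also have "\<dots> = range (\<lambda>c. \<Sum>m\<in>A. single m (c m))"
  proof (intro equalityI subsetI)
    fix x assume "x \<in> range (\<lambda>c. \<Sum>m\<in>A. single m (c m))"
    then obtain c where x: "x = (\<Sum>m\<in>A. single m (c m))" by blast
    have "(\<Sum>m\<in>A. single m (c m)) =
        (\<Sum>m\<in>A. single m (c (the_inv_into A (\<lambda>m. single m (1::'k)) (single m (1::'k)))))"
      by (intro sum.cong) (simp_all add: the_inv_into_f_f[OF inj_monomials])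
    then show "x \<in> range (\<lambda>u. \<Sum>m\<in>A. single m (u (single m (1::'k))))" using x by auto
  qed auto
  finally show ?thesis .
qed

lemma span_ideal_zero:
  assumes "x \<in> poly_vs.span (monomials (graded_basis j))" "x \<in> J"
  shows "x = 0"
proof -
  obtain c where c: "x = (\<Sum>m\<in>graded_basis j. single m (c m))"
    using assms(1) unfolding span_monomials[OF finite_graded_basis] by blast
  then have "c m = 0" if "m \<in> graded_basis j" for m using graded_basis_indep assms(2) that by blast
  then show ?thesis using c by simp
qed

text \<open>Membership in the image of degree \<open>i\<close> under \<eta> plus the span of
  \<open>B\<close>. Existence of coefficients is what spreads to neighbouring points.\<close>

definition spans :: "('v, 'k) mpoly \<Rightarrow> nat \<Rightarrow> ('v \<Rightarrow>\<^sub>0 nat) set \<Rightarrow> ('v, 'k) mpoly \<Rightarrow> bool" where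
  "spans \<eta> i B f \<longleftrightarrow> (\<exists>c d. f - (\<Sum>m\<in>graded_basis i. const (c m) * (\<eta> * single m 1)) -
     (\<Sum>m\<in>B. single m (d m)) \<in> J)"

lemma normal_form_family:
  assumes "\<eta> \<in> homogeneous E k" "j = k + i"
  obtains v where "\<And>m. m \<in> graded_basis i \<Longrightarrow> v m \<in> poly_vs.span (monomials (graded_basis j))"
    "\<And>m. m \<in> graded_basis i \<Longrightarrow> \<eta> * single m 1 - v m \<in> J"
proof -
  have "\<exists>v. v \<in> poly_vs.span (monomials (graded_basis j)) \<and> \<eta> * single m 1 - v \<in> J"
    if "m \<in> graded_basis i" for m
  proof -
    have "\<eta> * single m 1 \<in> homogeneous E j"
      using homogeneous_mult[OF assms(1) graded_basis_homogeneous[OF that]] assms(2) by simp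
    then obtain c where "\<eta> * single m 1 - (\<Sum>m\<in>graded_basis j. single m (c m)) \<in> J"
      by (rule normal_form)
    then show ?thesis unfolding span_monomials[OF finite_graded_basis] by blast
  qed
  then show ?thesis using that by metis
qed

lemma combination_normal_form:
  assumes "\<And>m. m \<in> graded_basis i \<Longrightarrow> \<eta> * single m 1 - v m \<in> J"
  shows "(\<Sum>m\<in>graded_basis i. const (c m) * (\<eta> * single m 1)) -
    (\<Sum>m\<in>graded_basis i. const (c m) * v m) \<in> J"
proof -
  have "(\<Sum>m\<in>graded_basis i. const (c m) * (\<eta> * single m 1 - v m)) \<in> J"
    using assms by (intro ideal_sum ideal_mult)
  then show ?thesis by (simp add: right_diff_distrib sum_subtractf)
qed

lemma combination_eq: "(\<Sum>m\<in>graded_basis i. const (c m) * (\<eta> * single m 1)) =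
    \<eta> * (\<Sum>m\<in>graded_basis i. single m (c m))"
  by (simp add: sum_distrib_left const_mult_left const_single)

text \<open>The images of a basis of degree \<open>i\<close> stay independent and are completed by
  monomials to a basis of degree \<open>j\<close>. \<open>B\<close> consists of the added monomials,
  so its size is the codimension of the image.\<close>

lemma injective_imp_spans:
  assumes \<eta>: "\<eta> \<in> homogeneous E k" and j: "j = k + i"
    and inj: "\<And>f. f \<in> homogeneous E i \<Longrightarrow> \<eta> * f \<in> J \<Longrightarrow> f \<in> J"
  shows "\<exists>B\<subseteq>graded_basis j. card B + card (graded_basis i) = card (graded_basis j) \<and>
    (\<forall>f\<in>homogeneous E j. spans \<eta> i B f)"
proof -
  let ?A = "graded_basis i" and ?T = "monomials (graded_basis j)"
  obtain v where v: "\<And>m. m \<in> ?A \<Longrightarrow> v m \<in> poly_vs.span ?T"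
    "\<And>m. m \<in> ?A \<Longrightarrow> \<eta> * single m 1 - v m \<in> J"
    using normal_form_family[OF \<eta> j] by blast
  have ind: "c m = 0" if c: "(\<Sum>m\<in>?A. const (c m) * v m) = 0" and m: "m \<in> ?A" for c m
  proof -
    let ?f = "\<Sum>m\<in>?A. single m (c m)"
    have "\<eta> * ?f \<in> J"
      using combination_normal_form[where c = c and i = i, OF v(2)] c
      unfolding combination_eq by simp
    then have "?f \<in> J" using inj homogeneous_sum graded_basis_homogeneous by metis
    then show ?thesis using graded_basis_indep m by blast
  qed
  have injv: "inj_on v ?A"
  proof (rule inj_onI, rule ccontr)
    fix x y assume xy: "x \<in> ?A" "y \<in> ?A" "v x = v y" "x \<noteq> y"
    \<comment> \<open>Equal images would give the relation \<open>v x - v y = 0\<close>; repetitions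
      must be excluded before the family is treated as a set.\<close>
    let ?c = "\<lambda>m. if m = x then 1 else if m = y then - 1 else 0 :: 'k"
    have "(\<Sum>m\<in>?A. const (?c m) * v m) = (\<Sum>m\<in>{x, y}. const (?c m) * v m)"
      using xy finite_graded_basis by (intro sum.mono_neutral_right) auto
    also have "\<dots> = 0" using xy by (simp add: const_minus)
    finally have "?c x = 0" using ind[of ?c x] xy(1) by blast
    then show False by simp
  qed
  have indv: "\<not> poly_vs.dependent (v ` ?A)"
  proof (rule poly_vs.independent_if_scalars_zero)
    fix f x assume f: "(\<Sum>x\<in>v ` ?A. const (f x) * x) = 0" and x: "x \<in> v ` ?A"
    have "(\<Sum>m\<in>?A. const (f (v m)) * v m) = 0" using f by (simp add: sum.reindex[OF injv])
    then show "f x = 0" using ind[of "\<lambda>m. f (v m)"] x by blast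
  qed (use finite_graded_basis in simp)
  obtain C where C: "v ` ?A \<subseteq> C" "C \<subseteq> v ` ?A \<union> ?T" "\<not> poly_vs.dependent C"
    "v ` ?A \<union> ?T \<subseteq> poly_vs.span C"
    using poly_vs.maximal_independent_subset_extend[OF Un_upper1 indv] by blast
  have finC: "finite C" by (rule finite_subset[OF C(2)]) (simp add: finite_graded_basis)
  have "v ` ?A \<union> ?T \<subseteq> poly_vs.span ?T" using v(1) poly_vs.span_superset[of ?T] by auto
  then have CT: "C \<subseteq> poly_vs.span ?T" using C(2) by blast
  have indT: "\<not> poly_vs.dependent ?T" by (rule monomials_independent[OF finite_graded_basis])
  have "card C = poly_vs.dim C" using poly_vs.dim_eq_card_independent[OF C(3)] by simp
  moreover have "poly_vs.dim C = poly_vs.dim ?T"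
  proof -
    have "poly_vs.span C = poly_vs.span ?T"
      using CT C(4) by (intro antisym poly_vs.span_minimal) auto
    then show ?thesis by (metis poly_vs.dim_span)
  qed
  moreover have "poly_vs.dim ?T = card ?T" by (rule poly_vs.dim_eq_card_independent[OF indT])
  moreover have "card ?T = card (graded_basis j)" by (rule card_image[OF inj_monomials])
  ultimately have cardC: "card C = card (graded_basis j)" by simp
  define B where "B = {m \<in> graded_basis j. single m 1 \<in> C - v ` ?A}"
  have CB: "C - v ` ?A = monomials B" using C(2) by (auto simp: B_def)
  have "card B = card (C - v ` ?A)" unfolding CB by (rule card_image[OF inj_monomials, symmetric])
  also have "\<dots> = card C - card ?A"
    using C(1) finC card_image[OF injv] by (simp add: card_Diff_subset finite_subset)
  finally have "card B + card ?A = card (graded_basis j)"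
    using card_mono[OF finC C(1)] card_image[OF injv] cardC by simp
  moreover have "spans \<eta> i B f" if f: "f \<in> homogeneous E j" for f
  proof -
    have finB: "finite B" using finite_graded_basis by (simp add: B_def)
    obtain b where b: "f - (\<Sum>m\<in>graded_basis j. single m (b m)) \<in> J"
      using normal_form[OF f] by blast
    let ?g = "\<Sum>m\<in>graded_basis j. single m (b m)"
    have "?g \<in> poly_vs.span ?T" unfolding span_monomials[OF finite_graded_basis] by blast
    moreover have "poly_vs.span ?T \<subseteq> poly_vs.span C" using C(4) by (intro poly_vs.span_minimal) auto
    ultimately have "?g \<in> poly_vs.span C" by blast
    then obtain u where u: "?g = (\<Sum>x\<in>C. const (u x) * x)"
      unfolding poly_vs.span_finite[OF finC] by blast
    also have "\<dots> = (\<Sum>x\<in>C - v ` ?A. const (u x) * x) + (\<Sum>x\<in>v ` ?A. const (u x) * x)"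
      by (rule sum.subset_diff[OF C(1) finC])
    also have "\<dots> = (\<Sum>m\<in>B. single m (u (single m 1))) + (\<Sum>m\<in>?A. const (u (v m)) * v m)"
      unfolding CB by (simp add: sum.reindex[OF inj_monomials] sum.reindex[OF injv] const_single)
    finally have g: "?g = (\<Sum>m\<in>B. single m (u (single m 1))) + (\<Sum>m\<in>?A. const (u (v m)) * v m)" .
    let ?c = "\<lambda>m. u (v m)"
    have "f - ?g - ((\<Sum>m\<in>?A. const (?c m) * (\<eta> * single m 1)) - (\<Sum>m\<in>?A. const (?c m) * v m)) \<in> J"
      by (rule ideal_diff[OF b combination_normal_form[where i = i, OF v(2)]])
    then show ?thesis unfolding spans_def g
      by (intro exI[of _ ?c] exI[of _ "\<lambda>m. u (single m 1)"]) (simp add: algebra_simps)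
  qed
  moreover have "B \<subseteq> graded_basis j" by (auto simp: B_def)
  ultimately show ?thesis by blast
qed

text \<open>The images together with \<open>B\<close> span degree \<open>j\<close> and are no more
  numerous than its dimension, so they are independent; in particular the images are.\<close>

lemma spans_imp_injective:
  assumes \<eta>: "\<eta> \<in> homogeneous E k" and j: "j = k + i"
    and B: "B \<subseteq> graded_basis j" "card B + card (graded_basis i) = card (graded_basis j)"
    and sp: "\<And>m. m \<in> graded_basis j \<Longrightarrow> spans \<eta> i B (single m 1)"
    and f: "f \<in> homogeneous E i" "\<eta> * f \<in> J"
  shows "f \<in> J"
proof -
  let ?A = "graded_basis i" and ?T = "monomials (graded_basis j)"
  obtain v where v: "\<And>m. m \<in> ?A \<Longrightarrow> v m \<in> poly_vs.span ?T"
    "\<And>m. m \<in> ?A \<Longrightarrow> \<eta> * single m 1 - v m \<in> J"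
    using normal_form_family[OF \<eta> j] by blast
  let ?C = "v ` ?A \<union> monomials B"
  have finB: "finite B" using B(1) finite_graded_basis finite_subset by blast
  have finC: "finite ?C" using finB finite_graded_basis by simp
  have CT: "?C \<subseteq> poly_vs.span ?T" using v(1) B(1) poly_vs.span_superset[of ?T] by blast
  have TC: "?T \<subseteq> poly_vs.span ?C"
  proof
    fix x assume "x \<in> ?T"
    then obtain n where n: "n \<in> graded_basis j" "x = single n 1" by blast
    then obtain c d where cd: "x - (\<Sum>m\<in>?A. const (c m) * (\<eta> * single m 1)) - (\<Sum>m\<in>B. single m (d m)) \<in> J"
      using sp unfolding spans_def by blast
    let ?y = "(\<Sum>m\<in>?A. const (c m) * v m) + (\<Sum>m\<in>B. single m (d m))"
    have d: "single m (d m) = const (d m) * single m 1" for m by (simp add: const_single)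
    have yC: "?y \<in> poly_vs.span ?C"
      unfolding d
      by (intro poly_vs.span_add poly_vs.span_sum poly_vs.span_scale poly_vs.span_base) auto
    also have "poly_vs.span ?C \<subseteq> poly_vs.span ?T"
      using CT by (intro poly_vs.span_minimal) auto
    finally have "?y \<in> poly_vs.span ?T" .
    then have "x - ?y \<in> poly_vs.span ?T"
      by (rule poly_vs.span_diff[OF poly_vs.span_base[OF \<open>x \<in> ?T\<close>]])
    moreover have "x - ?y \<in> J"
      using ideal_add[OF cd combination_normal_form[where c = c and i = i, OF v(2)]] by (simp add: algebra_simps)
    ultimately have "x - ?y = 0" by (rule span_ideal_zero)
    then show "x \<in> poly_vs.span ?C" using yC by simp
  qed
  have indT: "\<not> poly_vs.dependent ?T" by (rule monomials_independent[OF finite_graded_basis])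
  have dimT: "poly_vs.dim ?T = card (graded_basis j)"
    using poly_vs.dim_eq_card_independent[OF indT] card_image[OF inj_monomials] by simp
  have "poly_vs.dim ?T \<le> card ?C" using TC finC by (rule poly_vs.dim_le_card)
  moreover have "card ?C \<le> card (v ` ?A) + card (monomials B)" by (rule card_Un_le)
  moreover have "card (v ` ?A) \<le> card ?A" by (rule card_image_le[OF finite_graded_basis])
  moreover have "card (monomials B) = card B" by (rule card_image[OF inj_monomials])
  \<comment> \<open>A spanning set with at most \<open>dim\<close> members has exactly that many, so
    no image coincides with another or with a monomial of \<open>B\<close>.\<close>
  ultimately have card: "card (v ` ?A) = card ?A" "card ?C = poly_vs.dim ?T"
    using B(2) dimT by linarith+
  have injv: "inj_on v ?A" using card(1) finite_graded_basis by (simp add: eq_card_imp_inj_on)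
  have "\<not> poly_vs.dependent ?C"
  proof
    assume "poly_vs.dependent ?C"
    then obtain a where a: "a \<in> ?C" "a \<in> poly_vs.span (?C - {a})"
      unfolding poly_vs.dependent_def by blast
    have "?C \<subseteq> poly_vs.span (?C - {a})"
      using a(2) poly_vs.span_superset[of "?C - {a}"] by blast
    then have "poly_vs.span ?C \<subseteq> poly_vs.span (?C - {a})"
      by (intro poly_vs.span_minimal) auto
    then have "?T \<subseteq> poly_vs.span (?C - {a})" using TC by blast
    moreover have "finite (?C - {a})" using finC by simp
    ultimately have "poly_vs.dim ?T \<le> card (?C - {a})" by (rule poly_vs.dim_le_card)
    also have "\<dots> < card ?C" using finC a(1) by (rule card_Diff1_less)
    finally show False using card(2) by simp
  qed
  then have indv: "\<not> poly_vs.dependent (v ` ?A)" using poly_vs.independent_mono by blast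
  obtain c where c: "f - (\<Sum>m\<in>?A. single m (c m)) \<in> J" using normal_form[OF f(1)] by blast
  let ?y = "\<Sum>m\<in>?A. const (c m) * v m"
  have "\<eta> * (\<Sum>m\<in>?A. single m (c m)) \<in> J"
    using ideal_diff[OF f(2) ideal_mult[OF c, of \<eta>]] by (simp add: algebra_simps)
  from ideal_diff[OF this combination_normal_form[where c = c and i = i, OF v(2), unfolded combination_eq]]
  have "?y \<in> J" by simp
  moreover have "?y \<in> poly_vs.span ?T"
    using v(1) by (intro poly_vs.span_sum poly_vs.span_scale)
  ultimately have "?y = 0" using span_ideal_zero by blast
  moreover have "?y = (\<Sum>x\<in>v ` ?A. const (c (the_inv_into ?A v x)) * x)"
    using injv by (simp add: sum.reindex the_inv_into_f_f)
  ultimately have "(\<Sum>x\<in>v ` ?A. const (c (the_inv_into ?A v x)) * x) = 0" by simp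
  then have "c (the_inv_into ?A v x) = 0" if "x \<in> v ` ?A" for x
    using indv that finite_graded_basis
    unfolding poly_vs.independent_explicit_finite_subsets by (meson finite_imageI order_refl)
  then have "c m = 0" if "m \<in> ?A" for m using injv that by (metis imageI the_inv_into_f_f)
  then show ?thesis using c by simp
qed

end

section \<open>Zariski openness\<close>

text \<open>Working with functions avoids writing out the polynomials, such as determinants, that
  define open sets.\<close>

definition polynomial_fun :: "'j set \<Rightarrow> (('j \<Rightarrow> 'k::field) \<Rightarrow> 'k) \<Rightarrow> bool" where
  "polynomial_fun J \<phi> \<longleftrightarrow> (\<exists>F\<in>polys_in J. \<forall>p. \<phi> p = poly_eval p F)"

lemma poly_eval_const [simp]: "poly_eval p (const c) = c"
  by (simp add: const_def poly_eval_single)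

lemma poly_eval_var [simp]: "poly_eval p (var v) = p v"
  by (simp add: var_def poly_eval_single)

lemma polynomial_fun_const: "polynomial_fun J (\<lambda>_. c)"
  unfolding polynomial_fun_def by (rule bexI[of _ "const c"]) (simp_all add: const_in)

lemma polynomial_fun_coord: "v \<in> J \<Longrightarrow> polynomial_fun J (\<lambda>p. p v)"
  unfolding polynomial_fun_def by (rule bexI[of _ "var v"]) (simp_all add: var_in)

lemma polynomial_fun_add:
  "polynomial_fun J \<phi> \<Longrightarrow> polynomial_fun J \<psi> \<Longrightarrow> polynomial_fun J (\<lambda>p. \<phi> p + \<psi> p)"
  unfolding polynomial_fun_def by (metis poly_eval_add polys_in_add)

lemma polynomial_fun_mult:
  "polynomial_fun J \<phi> \<Longrightarrow> polynomial_fun J \<psi> \<Longrightarrow> polynomial_fun J (\<lambda>p. \<phi> p * \<psi> p)"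
  unfolding polynomial_fun_def by (metis poly_eval_mult polys_in_mult)

lemma polynomial_fun_sum:
  "(\<And>x. x \<in> A \<Longrightarrow> polynomial_fun J (\<phi> x)) \<Longrightarrow> polynomial_fun J (\<lambda>p. \<Sum>x\<in>A. \<phi> x p)"
  by (induction A rule: infinite_finite_induct)
    (auto intro: polynomial_fun_add polynomial_fun_const)

lemma polynomial_fun_prod:
  "(\<And>x. x \<in> A \<Longrightarrow> polynomial_fun J (\<phi> x)) \<Longrightarrow> polynomial_fun J (\<lambda>p. \<Prod>x\<in>A. \<phi> x p)"
  by (induction A rule: infinite_finite_induct)
    (auto intro: polynomial_fun_mult polynomial_fun_const)

lemma polynomial_fun_det:
  assumes "\<And>i j. i < n \<Longrightarrow> j < n \<Longrightarrow> polynomial_fun J (W i j)"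
  shows "polynomial_fun J (\<lambda>p. Determinant.det (Matrix.mat n n (\<lambda>(i, j). W i j p)))"
proof -
  have "Determinant.det (Matrix.mat n n (\<lambda>(i, j). W i j p)) =
      (\<Sum>\<pi> | \<pi> permutes {0..<n}. signof \<pi> * (\<Prod>i = 0..<n. W i (\<pi> i) p))" for p
  proof -
    have "(\<Prod>i = 0..<n. Matrix.mat n n (\<lambda>(i, j). W i j p) $$ (i, \<pi> i)) = (\<Prod>i = 0..<n. W i (\<pi> i) p)"
      if "\<pi> permutes {0..<n}" for \<pi>
      using permutes_in_image[OF that] by (intro prod.cong) auto
    then show ?thesis by (subst det_def') (auto intro!: sum.cong)
  qed
  moreover have "polynomial_fun J (\<lambda>p. \<Sum>\<pi> | \<pi> permutes {0..<n}. signof \<pi> * (\<Prod>i = 0..<n. W i (\<pi> i) p))"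
    using permutes_in_image
    by (intro polynomial_fun_sum polynomial_fun_mult polynomial_fun_const polynomial_fun_prod assms)
      fastforce+
  ultimately show ?thesis by simp
qed

text \<open>A principal open neighbourhood inside \<open>U\<close> around each point is enough; the
  complement is cut out by all polynomials whose non-vanishing forces membership in
  \<open>U\<close>.\<close>

lemma zariski_openI:
  assumes sub: "U \<subseteq> affine_space J"
    and loc: "\<And>p0. p0 \<in> U \<Longrightarrow> \<exists>\<phi>. polynomial_fun J \<phi> \<and> \<phi> p0 \<noteq> 0 \<and>
      (\<forall>p\<in>affine_space J. \<phi> p \<noteq> 0 \<longrightarrow> p \<in> U)"
  shows "zariski_open J (U :: ('j \<Rightarrow> 'k::field) set)"
proof -
  let ?S = "{F \<in> polys_in J. \<forall>p\<in>affine_space J. poly_eval p F \<noteq> 0 \<longrightarrow> p \<in> U}"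
  have "p \<in> affine_space J - zero_locus J ?S" if p: "p \<in> U" for p
  proof -
    obtain \<phi> where \<phi>: "polynomial_fun J \<phi>" "\<phi> p \<noteq> 0" "\<forall>p\<in>affine_space J. \<phi> p \<noteq> 0 \<longrightarrow> p \<in> U"
      using loc[OF p] by blast
    then obtain F where "F \<in> polys_in J" "\<forall>p. \<phi> p = poly_eval p F"
      by (auto simp: polynomial_fun_def)
    then show ?thesis using \<phi> p sub by (auto simp: zero_locus_def)
  qed
  then have "U = affine_space J - zero_locus J ?S" by (auto simp: zero_locus_def)
  then show ?thesis unfolding zariski_open_def by (intro exI[of _ ?S]) auto
qed

text \<open>Both sets are non-empty open, hence cofinite, on the line through a point of each.\<close>

lemma zariski_open_Int_nonempty:
  fixes U W :: "('j \<Rightarrow> 'k::field_char_0) set"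
  assumes "zariski_open J U" "zariski_open J W" "U \<noteq> {}" "W \<noteq> {}"
  shows "U \<inter> W \<noteq> {}"
proof -
  obtain S where S: "S \<subseteq> polys_in J" "U = affine_space J - zero_locus J S"
    using assms(1) unfolding zariski_open_def by (elim exE conjE)
  obtain T where T: "T \<subseteq> polys_in J" "W = affine_space J - zero_locus J T"
    using assms(2) unfolding zariski_open_def by (elim exE conjE)
  obtain p where p: "p \<in> U" using assms by blast
  obtain q where q: "q \<in> W" using assms by blast
  obtain F where F: "F \<in> S" "poly_eval p F \<noteq> 0" using p S(2) by (auto simp: zero_locus_def)
  obtain G where G: "G \<in> T" "poly_eval q G \<noteq> 0" using q T(2) by (auto simp: zero_locus_def)
  define line where "line s v = p v + s * (q v - p v)" for s v
  \<comment> \<open>The univariate polynomial that \<open>H\<close> becomes along the line through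
    \<open>p\<close> and \<open>q\<close>.\<close>
  define restrict where "restrict H = (\<Sum>m\<in>keys H. [:lookup H m:] *
    (\<Prod>v\<in>keys m. [:p v, q v - p v:] ^ lookup m v))" for H :: "('j, 'k) mpoly"
  have poly_restrict: "poly (restrict H) s = poly_eval (line s) H" for H s
    by (simp add: restrict_def poly_eval_def line_def poly_sum poly_prod poly_power)
  have "line 0 = p" "line 1 = q" by (auto simp: line_def)
  then have "restrict F \<noteq> 0" "restrict G \<noteq> 0"
    using F(2) G(2) poly_restrict by (metis poly_0)+
  then have "restrict F * restrict G \<noteq> 0" by simp
  then have "finite {s. poly (restrict F * restrict G) s = 0}" by (rule poly_roots_finite)
  then obtain s where "poly (restrict F * restrict G) s \<noteq> 0"
    using ex_new_if_finite[OF infinite_UNIV_char_0] by blast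
  then have s: "poly_eval (line s) F \<noteq> 0" "poly_eval (line s) G \<noteq> 0"
    by (simp_all add: poly_restrict)
  have "p \<in> affine_space J" "q \<in> affine_space J" using p q S(2) T(2) by auto
  \<comment> \<open>Off \<open>J\<close> both points are \<open>undefined\<close>; their difference
    vanishes there, so the whole line stays normalised.\<close>
  then have "line s \<in> affine_space J"
    by (auto simp: affine_space_def PiE_def extensional_def line_def)
  then have "line s \<in> U \<inter> W" using s F(1) G(1) S(2) T(2) by (auto simp: zero_locus_def)
  then show ?thesis by blast
qed

section \<open>Spanning conditions at varying points\<close>

lemma finite_monomials:
  assumes "finite E"
  shows "finite {n. keys n \<subseteq> E \<and> total_degree_monom n = j}"
proof (induction j)
  case 0
  have "{n. keys n \<subseteq> E \<and> total_degree_monom n = 0} \<subseteq> {0}"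
  proof clarify
    fix n :: "'a \<Rightarrow>\<^sub>0 nat" assume "total_degree_monom n = 0"
    then show "n = 0"
      by (intro poly_mapping_eqI) (auto simp: total_degree_monom_def in_keys_iff)
  qed
  then show ?case using finite_subset by blast
next
  case (Suc j)
  let ?N = "{n. keys n \<subseteq> E \<and> total_degree_monom n = j}"
  have "{n. keys n \<subseteq> E \<and> total_degree_monom n = Suc j} \<subseteq> (\<Union>e\<in>E. (+) (single e 1) ` ?N)"
  proof clarify
    fix n :: "'a \<Rightarrow>\<^sub>0 nat" assume n: "keys n \<subseteq> E" "total_degree_monom n = Suc j"
    then obtain e where e: "e \<in> keys n" by (metis all_not_in_conv keys_eq_empty nat.distinct(1) total_degree_zero)
    note d = diff_single_add[OF e]
    have "keys (n - single e 1) \<subseteq> E" "total_degree_monom (n - single e 1) = j"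
      using n d keys_add_nat[of "single e 1" "n - single e 1"]
        total_degree_add[of "single e 1" "n - single e 1"] by auto
    then have "n \<in> (+) (single e 1) ` ?N" using d by (intro image_eqI[of _ _ "n - single e 1"]) auto
    then show "n \<in> (\<Union>e\<in>E. (+) (single e 1) ` ?N)" using e n(1) by blast
  qed
  then show ?case using Suc assms by (meson finite_UN_I finite_imageI finite_subset)
qed

definition point_ideal :: "'a set \<Rightarrow> 'a set set \<Rightarrow> nat \<Rightarrow> ('a \<times> nat \<Rightarrow> 'k::field) \<Rightarrow> ('a, 'k) mpoly set" where
  "point_ideal E D r p = rel_ideal D r (\<lambda>l. one_form E (\<lambda>e. p (e, l)))"

definition point_form :: "'a set \<Rightarrow> nat \<Rightarrow> ('a \<times> nat \<Rightarrow> 'k::field) \<Rightarrow> ('a, 'k) mpoly" where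
  "point_form E r p = one_form E (\<lambda>e. p (e, r))"

lemma polynomial_fun_one_form_mult:
  assumes "l \<le> r" "\<And>n. polynomial_fun (E \<times> {..r}) (\<lambda>p. lookup (f p) n)"
  shows "polynomial_fun (E \<times> {..r}) (\<lambda>p. lookup (one_form E (\<lambda>e. p (e, l)) * f p) n)"
  unfolding lookup_one_form_mult
proof (intro polynomial_fun_sum polynomial_fun_mult polynomial_fun_coord)
  fix e
  show "polynomial_fun (E \<times> {..r}) (\<lambda>p. if e \<in> keys n then lookup (f p) (n - single e 1) else 0)"
    using assms(2) by (cases "e \<in> keys n") (simp_all add: polynomial_fun_const)
qed (use assms in auto)

lemma polynomial_fun_point_form_power:
  "polynomial_fun (E \<times> {..r}) (\<lambda>p. lookup (point_form E r p ^ k * f) n)"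
proof (induction k arbitrary: n)
  case (Suc k)
  have "polynomial_fun (E \<times> {..r})
      (\<lambda>p. lookup (point_form E r p * (point_form E r p ^ k * f)) n)"
    using polynomial_fun_one_form_mult[OF order_refl Suc.IH] by (simp add: point_form_def)
  then show ?case by (simp add: mult.assoc)
qed (simp add: polynomial_fun_const)

lemma combine_combinations:
  "(\<Sum>b<s. const (\<mu> b) * (\<Sum>m\<in>A. const (c b m) * x m)) =
    (\<Sum>m\<in>A. const (\<Sum>b<s. \<mu> b * c b m) * x m)"
  for s :: nat
proof -
  have "(\<Sum>b<s. const (\<mu> b) * (\<Sum>m\<in>A. const (c b m) * x m)) =
      (\<Sum>b<s. \<Sum>m\<in>A. const (\<mu> b * c b m) * x m)"
    unfolding sum_distrib_left const_mult mult.assoc ..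
  also have "\<dots> = (\<Sum>m\<in>A. \<Sum>b<s. const (\<mu> b * c b m) * x m)" by (rule sum.swap)
  finally show ?thesis unfolding const_sum sum_distrib_right .
qed

text \<open>At \<open>p0\<close> each face monomial of degree \<open>j\<close> has an expression
  with some coefficients and cofactors. Freezing these and moving the point gives
  \<open>V a p\<close>, whose coefficients at the face monomials form a matrix that is the identity
  at \<open>p0\<close>. Where its determinant is nonzero the expressions can be recombined to give
  every face monomial again.\<close>

lemma spanning_open:
  fixes p0 :: "'a \<times> nat \<Rightarrow> 'k::field" and r :: nat
  assumes E: "finite E" and D: "D \<subseteq> Pow E"
    and A: "\<And>m. m \<in> A \<Longrightarrow> keys m \<subseteq> E \<and> total_degree_monom m + k = j"
    and B: "\<And>m. m \<in> B \<Longrightarrow> keys m \<subseteq> E \<and> total_degree_monom m = j"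
  defines "sp \<equiv> \<lambda>(p :: 'a \<times> nat \<Rightarrow> 'k) f. \<exists>c d. f -
      (\<Sum>m\<in>A. const (c m) * (point_form E r p ^ k * single m 1)) -
      (\<Sum>m\<in>B. single m (d m)) \<in> point_ideal E D r p"
  assumes p0: "\<And>n. keys n \<in> D \<Longrightarrow> total_degree_monom n = j \<Longrightarrow> sp p0 (single n 1)"
  shows "\<exists>\<phi>. polynomial_fun (E \<times> {..r}) \<phi> \<and> \<phi> p0 \<noteq> 0 \<and>
    (\<forall>p. \<phi> p \<noteq> 0 \<longrightarrow> (\<forall>n. keys n \<in> D \<longrightarrow> total_degree_monom n = j \<longrightarrow> sp p (single n 1)))"
proof -
  let ?J = "E \<times> {..r}"
  let ?N = "{n. keys n \<in> D \<and> total_degree_monom n = j}"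
  define T where "T p l = one_form E (\<lambda>e. p (e, l))" for p :: "'a \<times> nat \<Rightarrow> 'k" and l
  have "finite ?N" using D by (intro finite_subset[OF _ finite_monomials[OF E, of j]]) auto
  then obtain \<nu> where \<nu>: "bij_betw \<nu> {..<card ?N} ?N"
    using ex_bij_betw_nat_finite[of ?N] unfolding atLeast0LessThan by blast
  let ?s = "card ?N"
  define Q where "Q n c d g \<longleftrightarrow> single n 1 -
      (\<Sum>m\<in>A. const (c m) * (point_form E r p0 ^ k * single m 1)) -
      (\<Sum>m\<in>B. single m (d m)) - (\<Sum>l<r. T p0 l * g l) \<in> nonface_ideal D" for n c d g
  have "\<exists>c d g. Q n c d g" if n: "n \<in> ?N" for n
  proof -
    have "sp p0 (single n 1)" using p0 n by simp
    then obtain c d where "single n 1 -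
        (\<Sum>m\<in>A. const (c m) * (point_form E r p0 ^ k * single m 1)) -
        (\<Sum>m\<in>B. single m (d m)) \<in> point_ideal E D r p0"
      unfolding sp_def by (elim exE)
    then obtain g where "Q n c d g"
      unfolding point_ideal_def Q_def T_def by (rule rel_idealE)
    then show ?thesis by (intro exI)
  qed
  then obtain c d g where cdg: "\<And>n. n \<in> ?N \<Longrightarrow> Q n (c n) (d n) (g n)" by metis
  define V where "V a p = (\<Sum>m\<in>A. const (c (\<nu> a) m) * (point_form E r p ^ k * single m 1)) +
      (\<Sum>m\<in>B. single m (d (\<nu> a) m)) + (\<Sum>l<r. T p l * g (\<nu> a) l)" for a p
  define \<phi> where "\<phi> p = Determinant.det (Matrix.mat ?s ?s (\<lambda>(a, b). lookup (V a p) (\<nu> b)))" for p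
  have \<nu>N: "\<nu> a \<in> ?N" if "a < ?s" for a using \<nu> that by (auto simp: bij_betw_def)
  have \<nu>inj: "\<nu> a = \<nu> b \<longleftrightarrow> a = b" if "a < ?s" "b < ?s" for a b
    using inj_on_eq_iff[OF bij_betw_imp_inj_on[OF \<nu>]] that by simp
  have "polynomial_fun ?J (\<lambda>p. lookup (V a p) n)" for a n
    unfolding V_def T_def lookup_add lookup_sum lookup_const_mult
    by (intro polynomial_fun_add polynomial_fun_sum polynomial_fun_mult polynomial_fun_const
        polynomial_fun_point_form_power polynomial_fun_one_form_mult) auto
  then have "polynomial_fun ?J \<phi>" unfolding \<phi>_def by (intro polynomial_fun_det)
  moreover have "\<phi> p0 \<noteq> 0"
  proof -
    have "lookup (V a p0) (\<nu> b) = (if a = b then 1 else 0)" if "a < ?s" "b < ?s" for a b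
    proof -
      have "single (\<nu> a) 1 - V a p0 \<in> nonface_ideal D"
        using cdg[OF \<nu>N[OF that(1)]] by (simp add: Q_def V_def diff_diff_eq)
      then have "lookup (single (\<nu> a) 1 - V a p0) (\<nu> b) = 0"
        using \<nu>N[OF that(2)] by (simp add: nonface_ideal_iff)
      then show ?thesis using \<nu>inj[OF that] by (simp add: lookup_minus lookup_single when_def)
    qed
    then have "Matrix.mat ?s ?s (\<lambda>(a, b). lookup (V a p0) (\<nu> b)) = 1\<^sub>m ?s"
      by (intro eq_matI) auto
    then show ?thesis by (simp add: \<phi>_def)
  qed
  moreover have "sp p (single n 1)" if \<phi>p: "\<phi> p \<noteq> 0" and n: "keys n \<in> D" "total_degree_monom n = j" for p n
  proof -
    obtain a where a: "a < ?s" "n = \<nu> a" using \<nu> n by (auto simp: bij_betw_def)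
    obtain M where M: "\<And>i j. i < ?s \<Longrightarrow> j < ?s \<Longrightarrow>
        (\<Sum>b<?s. M i b * lookup (V b p) (\<nu> j)) = (if i = j then \<phi> p else 0)"
      by (rule adjugate_entries[where W = "\<lambda>a b. lookup (V a p) (\<nu> b)" and n = ?s, folded \<phi>_def],
          rule that)
    \<comment> \<open>Row \<open>a\<close> of the inverse matrix: the combination whose coefficient
      is one at \<open>n\<close> and zero at the other face monomials of degree
      \<open>j\<close>.\<close>
    define \<mu> where "\<mu> b = M a b / \<phi> p" for b
    let ?H = "\<Sum>b<?s. const (\<mu> b) * V b p"
    have H: "lookup ?H (\<nu> b) = (if a = b then 1 else 0)" if "b < ?s" for b
    proof -
      have "lookup ?H (\<nu> b) = (\<Sum>k<?s. M a k * lookup (V k p) (\<nu> b)) / \<phi> p"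
        by (simp add: lookup_sum lookup_const_mult \<mu>_def sum_divide_distrib)
      then show ?thesis using M[OF a(1) that] \<phi>p by simp
    qed
    \<comment> \<open>The cofactors need not be homogeneous, so \<open>?H\<close> may have terms of
      other degrees; only its component of degree \<open>j\<close> matches the monomial.\<close>
    have HI: "single n 1 - hpart E j ?H \<in> nonface_ideal D"
      unfolding nonface_ideal_iff
    proof (intro allI impI)
      fix n' :: "'a \<Rightarrow>\<^sub>0 nat" assume n': "keys n' \<in> D"
      show "lookup (single n 1 - hpart E j ?H) n' = 0"
      proof (cases "total_degree_monom n' = j")
        case True
        then obtain b where b: "b < ?s" "n' = \<nu> b" using \<nu> n' by (auto simp: bij_betw_def)
        have "keys n' \<subseteq> E" using n' D by blast
        then show ?thesis
          using H[OF b(1)] True b a \<nu>inj[OF a(1) b(1)]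
          by (simp add: lookup_minus lookup_hpart lookup_single when_def)
      next
        case False
        then show ?thesis using n
          by (auto simp: lookup_minus lookup_hpart lookup_single when_def)
      qed
    qed
    define c' where "c' m = (\<Sum>b<?s. \<mu> b * c (\<nu> b) m)" for m
    define d' where "d' m = (\<Sum>b<?s. \<mu> b * d (\<nu> b) m)" for m
    define g' where "g' l = (\<Sum>b<?s. const (\<mu> b) * g (\<nu> b) l)" for l
    let ?A = "\<Sum>m\<in>A. const (c' m) * (point_form E r p ^ k * single m 1)"
    let ?B = "\<Sum>m\<in>B. single m (d' m)"
    have HA: "(\<Sum>b<?s. const (\<mu> b) * (\<Sum>m\<in>A. const (c (\<nu> b) m) * (point_form E r p ^ k * single m 1))) = ?A"
      unfolding c'_def by (rule combine_combinations)
    have HB: "(\<Sum>b<?s. const (\<mu> b) * (\<Sum>m\<in>B. single m (d (\<nu> b) m))) = ?B"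
      using combine_combinations[of \<mu> "\<lambda>b m. d (\<nu> b) m" "\<lambda>m. single m 1" B ?s]
      unfolding d'_def const_single mult_1_right .
    have HT: "(\<Sum>b<?s. const (\<mu> b) * (\<Sum>l<r. T p l * g (\<nu> b) l)) = (\<Sum>l<r. T p l * g' l)"
      unfolding g'_def sum_distrib_left by (subst sum.swap) (simp only: mult.left_commute)
    have "?H = ?A + ?B + (\<Sum>l<r. T p l * g' l)"
      unfolding V_def distrib_left sum.distrib HA HB HT ..
    moreover have "hpart E j ?A = ?A"
    proof (intro hpart_id homogeneous_sum homogeneous_const_mult)
      fix m assume m: "m \<in> A"
      have "point_form E r p ^ k * single m 1 \<in> homogeneous E (k + total_degree_monom m)"
        unfolding point_form_def
        using A[OF m] by (intro homogeneous_mult homogeneous_power one_form_homogeneous homogeneous_single) auto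
      then show "point_form E r p ^ k * single m 1 \<in> homogeneous E j"
        using A[OF m] by (simp add: add.commute)
    qed
    moreover have "hpart E j ?B = ?B"
      using B by (intro hpart_id homogeneous_sum homogeneous_single) auto
    ultimately have h: "hpart E j ?H = ?A + ?B + hpart E j (\<Sum>l<r. T p l * g' l)"
      by (simp add: hpart_add)
    have "hpart E j (\<Sum>l<r. T p l * g' l) \<in> point_ideal E D r p"
      unfolding point_ideal_def T_def
      by (intro rel_ideal_hpart) (auto intro: rel_idealI[where g = g'])
    moreover have "single n 1 - hpart E j ?H \<in> point_ideal E D r p"
      unfolding point_ideal_def by (rule nonface_rel_ideal[OF HI])
    moreover have "single n 1 - ?A - ?B =
        (single n 1 - hpart E j ?H) + hpart E j (\<Sum>l<r. T p l * g' l)"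
      unfolding h by simp
    ultimately have "single n 1 - ?A - ?B \<in> point_ideal E D r p"
      unfolding point_ideal_def by (simp only: rel_ideal_add)
    then show ?thesis unfolding sp_def by blast
  qed
  ultimately show ?thesis by blast
qed

section \<open>Detecting parameters by evaluation\<close>

lemma poly_eval_diff: "poly_eval p (f - g) = poly_eval p f - poly_eval p (g :: ('v, 'k::field) mpoly)"
  using poly_eval_add[of p "f - g" g] by (simp add: algebra_simps)

lemma poly_eval_sum: "poly_eval p (\<Sum>x\<in>A. f x) = (\<Sum>x\<in>A. poly_eval p (f x))"
  by (induction A rule: infinite_finite_induct) (simp_all add: poly_eval_add)

text \<open>Each monomial of the face ideal has a variable outside \<open>F\<close>, which vanishes
  at \<open>q\<close>.\<close>

lemma poly_eval_nonface_ideal: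
  assumes f: "f \<in> nonface_ideal D" and D: "down_closed D" and F: "F \<in> D"
    and q: "\<And>v. v \<notin> F \<Longrightarrow> q v = 0"
  shows "poly_eval q f = 0"
  unfolding poly_eval_def
proof (intro sum.neutral ballI)
  fix m assume "m \<in> keys f"
  then have "\<not> keys m \<subseteq> F" using f D F by (auto simp: nonface_ideal_def down_closed_def)
  then obtain v where v: "v \<in> keys m" "v \<notin> F" by blast
  then have "q v ^ lookup m v = 0" using q by (simp add: in_keys_iff)
  then have "(\<Prod>v\<in>keys m. q v ^ lookup m v) = 0" using v(1) by (intro prod_zero) auto
  then show "lookup f m * (\<Prod>v\<in>keys m. q v ^ lookup m v) = 0" by simp
qed

text \<open>A linear dependence among the columns of a face is a common zero of the parameters and
  the face ideal. The powers of the vertex variables vanish there, which forces its coordinates to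
  be zero.\<close>

lemma lsop_if_powers_in_ideal:
  fixes \<theta> :: "nat \<Rightarrow> 'a \<Rightarrow> 'k::field"
  assumes E: "finite E" and D: "D \<subseteq> Pow E" "down_closed D"
    and pw: "\<And>e. {e} \<in> D \<Longrightarrow> single (single e (Suc j)) 1 \<in> rel_ideal D r (\<lambda>l. one_form E (\<theta> l))"
  shows "is_lsop D r \<theta>"
  unfolding is_lsop_def
proof (intro ballI allI impI)
  fix F c e assume F: "F \<in> D" and c: "\<forall>i<r. (\<Sum>e\<in>F. c e * \<theta> i e) = 0" and e: "e \<in> F"
  define q where "q v = (if v \<in> F then c v else 0)" for v
  have FE: "F \<subseteq> E" using F D(1) by blast
  note finF = finite_subset[OF FE E] FE
  have T: "poly_eval q (one_form E (\<theta> i)) = 0" if "i < r" for i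
  proof -
    have "poly_eval q (one_form E (\<theta> i)) = (\<Sum>v\<in>E. \<theta> i v * q v)"
      by (simp add: one_form_def poly_eval_sum poly_eval_mult)
    also have "\<dots> = (\<Sum>v\<in>F. \<theta> i v * q v)"
      using finF E by (intro sum.mono_neutral_right) (auto simp: q_def)
    finally show ?thesis using c that by (simp add: q_def mult.commute)
  qed
  have "{e} \<in> D" using D(2) F e by (auto simp: down_closed_def)
  then obtain g where "single (single e (Suc j)) 1 - (\<Sum>l<r. one_form E (\<theta> l) * g l) \<in> nonface_ideal D"
    using pw rel_idealE by blast
  then have "poly_eval q (single (single e (Suc j)) 1 - (\<Sum>l<r. one_form E (\<theta> l) * g l)) = 0"
    by (rule poly_eval_nonface_ideal[OF _ D(2) F]) (simp add: q_def)
  then have "poly_eval q (single (single e (Suc j)) 1) = 0"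
    using T by (simp add: poly_eval_diff poly_eval_sum poly_eval_mult)
  then show "c e = 0" using e by (auto simp: poly_eval_single q_def)
qed

text \<open>The bound \<open>t\<close> is separate from \<open>r\<close>: with cone points the
  reduction ends below degree \<open>r\<close>, and the induction lowers \<open>t\<close> on
  stars.\<close>

definition good_points :: "'a set \<Rightarrow> 'a set set \<Rightarrow> nat \<Rightarrow> nat \<Rightarrow> ('a \<times> nat \<Rightarrow> 'k::field) set" where
  "good_points E D r t = {p \<in> affine_space (E \<times> {..r}). is_lsop D r (\<lambda>i e. p (e, i)) \<and>
     lefschetz E (point_ideal E D r p) (point_form E r p) t}"

context matroid_complex
begin

lemma graded_quotient_point:
  assumes "monomial_basis (point_ideal E D r p) \<B>" "\<And>m. m \<in> \<B> \<Longrightarrow> keys m \<in> D"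
  shows "graded_quotient E (point_ideal E D r p) \<B>"
proof
  show "hpart E j f \<in> point_ideal E D r p" if "f \<in> point_ideal E D r p" for f j
    using that unfolding point_ideal_def by (intro rel_ideal_hpart) auto
  show "h * f \<in> point_ideal E D r p" if "f \<in> point_ideal E D r p" for f h
    using that unfolding point_ideal_def by (intro rel_ideal_mult down_closed_faces)
  show "f + g \<in> point_ideal E D r p" if "f \<in> point_ideal E D r p" "g \<in> point_ideal E D r p" for f g
    using that unfolding point_ideal_def by (rule rel_ideal_add)
qed (use assms indep_ground in auto)

lemma face_basis:
  obtains \<B> where "\<And>m. m \<in> \<B> \<Longrightarrow> keys m \<in> D \<and> total_degree_monom m \<le> r"
    "\<And>p :: 'a \<times> nat \<Rightarrow> 'k::field_char_0. is_lsop D r (\<lambda>i e. p (e, i)) \<Longrightarrow>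
      monomial_basis (point_ideal E D r p) \<B>"
proof -
  obtain \<B> where B: "\<forall>m\<in>\<B>. keys m \<in> D \<and> total_degree_monom m + card (cone_points E D r) \<le> r"
    "\<forall>\<theta> :: nat \<Rightarrow> 'a \<Rightarrow> 'k. is_lsop D r \<theta> \<longrightarrow>
      monomial_basis (rel_ideal D r (\<lambda>l. one_form E (\<theta> l))) \<B>"
    using koszul_and_basis[OF matroid_complex_axioms, where ?'k = 'k] by blast
  show ?thesis
  proof (rule that)
    show "keys m \<in> D \<and> total_degree_monom m \<le> r" if "m \<in> \<B>" for m using B(1) that by auto
    show "monomial_basis (point_ideal E D r p) \<B>"
      if "is_lsop D r (\<lambda>i e. p (e, i))" for p :: "'a \<times> nat \<Rightarrow> 'k"
      using B(2)[rule_format, OF that] by (simp add: point_ideal_def)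
  qed
qed

lemma high_degree_in_ideal:
  fixes p :: "'a \<times> nat \<Rightarrow> 'k::field_char_0"
  assumes lsop: "is_lsop D r (\<lambda>i e. p (e, i))" and f: "f \<in> homogeneous E j" "r < j"
  shows "f \<in> point_ideal E D r p"
proof -
  obtain \<B> where B: "\<And>m. m \<in> \<B> \<Longrightarrow> keys m \<in> D \<and> total_degree_monom m \<le> r"
    "monomial_basis (point_ideal E D r p) \<B>"
    using face_basis[where ?'k = 'k] lsop by metis
  interpret graded_quotient E "point_ideal E D r p" \<B>
    using graded_quotient_point B by blast
  have "graded_basis j = {}" using B(1) f(2) by (fastforce simp: graded_basis_def)
  then show ?thesis using normal_form[OF f(1)] by auto
qed

text \<open>For an l.s.o.p. all face monomials of degree \<open>r + 1\<close> lie in the ideal. This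
  is a spanning condition with \<open>A\<close> and \<open>B\<close> empty, hence open, and by
  evaluation it implies the l.s.o.p. property in return.\<close>

lemma lsop_open:
  fixes p0 :: "'a \<times> nat \<Rightarrow> 'k::field_char_0"
  assumes lsop: "is_lsop D r (\<lambda>i e. p0 (e, i))"
  shows "\<exists>\<phi>. polynomial_fun (E \<times> {..r}) \<phi> \<and> \<phi> p0 \<noteq> 0 \<and>
    (\<forall>p. \<phi> p \<noteq> 0 \<longrightarrow> is_lsop D r (\<lambda>i e. p (e, i)))"
proof -
  have DE: "D \<subseteq> Pow E" using indep_ground by blast
  have "single n 1 \<in> point_ideal E D r p0" if "keys n \<in> D" "total_degree_monom n = Suc r" for n
    using that DE by (intro high_degree_in_ideal[OF lsop homogeneous_single]) auto
  then obtain \<phi> where \<phi>: "polynomial_fun (E \<times> {..r}) \<phi>" "\<phi> p0 \<noteq> 0"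
    "\<And>p n. \<phi> p \<noteq> 0 \<Longrightarrow> keys n \<in> D \<Longrightarrow> total_degree_monom n = Suc r \<Longrightarrow>
      single n 1 \<in> point_ideal E D r p"
    using spanning_open[OF finite_ground DE, of "{}" 0 "Suc r" "{}" r p0] by auto
  have "is_lsop D r (\<lambda>i e. p (e, i))" if "\<phi> p \<noteq> 0" for p
    using \<phi>(3)[OF that] unfolding point_ideal_def
    by (intro lsop_if_powers_in_ideal[OF finite_ground DE down_closed_faces, of r]) simp
  with \<phi> show ?thesis by blast
qed

text \<open>The same \<B> serves at \<open>p0\<close> and nearby, so the sizes of the graded bases
  agree and the complement \<open>C\<close> found at \<open>p0\<close> can be reused. One polynomial
  for each \<open>i\<close> and one for the l.s.o.p. condition are multiplied together.\<close>

lemma good_points_open: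
  "zariski_open (E \<times> {..r}) (good_points E D r t :: ('a \<times> nat \<Rightarrow> 'k::field_char_0) set)"
proof (rule zariski_openI)
  show "(good_points E D r t :: ('a \<times> nat \<Rightarrow> 'k) set) \<subseteq> affine_space (E \<times> {..r})"
    by (auto simp: good_points_def)
next
  fix p0 :: "'a \<times> nat \<Rightarrow> 'k" assume p0: "p0 \<in> good_points E D r t"
  then have lsop: "is_lsop D r (\<lambda>i e. p0 (e, i))"
    and lef: "lefschetz E (point_ideal E D r p0) (point_form E r p0) t"
    by (auto simp: good_points_def)
  have DE: "D \<subseteq> Pow E" using indep_ground by blast
  obtain \<B> where B: "\<And>m. m \<in> \<B> \<Longrightarrow> keys m \<in> D \<and> total_degree_monom m \<le> r"
    and basis: "\<And>p :: 'a \<times> nat \<Rightarrow> 'k. is_lsop D r (\<lambda>i e. p (e, i)) \<Longrightarrow>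
      monomial_basis (point_ideal E D r p) \<B>"
    by (rule face_basis[where ?'k = 'k]) blast
  have gq: "graded_quotient E (point_ideal E D r p) \<B>" if "is_lsop D r (\<lambda>i e. p (e, i))"
    for p :: "'a \<times> nat \<Rightarrow> 'k"
    using graded_quotient_point[OF basis[OF that]] B by blast
  interpret q0: graded_quotient E "point_ideal E D r p0" \<B> by (rule gq[OF lsop])
  have power_form: "point_form E r p ^ k \<in> homogeneous E k" for p :: "'a \<times> nat \<Rightarrow> 'k" and k
    unfolding point_form_def by (intro homogeneous_power one_form_homogeneous)
  define P where "P i \<phi> \<longleftrightarrow> polynomial_fun (E \<times> {..r}) \<phi> \<and> \<phi> p0 \<noteq> 0 \<and>
      (\<forall>p. \<phi> p \<noteq> 0 \<longrightarrow> is_lsop D r (\<lambda>i e. p (e, i)) \<longrightarrow> (\<forall>f\<in>homogeneous E i.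
        point_form E r p ^ (t - 2 * i) * f \<in> point_ideal E D r p \<longrightarrow> f \<in> point_ideal E D r p))"
    for i \<phi>
  have "\<exists>\<phi>. P i \<phi>"
    if i: "2 * i \<le> t" for i
  proof -
    let ?k = "t - 2 * i" and ?j = "t - i"
    have j: "?j = ?k + i" using i by simp
    have "f \<in> point_ideal E D r p0"
      if "f \<in> homogeneous E i" "point_form E r p0 ^ ?k * f \<in> point_ideal E D r p0" for f
      using lef i that unfolding lefschetz_def by (metis le_add_diff_inverse order_refl)
    then have "\<exists>C\<subseteq>q0.graded_basis ?j.
        card C + card (q0.graded_basis i) = card (q0.graded_basis ?j) \<and>
        (\<forall>f\<in>homogeneous E ?j. q0.spans (point_form E r p0 ^ ?k) i C f)"
      by (rule q0.injective_imp_spans[OF power_form j])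
    then obtain C where C: "C \<subseteq> q0.graded_basis ?j"
      "card C + card (q0.graded_basis i) = card (q0.graded_basis ?j)"
      "\<forall>f\<in>homogeneous E ?j. q0.spans (point_form E r p0 ^ ?k) i C f"
      by blast
    have gb: "keys m \<in> D \<and> keys m \<subseteq> E \<and> total_degree_monom m = l" if "m \<in> q0.graded_basis l" for m l
    proof -
      have "m \<in> \<B>" "total_degree_monom m = l" using that by (simp_all add: q0.graded_basis_def)
      then show ?thesis using B[of m] DE by blast
    qed
    have A: "keys m \<subseteq> E \<and> total_degree_monom m + ?k = ?j" if "m \<in> q0.graded_basis i" for m
      using gb[OF that] i by simp
    have CB: "keys m \<subseteq> E \<and> total_degree_monom m = ?j" if "m \<in> C" for m
      using gb[OF subsetD[OF C(1) that]] by simp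
    have "\<exists>c d. single n 1 - (\<Sum>m\<in>q0.graded_basis i. const (c m) * (point_form E r p0 ^ ?k * single m 1)) -
        (\<Sum>m\<in>C. single m (d m)) \<in> point_ideal E D r p0" if "keys n \<in> D" "total_degree_monom n = ?j" for n
    proof -
      have "single n 1 \<in> homogeneous E ?j" using that DE by (intro homogeneous_single) auto
      then show ?thesis using C(3) unfolding q0.spans_def by (elim ballE) auto
    qed
    from spanning_open[OF finite_ground DE A CB this]
    obtain \<phi> where \<phi>: "polynomial_fun (E \<times> {..r}) \<phi>" "\<phi> p0 \<noteq> 0"
      "\<And>p n. \<phi> p \<noteq> 0 \<Longrightarrow> keys n \<in> D \<Longrightarrow> total_degree_monom n = ?j \<Longrightarrow>
        \<exists>c d. single n 1 - (\<Sum>m\<in>q0.graded_basis i. const (c m) * (point_form E r p ^ ?k * single m 1)) -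
        (\<Sum>m\<in>C. single m (d m)) \<in> point_ideal E D r p"
      by blast
    have "f \<in> point_ideal E D r p" if p: "\<phi> p \<noteq> 0" "is_lsop D r (\<lambda>i e. p (e, i))"
      and f: "f \<in> homogeneous E i" "point_form E r p ^ ?k * f \<in> point_ideal E D r p" for p f
    proof -
      interpret q: graded_quotient E "point_ideal E D r p" \<B> by (rule gq[OF p(2)])
      have "q.spans (point_form E r p ^ ?k) i C (single m 1)" if "m \<in> q.graded_basis ?j" for m
        using \<phi>(3)[OF p(1)] gb[OF that] unfolding q.spans_def by blast
      then show ?thesis using q.spans_imp_injective[OF power_form j C(1,2)] f by blast
    qed
    with \<phi>(1,2) have "P i \<phi>" unfolding P_def by blast
    then show ?thesis by (intro exI[of _ \<phi>])
  qed
  then obtain \<phi> where \<phi>: "\<And>i. 2 * i \<le> t \<Longrightarrow> P i (\<phi> i)" by metis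
  obtain \<psi> where \<psi>: "polynomial_fun (E \<times> {..r}) \<psi>" "\<psi> p0 \<noteq> 0"
    "\<And>p. \<psi> p \<noteq> 0 \<Longrightarrow> is_lsop D r (\<lambda>i e. p (e, i))"
    using lsop_open[OF lsop] by blast
  let ?I = "{i. 2 * i \<le> t}"
  have finI: "finite ?I" by (rule finite_subset[of _ "{..t}"]) auto
  let ?\<Phi> = "\<lambda>p. \<psi> p * (\<Prod>i\<in>?I. \<phi> i p)"
  have "polynomial_fun (E \<times> {..r}) ?\<Phi>"
    using \<phi> \<psi>(1) by (intro polynomial_fun_mult polynomial_fun_prod) (auto simp: P_def)
  moreover have "?\<Phi> p0 \<noteq> 0" using \<phi> \<psi>(2) finI by (simp add: P_def)
  moreover have "p \<in> good_points E D r t" if p: "p \<in> affine_space (E \<times> {..r})" "?\<Phi> p \<noteq> 0" for p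
  proof -
    have l: "is_lsop D r (\<lambda>i e. p (e, i))" using p \<psi>(3) by simp
    have mult: "g * f \<in> point_ideal E D r p" if "f \<in> point_ideal E D r p" for f g
      using that unfolding point_ideal_def by (rule rel_ideal_mult[OF down_closed_faces])
    have "\<forall>i. 2 * i \<le> t \<longrightarrow> (\<forall>f\<in>homogeneous E i.
        point_form E r p ^ (t - 2 * i) * f \<in> point_ideal E D r p \<longrightarrow> f \<in> point_ideal E D r p)"
    proof (intro allI impI)
      fix i assume i: "2 * i \<le> t"
      then have "\<phi> i p \<noteq> 0" using p(2) finI by auto
      then show "\<forall>f\<in>homogeneous E i. point_form E r p ^ (t - 2 * i) * f \<in> point_ideal E D r p \<longrightarrow>
          f \<in> point_ideal E D r p"
        using \<phi>[OF i] l unfolding P_def by blast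
    qed
    then have "lefschetz E (point_ideal E D r p) (point_form E r p) t"
      by (subst lefschetz_iff) (rule mult)
    with p l show ?thesis by (simp add: good_points_def)
  qed
  ultimately show "\<exists>\<phi>. polynomial_fun (E \<times> {..r}) \<phi> \<and> \<phi> p0 \<noteq> 0 \<and>
      (\<forall>p\<in>affine_space (E \<times> {..r}). \<phi> p \<noteq> 0 \<longrightarrow> p \<in> good_points E D r t)"
    by (intro exI[of _ ?\<Phi>]) blast
qed

end

section \<open>Monomial complete intersections\<close>

text \<open>The operators \<open>raise\<close> and \<open>lower\<close> act on coefficient functions. On the quotient by the powers
  \<open>x\<^sub>v\<close> to the \<open>s v\<close> they are the raising and lowering operators of a representation of the Lie
  algebra sl2; \<open>lower\<close> takes \<open>x\<^sub>v\<close> to the \<open>a\<close> to \<open>a * (s v - a)\<close> times \<open>x\<^sub>v\<close> to the \<open>a - 1\<close>.\<close>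

definition raise :: "'v set \<Rightarrow> (('v \<Rightarrow>\<^sub>0 nat) \<Rightarrow> 'k::field) \<Rightarrow> ('v \<Rightarrow>\<^sub>0 nat) \<Rightarrow> 'k" where
  "raise V \<phi> n = (\<Sum>v\<in>V. if v \<in> keys n then \<phi> (n - single v 1) else 0)"

definition lower :: "'v set \<Rightarrow> ('v \<Rightarrow> nat) \<Rightarrow> (('v \<Rightarrow>\<^sub>0 nat) \<Rightarrow> 'k::field) \<Rightarrow> ('v \<Rightarrow>\<^sub>0 nat) \<Rightarrow> 'k" where
  "lower V s \<phi> n = (\<Sum>v\<in>V. of_nat (lookup n v + 1) * (of_nat (s v) - of_nat (lookup n v + 1)) *
     \<phi> (n + single v 1))"

definition supported_in_degree :: "'v set \<Rightarrow> nat \<Rightarrow> (('v \<Rightarrow>\<^sub>0 nat) \<Rightarrow> 'k::field) \<Rightarrow> bool" where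
  "supported_in_degree V i \<phi> \<longleftrightarrow>
     (\<forall>n. \<phi> n \<noteq> 0 \<longrightarrow> keys n \<subseteq> V \<and> total_degree_monom n = i)"

text \<open>These are the coefficient functions of the ideal generated by the \<open>s v\<close>-th
  powers of the variables \<open>v\<close> in \<open>V\<close>.\<close>

definition vanishes_below :: "'v set \<Rightarrow> ('v \<Rightarrow> nat) \<Rightarrow> (('v \<Rightarrow>\<^sub>0 nat) \<Rightarrow> 'k::field) \<Rightarrow> bool" where
  "vanishes_below V s \<phi> \<longleftrightarrow> (\<forall>n. (\<forall>v\<in>V. lookup n v < s v) \<longrightarrow> \<phi> n = 0)"

lemma raise_linear: "raise V (\<lambda>n. \<phi> n + c * \<psi> n) n = raise V \<phi> n + c * raise V \<psi> n"
  unfolding raise_def sum_distrib_left sum.distrib[symmetric] by (intro sum.cong) auto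

lemma lookup_diff_single: "lookup (n - single v (Suc 0)) w = (if w = v then lookup n v - 1 else lookup n w)"
  for n :: "'v \<Rightarrow>\<^sub>0 nat"
  by (auto simp: lookup_minus lookup_single when_def)

lemma lookup_add_single: "lookup (n + single v (Suc 0)) w = (if w = v then lookup n v + 1 else lookup n w)"
  for n :: "'v \<Rightarrow>\<^sub>0 nat"
  by (auto simp: lookup_add lookup_single when_def)

text \<open>For \<open>v \<noteq> w\<close> the operators commute. For \<open>v = w\<close> an
  exponent b contributes (b + 1)(s - b - 1) - b(s - b) = s - 1 - 2b.\<close>

lemma lower_raise_term:
  fixes \<phi> :: "('v \<Rightarrow>\<^sub>0 nat) \<Rightarrow> 'k::field" and s :: "'v \<Rightarrow> nat"
  defines "a \<equiv> \<lambda>(n :: 'v \<Rightarrow>\<^sub>0 nat) v. of_nat (lookup n v + 1) * (of_nat (s v) - of_nat (lookup n v + 1)) :: 'k"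
  shows "a n v * (if w \<in> keys (n + single v 1) then \<phi> (n + single v 1 - single w 1) else 0) =
    (if w \<in> keys n then a (n - single w 1) v * \<phi> (n - single w 1 + single v 1) else 0) +
    (if v = w then (of_nat (s v) - 1 - 2 * of_nat (lookup n v)) * \<phi> n else 0)"
proof (cases "v = w")
  case True
  show ?thesis
  proof (cases "w \<in> keys n")
    case w: True
    then have "lookup n w \<noteq> 0" by (simp add: in_keys_iff)
    then obtain b where b: "lookup n w = Suc b" by (cases "lookup n w") auto
    have "n - single w 1 + single w 1 = n" using diff_single_add[OF w] by (simp add: add.commute)
    then show ?thesis using True w b
      by (simp add: a_def keys_add_nat lookup_diff_single algebra_simps)
  next
    case False
    then have "lookup n w = 0" by (simp add: in_keys_iff)
    then show ?thesis using True False
      by (simp add: a_def keys_add_nat algebra_simps)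
  qed
next
  case False
  have "w \<in> keys (n + single v 1) \<longleftrightarrow> w \<in> keys n" using False by (simp add: keys_add_nat)
  moreover have "n + single v 1 - single w 1 = n - single w 1 + single v 1" if "w \<in> keys n"
  proof (rule poly_mapping_eqI)
    fix u
    have "0 < lookup n w" using that by (simp add: in_keys_iff)
    then show "lookup (n + single v 1 - single w 1) u = lookup (n - single w 1 + single v 1) u"
      using False by (simp add: lookup_diff_single lookup_add_single)
  qed
  ultimately show ?thesis using False by (simp add: a_def lookup_diff_single)
qed

text \<open>The sl2 relation: on degree \<open>i\<close> the commutator is the weight t - 2i, where
  t, the sum of the \<open>s v - 1\<close>, is the top degree of the quotient.\<close>

lemma lower_raise:
  fixes \<phi> :: "('v \<Rightarrow>\<^sub>0 nat) \<Rightarrow> 'k::field"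
  assumes V: "finite V" and s: "\<And>v. v \<in> V \<Longrightarrow> 1 \<le> s v" and deg: "supported_in_degree V i \<phi>"
  shows "lower V s (raise V \<phi>) n =
    raise V (lower V s \<phi>) n + (of_nat (\<Sum>v\<in>V. s v - 1) - 2 * of_nat i) * \<phi> n"
proof -
  define a where "a n v = (of_nat (lookup n v + 1) * (of_nat (s v) - of_nat (lookup n v + 1)) :: 'k)"
    for n :: "'v \<Rightarrow>\<^sub>0 nat" and v
  have "lower V s (raise V \<phi>) n = (\<Sum>v\<in>V. \<Sum>w\<in>V. a n v *
      (if w \<in> keys (n + single v 1) then \<phi> (n + single v 1 - single w 1) else 0))"
    unfolding lower_def raise_def sum_distrib_left a_def ..
  also have "\<dots> = (\<Sum>v\<in>V. \<Sum>w\<in>V. (if w \<in> keys n then a (n - single w 1) v * \<phi> (n - single w 1 + single v 1) else 0) +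
    (if v = w then (of_nat (s v) - 1 - 2 * of_nat (lookup n v)) * \<phi> n else 0))"
    unfolding a_def by (intro sum.cong refl lower_raise_term)
  also have "\<dots> = (\<Sum>v\<in>V. \<Sum>w\<in>V. if w \<in> keys n then a (n - single w 1) v * \<phi> (n - single w 1 + single v 1) else 0) +
      (\<Sum>v\<in>V. (of_nat (s v) - 1 - 2 * of_nat (lookup n v)) * \<phi> n)"
    using V by (simp add: sum.distrib)
  also have "(\<Sum>v\<in>V. \<Sum>w\<in>V. if w \<in> keys n then a (n - single w 1) v * \<phi> (n - single w 1 + single v 1) else 0) =
      (\<Sum>w\<in>V. \<Sum>v\<in>V. if w \<in> keys n then a (n - single w 1) v * \<phi> (n - single w 1 + single v 1) else 0)"
    by (rule sum.swap)
  also have "\<dots> = raise V (lower V s \<phi>) n"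
    unfolding raise_def lower_def a_def by (intro sum.cong) auto
  also have "(\<Sum>v\<in>V. (of_nat (s v) - 1 - 2 * of_nat (lookup n v)) * \<phi> n) =
      (of_nat (\<Sum>v\<in>V. s v - 1) - 2 * of_nat i) * \<phi> n"
  proof (cases "\<phi> n = 0")
    case False
    then have "keys n \<subseteq> V" "total_degree_monom n = i" using deg by (auto simp: supported_in_degree_def)
    then have "(\<Sum>v\<in>V. lookup n v) = i" using total_degree_superset[OF V] by metis
    then have i: "of_nat i = (\<Sum>v\<in>V. of_nat (lookup n v) :: 'k)" by (simp flip: of_nat_sum)
    have "of_nat (\<Sum>v\<in>V. s v - 1) = (\<Sum>v\<in>V. of_nat (s v) - 1 :: 'k)"
      unfolding of_nat_sum using s by (intro sum.cong) (auto simp: of_nat_diff)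
    then show ?thesis unfolding i
      by (simp add: sum_subtractf sum_distrib_left flip: sum_distrib_right)
  qed simp
  finally show ?thesis .
qed

lemma supported_raise:
  assumes "supported_in_degree V i \<phi>"
  shows "supported_in_degree V (Suc i) (raise V \<phi>)"
  unfolding supported_in_degree_def
proof (intro allI impI)
  fix n assume "raise V \<phi> n \<noteq> 0"
  then obtain v where v: "v \<in> V" "(if v \<in> keys n then \<phi> (n - single v 1) else 0) \<noteq> 0"
    unfolding raise_def using sum.not_neutral_contains_not_neutral by blast
  then have k: "v \<in> keys n" "\<phi> (n - single v 1) \<noteq> 0" by (auto split: if_splits)
  then have "keys (n - single v 1) \<subseteq> V" "total_degree_monom (n - single v 1) = i"
    using assms by (auto simp: supported_in_degree_def)
  then show "keys n \<subseteq> V \<and> total_degree_monom n = Suc i"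
    using diff_single_add[OF k(1)] keys_add_nat[of "single v 1" "n - single v 1"]
      total_degree_add[of "single v 1" "n - single v 1"] v(1) by auto
qed

text \<open>The difference \<open>i - 1\<close> truncates, so degree zero needs the separate
  claim.\<close>

lemma supported_lower:
  assumes "supported_in_degree V i \<phi>"
  shows "supported_in_degree V (i - 1) (lower V s \<phi>)" "i = 0 \<Longrightarrow> lower V s \<phi> n = 0"
proof -
  have *: "keys n \<subseteq> V \<and> Suc (total_degree_monom n) = i" if nz: "lower V s \<phi> n \<noteq> 0" for n
  proof -
    obtain v where v: "v \<in> V" "of_nat (lookup n v + 1) *
        (of_nat (s v) - of_nat (lookup n v + 1)) * \<phi> (n + single v 1) \<noteq> 0"
      using nz unfolding lower_def using sum.not_neutral_contains_not_neutral by blast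
    then have "\<phi> (n + single v 1) \<noteq> 0" by auto
    then have "keys (n + single v 1) \<subseteq> V" "total_degree_monom (n + single v 1) = i"
      using assms by (auto simp: supported_in_degree_def)
    then show ?thesis by (simp add: keys_add_nat total_degree_add)
  qed
  then show "supported_in_degree V (i - 1) (lower V s \<phi>)"
    unfolding supported_in_degree_def by fastforce
  show "i = 0 \<Longrightarrow> lower V s \<phi> n = 0" using * by fastforce
qed

lemma vanishes_raise:
  assumes "vanishes_below V s \<phi>"
  shows "vanishes_below V s (raise V \<phi>)"
  unfolding vanishes_below_def raise_def
proof (intro allI impI sum.neutral ballI)
  fix n v assume n: "\<forall>v\<in>V. lookup n v < s v" and v: "v \<in> V"
  have "lookup (n - single v 1) w < s w" if "w \<in> V" for w
    using n that by (auto simp: lookup_diff_single intro: le_less_trans[OF diff_le_self])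
  then show "(if v \<in> keys n then \<phi> (n - single v 1) else 0) = 0"
    using assms by (simp add: vanishes_below_def)
qed

text \<open>Lowering could leave the ideal only from exponent \<open>s v\<close> to
  \<open>s v - 1\<close>, and exactly there its coefficient is zero.\<close>

lemma vanishes_lower:
  assumes "vanishes_below V s \<phi>"
  shows "vanishes_below V s (lower V s \<phi>)"
  unfolding vanishes_below_def lower_def
proof (intro allI impI sum.neutral ballI)
  fix n v assume n: "\<forall>v\<in>V. lookup n v < s v" and v: "v \<in> V"
  show "of_nat (lookup n v + 1) * (of_nat (s v) - of_nat (lookup n v + 1)) * \<phi> (n + single v 1) = 0"
  proof (cases "lookup n v + 1 = s v")
    case True
    then show ?thesis by (metis cancel_comm_monoid_add_class.diff_cancel mult_zero_left mult_zero_right)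
  next
    case False
    then have "lookup (n + single v 1) w < s w" if "w \<in> V" for w
      using n that v by (auto simp: lookup_add_single Suc_lessI)
    then have "\<phi> (n + single v 1) = 0" using assms by (simp add: vanishes_below_def)
    then show ?thesis by simp
  qed
qed

lemma supported_raise_power:
  "supported_in_degree V i \<phi> \<Longrightarrow> supported_in_degree V (i + m) ((raise V ^^ m) \<phi>)"
  by (induction m) (auto dest: supported_raise)

text \<open>The weights t - 2(i + j) for j from 0 to \<open>m\<close> add up to (m + 1)(t - 2i -
  m).\<close>

lemma lower_raise_power:
  fixes \<phi> :: "('v \<Rightarrow>\<^sub>0 nat) \<Rightarrow> 'k::field" and s :: "'v \<Rightarrow> nat" and V :: "'v set"
  assumes V: "finite V" and s: "\<And>v. v \<in> V \<Longrightarrow> 1 \<le> s v" and deg: "supported_in_degree V i \<phi>"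
  defines "t \<equiv> \<Sum>v\<in>V. s v - 1"
  shows "lower V s ((raise V ^^ Suc m) \<phi>) = (\<lambda>n. (raise V ^^ Suc m) (lower V s \<phi>) n +
    of_nat (Suc m) * (of_nat t - 2 * of_nat i - of_nat m) * (raise V ^^ m) \<phi> n)"
proof (induction m)
  case 0
  show ?case using lower_raise[OF V s deg] by (simp add: t_def fun_eq_iff)
next
  case (Suc m)
  show ?case
  proof (rule ext)
    fix n
    have A: "lower V s ((raise V ^^ Suc (Suc m)) \<phi>) n =
        raise V (lower V s ((raise V ^^ Suc m) \<phi>)) n +
        (of_nat t - 2 * of_nat (i + Suc m)) * (raise V ^^ Suc m) \<phi> n"
      using lower_raise[OF V s supported_raise_power[OF deg, of "Suc m"]] by (simp add: t_def)
    have B: "raise V (lower V s ((raise V ^^ Suc m) \<phi>)) n =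
        (raise V ^^ Suc (Suc m)) (lower V s \<phi>) n +
        of_nat (Suc m) * (of_nat t - 2 * of_nat i - of_nat m) * (raise V ^^ Suc m) \<phi> n"
      unfolding Suc.IH raise_linear by simp
    show "lower V s ((raise V ^^ Suc (Suc m)) \<phi>) n =
        (raise V ^^ Suc (Suc m)) (lower V s \<phi>) n +
        of_nat (Suc (Suc m)) * (of_nat t - 2 * of_nat i - of_nat (Suc m)) * (raise V ^^ Suc m) \<phi> n"
      unfolding A B by (simp add: algebra_simps)
  qed
qed

lemma raise_coefficient_nonzero:
  assumes "2 * i + m < t"
  shows "of_nat (Suc m) * (of_nat t - 2 * of_nat i - of_nat m) \<noteq> (0 :: 'k::field_char_0)"
proof -
  obtain q where "t = 2 * i + m + Suc q" using less_imp_Suc_add[OF assms] by auto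
  then have "of_nat t - 2 * of_nat i - of_nat m = (of_nat (Suc q) :: 'k)" by simp
  then show ?thesis by (metis mult_eq_0_iff nat.distinct(1) of_nat_eq_0_iff)
qed

lemma vanishes_below_cancel:
  assumes "\<And>n. \<chi> n = \<phi> n + c * \<psi> n" "vanishes_below V s \<chi>"
  shows "vanishes_below V s \<psi> \<Longrightarrow> vanishes_below V s \<phi>"
    and "vanishes_below V s \<phi> \<Longrightarrow> vanishes_below V s (\<lambda>n. c * \<psi> n)"
  using assms by (auto simp: vanishes_below_def)

text \<open>Suppose raising \<phi> \<open>m + 1\<close> times gives an element of the ideal.
  Lowering it leaves the raised \<open>lower V s \<phi>\<close> plus a nonzero multiple of the
  \<open>m\<close>-fold raise of \<phi>; raising once more disposes of the second term. The outer
  induction then handles \<open>lower V s \<phi>\<close>, one degree down with exponent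
  \<open>m + 2\<close>, and the inner one the \<open>m\<close>-fold raise.\<close>

lemma raise_power_cancel:
  fixes \<phi> :: "('v \<Rightarrow>\<^sub>0 nat) \<Rightarrow> 'k::field_char_0"
  assumes V: "finite V" and s: "\<And>v. v \<in> V \<Longrightarrow> 1 \<le> s v"
    and deg: "supported_in_degree V i \<phi>" and im: "2 * i + m \<le> (\<Sum>v\<in>V. s v - 1)"
    and van: "vanishes_below V s ((raise V ^^ m) \<phi>)"
  shows "vanishes_below V s \<phi>"
  using deg im van
proof (induction i arbitrary: \<phi> m)
  case (0 \<phi> m)
  let ?t = "\<Sum>v\<in>V. s v - 1"
  from 0 show ?case
  proof (induction m)
    case (Suc m)
    let ?c = "of_nat (Suc m) * (of_nat ?t - 2 * of_nat 0 - of_nat m) :: 'k"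
    have "lower V s \<phi> = (\<lambda>n. 0)" using supported_lower(2)[OF Suc.prems(1)] by auto
    moreover have r0: "raise V (\<lambda>n. 0) = (\<lambda>n. 0 :: 'k)" by (simp add: raise_def fun_eq_iff)
    then have "(raise V ^^ j) (\<lambda>n. 0) = (\<lambda>n. 0 :: 'k)" for j
      by (induction j) simp_all
    ultimately have "lower V s ((raise V ^^ Suc m) \<phi>) = (\<lambda>n. ?c * (raise V ^^ m) \<phi> n)"
      using lower_raise_power[where s = s and m = m, OF V s Suc.prems(1)] r0 by simp
    then have "vanishes_below V s (\<lambda>n. ?c * (raise V ^^ m) \<phi> n)"
      using vanishes_lower[OF Suc.prems(3)] by simp
    moreover have "?c \<noteq> 0"
      using Suc.prems(2) by (intro raise_coefficient_nonzero) simp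
    ultimately have "vanishes_below V s ((raise V ^^ m) \<phi>)" by (simp add: vanishes_below_def)
    then show ?case using Suc.IH Suc.prems by simp
  qed simp
next
  case (Suc i \<phi> m)
  note outer = Suc.IH
  let ?t = "\<Sum>v\<in>V. s v - 1"
  from Suc.prems show ?case
  proof (induction m)
    case (Suc m)
    let ?c = "of_nat (Suc m) * (of_nat ?t - 2 * of_nat (Suc i) - of_nat m) :: 'k"
    have lr: "lower V s ((raise V ^^ Suc m) \<phi>) =
        (\<lambda>n. (raise V ^^ Suc m) (lower V s \<phi>) n + ?c * (raise V ^^ m) \<phi> n)"
      by (rule lower_raise_power[OF V s Suc.prems(1)])
    have lv: "vanishes_below V s (lower V s ((raise V ^^ Suc m) \<phi>))"
      by (rule vanishes_lower[OF Suc.prems(3)])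
    have "vanishes_below V s (lower V s \<phi>)"
    proof (rule outer)
      show "supported_in_degree V i (lower V s \<phi>)" using supported_lower(1)[OF Suc.prems(1)] by simp
      show "2 * i + Suc (Suc m) \<le> ?t" using Suc.prems(2) by simp
      have "raise V (lower V s ((raise V ^^ Suc m) \<phi>)) n =
          (raise V ^^ Suc (Suc m)) (lower V s \<phi>) n + ?c * (raise V ^^ Suc m) \<phi> n" for n
        unfolding lr raise_linear by simp
      then show "vanishes_below V s ((raise V ^^ Suc (Suc m)) (lower V s \<phi>))"
        by (rule vanishes_below_cancel(1)) (rule vanishes_raise[OF lv], rule Suc.prems(3))
    qed
    then have "vanishes_below V s ((raise V ^^ j) (lower V s \<phi>))" for j
      by (induction j) (simp_all add: vanishes_raise)
    from this[of "Suc m"] have "vanishes_below V s (\<lambda>n. ?c * (raise V ^^ m) \<phi> n)"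
      by (rule vanishes_below_cancel(2)[OF fun_cong[OF lr] lv])
    moreover have "?c \<noteq> 0"
      using Suc.prems(2) by (intro raise_coefficient_nonzero) simp
    ultimately have "vanishes_below V s ((raise V ^^ m) \<phi>)" by (simp add: vanishes_below_def)
    then show ?case using Suc.IH Suc.prems by simp
  qed simp
qed

lemma lookup_sum_form_power:
  "lookup (one_form V (\<lambda>_. 1) ^ k * f) = (raise V ^^ k) (lookup f)"
proof (induction k)
  case (Suc k)
  have "lookup (one_form V (\<lambda>_. 1) * (one_form V (\<lambda>_. 1) ^ k * f)) =
      raise V (lookup (one_form V (\<lambda>_. 1) ^ k * f))"
    by (rule ext) (simp add: lookup_one_form_mult raise_def)
  then show ?case using Suc by (simp add: mult.assoc)
qed simp

lemma complete_intersection_lefschetz: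
  fixes f :: "('v, 'k::field_char_0) mpoly"
  assumes "finite V" "\<And>v. v \<in> V \<Longrightarrow> 1 \<le> s v" "f \<in> homogeneous V i"
    "2 * i + k \<le> (\<Sum>v\<in>V. s v - 1)"
    "vanishes_below V s (lookup (one_form V (\<lambda>_. 1) ^ k * f))"
  shows "vanishes_below V s (lookup f)"
proof -
  have "supported_in_degree V i (lookup f)"
    using assms(3) by (auto simp: supported_in_degree_def homogeneous_iff in_keys_iff)
  then show ?thesis
    using raise_power_cancel[OF assms(1,2) _ assms(4)] assms(5) unfolding lookup_sum_form_power
    by blast
qed

section \<open>Direct sums of circuits\<close>

definition monomial_value :: "('v \<Rightarrow> ('w, 'k::field) mpoly) \<Rightarrow> ('v \<Rightarrow>\<^sub>0 nat) \<Rightarrow> ('w, 'k) mpoly" where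
  "monomial_value \<sigma> n = (\<Prod>v\<in>keys n. \<sigma> v ^ lookup n v)"

definition subst_poly :: "('v \<Rightarrow> ('w, 'k::field) mpoly) \<Rightarrow> ('v, 'k) mpoly \<Rightarrow> ('w, 'k) mpoly" where
  "subst_poly \<sigma> f = (\<Sum>n\<in>keys f. const (lookup f n) * monomial_value \<sigma> n)"

lemma monomial_value_superset:
  "finite A \<Longrightarrow> keys n \<subseteq> A \<Longrightarrow> monomial_value \<sigma> n = (\<Prod>v\<in>A. \<sigma> v ^ lookup n v)"
  unfolding monomial_value_def by (rule prod.mono_neutral_left) (auto simp: in_keys_iff)

lemma monomial_value_add: "monomial_value \<sigma> (m + n) = monomial_value \<sigma> m * monomial_value \<sigma> n"
proof -
  have *: "monomial_value \<sigma> q = (\<Prod>v\<in>keys m \<union> keys n. \<sigma> v ^ lookup q v)" if "keys q \<subseteq> keys m \<union> keys n" for q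
    by (rule monomial_value_superset) (use that in auto)
  show ?thesis
    by (simp add: * keys_add_nat lookup_add power_add prod.distrib)
qed

lemma monomial_value_single: "monomial_value \<sigma> (single v 1) = \<sigma> v"
  by (simp add: monomial_value_def)

lemma subst_poly_superset:
  "finite A \<Longrightarrow> keys f \<subseteq> A \<Longrightarrow> subst_poly \<sigma> f = (\<Sum>n\<in>A. const (lookup f n) * monomial_value \<sigma> n)"
  unfolding subst_poly_def by (rule sum.mono_neutral_left) (auto simp: in_keys_iff)

lemma subst_poly_add: "subst_poly \<sigma> (f + g) = subst_poly \<sigma> f + subst_poly \<sigma> g"
proof -
  let ?A = "keys f \<union> keys g"
  have c: "const (a + b) = const a + const b" for a b by (simp add: const_def single_add)
  have "subst_poly \<sigma> (f + g) = (\<Sum>n\<in>?A. const (lookup (f + g) n) * monomial_value \<sigma> n)"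
    using Poly_Mapping.keys_add[of f g] by (intro subst_poly_superset) auto
  also have "\<dots> = subst_poly \<sigma> f + subst_poly \<sigma> g"
    unfolding lookup_add c distrib_right sum.distrib
    by (simp add: subst_poly_superset[of ?A])
  finally show ?thesis .
qed

lemma subst_poly_zero [simp]: "subst_poly \<sigma> 0 = 0"
  by (simp add: subst_poly_def)

lemma subst_poly_diff: "subst_poly \<sigma> (f - g) = subst_poly \<sigma> f - subst_poly \<sigma> g"
  using subst_poly_add[of \<sigma> "f - g" g] by (simp add: algebra_simps)

lemma subst_poly_sum: "subst_poly \<sigma> (\<Sum>x\<in>A. f x) = (\<Sum>x\<in>A. subst_poly \<sigma> (f x))"
  by (induction A rule: infinite_finite_induct) (simp_all add: subst_poly_add)

lemma subst_poly_single: "subst_poly \<sigma> (single n c) = const c * monomial_value \<sigma> n"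
  by (simp add: subst_poly_def)

lemma subst_poly_var_mult: "subst_poly \<sigma> (var e * f) = \<sigma> e * subst_poly \<sigma> f"
proof (induction f rule: mpoly_induct)
  case (add m c f)
  have "subst_poly \<sigma> (var e * single m c) = \<sigma> e * subst_poly \<sigma> (single m c)"
    by (simp add: var_def mult_single subst_poly_single monomial_value_add
        monomial_value_single[unfolded One_nat_def] mult.left_commute)
  with add show ?case by (simp add: distrib_left subst_poly_add)
qed simp

text \<open>The fibres of \<tau> are disjoint circuits, each with a chosen representative, and the
  elements of \<open>E - M\<close> are cone points. \<open>card_E\<close> says that \<open>r\<close>
  is the rank of this direct sum.\<close>

locale circuit_sum =
  fixes E M :: "'a set" and \<tau> :: "'a \<Rightarrow> 'a" and D :: "'a set set" and r :: nat
  assumes finite_E: "finite E" and M_sub: "M \<subseteq> E"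
    and \<tau>_in: "e \<in> M \<Longrightarrow> \<tau> e \<in> M" and \<tau>_idem: "e \<in> M \<Longrightarrow> \<tau> (\<tau> e) = \<tau> e"
    and card_E: "card E = r + card (\<tau> ` M)"
    and D_eq: "D = {F. F \<subseteq> E \<and> (\<forall>v\<in>\<tau> ` M. \<not> {e \<in> M. \<tau> e = v} \<subseteq> F)}"
begin

abbreviation "V \<equiv> \<tau> ` M"

definition circuit :: "'a \<Rightarrow> 'a set" where
  "circuit v = {e \<in> M. \<tau> e = v}"

lemma finite_V: "finite V" and V_sub: "V \<subseteq> M" and \<tau>_V: "v \<in> V \<Longrightarrow> \<tau> v = v"
  using finite_subset[OF M_sub finite_E] \<tau>_in \<tau>_idem by auto

lemma finite_circuit: "finite (circuit v)"
  using finite_E M_sub finite_subset[of M E] by (simp add: circuit_def)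

lemma down_closed_D: "down_closed D"
  unfolding D_eq down_closed_def by blast

lemma circuit_card: "v \<in> V \<Longrightarrow> 1 \<le> card (circuit v)"
  using finite_circuit[of v] by (simp add: Suc_le_eq card_gt_0_iff) (auto simp: circuit_def)

lemma circuit_nonface: "v \<in> V \<Longrightarrow> circuit v \<notin> D"
  by (auto simp: D_eq circuit_def)

lemma sum_circuits: "(\<Sum>v\<in>V. card (circuit v) - 1) + card V = card M"
proof -
  have "(\<Sum>v\<in>V. card (circuit v) - 1) + (\<Sum>v\<in>V. 1) = (\<Sum>v\<in>V. card (circuit v))"
    unfolding sum.distrib[symmetric] by (intro sum.cong refl le_add_diff_inverse2 circuit_card)
  also have "\<dots> = card (\<Union>v\<in>V. circuit v)"
    using finite_V finite_circuit by (subst card_UN_disjoint) (auto simp: circuit_def)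
  also have "(\<Union>v\<in>V. circuit v) = M" by (auto simp: circuit_def)
  finally show ?thesis by simp
qed

text \<open>The substitution that solves the parameters chosen below: it identifies the variables
  along each circuit and kills the cone points.\<close>

definition \<sigma> :: "'a \<Rightarrow> ('a, 'k::field) mpoly" where
  "\<sigma> e = (if e \<in> M then var (\<tau> e) else 0)"

lemma \<sigma>_V:
  assumes "v \<in> V"
  shows "\<sigma> v = var v"
  using subsetD[OF V_sub assms] \<tau>_V[OF assms] by (simp add: \<sigma>_def)

lemma subst_sum_form: "subst_poly \<sigma> (one_form V (\<lambda>_. 1) ^ k * f) =
    (one_form V (\<lambda>_. 1) ^ k * subst_poly \<sigma> f :: ('a, 'k::field) mpoly)"
proof (induction k)
  case (Suc k)
  have "subst_poly \<sigma> (one_form V (\<lambda>_. 1) * g) = (one_form V (\<lambda>_. 1) * subst_poly \<sigma> g :: ('a, 'k) mpoly)" for g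
    unfolding one_form_def
    by (simp add: sum_distrib_right subst_poly_sum subst_poly_var_mult \<sigma>_V)
  then show ?case using Suc by (simp add: mult.assoc)
qed simp

lemma monomial_value_homogeneous:
  "monomial_value \<sigma> n \<in> (homogeneous V (total_degree_monom n) :: ('a, 'k::field) mpoly set)"
proof -
  have s: "\<sigma> v \<in> (homogeneous V 1 :: ('a, 'k) mpoly set)" for v
    by (auto simp: \<sigma>_def var_def intro: homogeneous_single)
  have "(\<Prod>v\<in>A. \<sigma> v ^ lookup n v) \<in> (homogeneous V (\<Sum>v\<in>A. lookup n v) :: ('a, 'k) mpoly set)"
    if "finite A" for A
    using that
  proof (induction A rule: finite_induct)
    case empty
    show ?case using homogeneous_power[OF s, of undefined 0] by simp
  next
    case (insert x A)
    then show ?case using homogeneous_mult[OF homogeneous_power[OF s] insert.IH] by simp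
  qed
  then show ?thesis by (simp add: monomial_value_def total_degree_monom_def)
qed

lemma subst_homogeneous:
  "f \<in> homogeneous E i \<Longrightarrow> subst_poly \<sigma> f \<in> (homogeneous V i :: ('a, 'k::field) mpoly set)"
  unfolding subst_poly_def
  by (intro homogeneous_sum homogeneous_const_mult)
    (metis homogeneous_iff monomial_value_homogeneous)

lemma prod_\<sigma>_circuit: "v \<in> V \<Longrightarrow> (\<Prod>e\<in>circuit v. \<sigma> e) = (var v ^ card (circuit v) :: ('a, 'k::field) mpoly)"
proof -
  have "(\<Prod>e\<in>circuit v. \<sigma> e) = (\<Prod>e\<in>circuit v. var v :: ('a, 'k) mpoly)"
    by (rule prod.cong) (auto simp: circuit_def \<sigma>_def)
  then show ?thesis by simp
qed

lemma var_power: "var v ^ k = single (single v k) 1"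
  by (induction k) (simp_all add: var_def mult_single flip: single_add)

lemma vanishes_var_power_mult:
  "v \<in> V \<Longrightarrow> vanishes_below V (\<lambda>v. card (circuit v)) (lookup (var v ^ card (circuit v) * f))"
  unfolding vanishes_below_def var_power lookup_single_mult
  by (auto simp: lookup_single when_def split: if_splits dest!: bspec)

text \<open>A minimal nonface inside \<open>E\<close> is a circuit, whose monomial becomes a power
  of one variable with the circuit size as exponent. Variables outside \<open>E\<close> become
  zero.\<close>

lemma subst_nonface:
  assumes n: "keys n \<notin> D"
  shows "vanishes_below V (\<lambda>v. card (circuit v)) (lookup (subst_poly \<sigma> (single n c) :: ('a, 'k::field) mpoly))"
proof (cases "keys n \<subseteq> E")
  case False
  then obtain v where v: "v \<in> keys n" "v \<notin> E" by blast
  then have "\<sigma> v ^ lookup n v = (0 :: ('a, 'k) mpoly)" using M_sub by (auto simp: \<sigma>_def in_keys_iff zero_power)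
  then have "monomial_value \<sigma> n = (0 :: ('a, 'k) mpoly)"
    unfolding monomial_value_def using v(1) by (intro prod_zero) auto
  then show ?thesis by (simp add: subst_poly_single vanishes_below_def)
next
  case True
  then obtain v where v: "v \<in> V" "circuit v \<subseteq> keys n" using n by (auto simp: D_eq circuit_def)
  note m = lookup_mon_of[OF finite_circuit]
  have "mon_of (circuit v) + (n - mon_of (circuit v)) = n"
    using v(2) add_eq_iff_diff[of "mon_of (circuit v)" "n - mon_of (circuit v)" n]
    by (auto simp: m in_keys_iff Suc_le_eq)
  then have "monomial_value \<sigma> n =
      monomial_value \<sigma> (mon_of (circuit v)) * (monomial_value \<sigma> (n - mon_of (circuit v)) :: ('a, 'k) mpoly)"
    by (metis monomial_value_add)
  also have "monomial_value \<sigma> (mon_of (circuit v)) = (var v ^ card (circuit v) :: ('a, 'k) mpoly)"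
    unfolding prod_\<sigma>_circuit[OF v(1), symmetric] monomial_value_def keys_mon_of[OF finite_circuit]
    by (intro prod.cong) (simp_all add: m)
  finally have "subst_poly \<sigma> (single n c) =
      var v ^ card (circuit v) * (const c * monomial_value \<sigma> (n - mon_of (circuit v)) :: ('a, 'k) mpoly)"
    by (simp add: subst_poly_single mult.left_commute)
  then show ?thesis using vanishes_var_power_mult[OF v(1)] by metis
qed

text \<open>Each of the \<open>r\<close> elements outside \<open>V\<close> gives one parameter: its
  variable, minus that of its representative if it lies in \<open>M\<close>. This leaves the
  polynomials in \<open>V\<close> modulo the powers given by the circuit sizes, with top degree
  \<open>card M - card V\<close>.\<close>

lemma good_point_exists:
  assumes t: "t + card V \<le> card M"
  shows "(good_points E D r t :: ('a \<times> nat \<Rightarrow> 'k::field_char_0) set) \<noteq> {}"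
proof -
  have VE: "V \<subseteq> E" using V_sub M_sub by blast
  have "card (E - V) = r" using card_E finite_V VE by (simp add: card_Diff_subset)
  then obtain b where b: "bij_betw b {..<r} (E - V)"
    using ex_bij_betw_nat_finite[of "E - V"] finite_E unfolding atLeast0LessThan by auto
  define p :: "'a \<times> nat \<Rightarrow> 'k" where "p = (\<lambda>x. if x \<in> E \<times> {..r} then
      (case x of (e, l) \<Rightarrow> if l = r then (if e \<in> V then 1 else 0)
        else if e = b l then 1 else if b l \<in> M \<and> e = \<tau> (b l) then - 1 else 0) else undefined)"
  have p_l: "p (e, l) = (if e = b l then 1 else if b l \<in> M \<and> e = \<tau> (b l) then - 1 else 0)"
    if "e \<in> E" "l < r" for e l using that by (simp add: p_def)
  have p_r: "p (e, r) = (if e \<in> V then 1 else 0)" if "e \<in> E" for e using that by (simp add: p_def)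
  have bE: "b l \<in> E - V" if "l < r" for l using b that by (auto simp: bij_betw_def)
  have form: "(\<Sum>e\<in>E. p (e, l) * x e) = x (b l) - (if b l \<in> M then x (\<tau> (b l)) else 0)"
    if l: "l < r" for l and x :: "'a \<Rightarrow> 'k"
  proof -
    have ne: "\<tau> (b l) \<noteq> b l" if "b l \<in> M" using bE[OF l] that by (metis DiffD2 imageI)
    have "(\<Sum>e\<in>E. p (e, l) * x e) =
        (\<Sum>e\<in>E. (if e = b l then x e else 0) - (if e = \<tau> (b l) then (if b l \<in> M then x e else 0) else 0))"
      using ne by (intro sum.cong) (auto simp: p_l[OF _ l])
    also have "\<dots> = x (b l) - (if b l \<in> M then x (\<tau> (b l)) else 0)"
      unfolding sum_subtractf using finite_E bE[OF l] \<tau>_in M_sub by auto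
    finally show ?thesis .
  qed
  have T: "one_form E (\<lambda>e. p (e, l)) = var (b l) - \<sigma> (b l)" if l: "l < r" for l
  proof -
    have ne: "\<tau> (b l) \<noteq> b l" if "b l \<in> M" using bE[OF l] that by (metis DiffD2 imageI)
    have "one_form E (\<lambda>e. p (e, l)) =
        (\<Sum>e\<in>E. (if e = b l then var e else 0) - (if e = \<tau> (b l) then (if b l \<in> M then var e else 0) else 0))"
      unfolding one_form_def using ne by (intro sum.cong) (auto simp: p_l[OF _ l] const_minus)
    also have "\<dots> = var (b l) - \<sigma> (b l)"
      unfolding sum_subtractf \<sigma>_def using finite_E bE[OF l] \<tau>_in M_sub by auto
    finally show ?thesis .
  qed
  have \<Omega>: "point_form E r p = one_form V (\<lambda>_. 1)"
  proof -
    have "point_form E r p = (\<Sum>e\<in>E. if e \<in> V then var e else 0)"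
      unfolding point_form_def one_form_def by (intro sum.cong) (auto simp: p_r)
    also have "\<dots> = (\<Sum>e\<in>V. var e)"
      using VE finite_E by (simp add: sum.inter_restrict[symmetric] Int_absorb1)
    finally show ?thesis by (simp add: one_form_def)
  qed
  let ?J = "point_ideal E D r p"
  \<comment> \<open>A dependence \<open>c\<close>, extended by zero off \<open>F\<close>, is
    constant along each circuit and zero on cone points. A face omits an element of every circuit,
    so the constant is zero.\<close>
  have \<theta>: "is_lsop D r (\<lambda>i e. p (e, i))"
    unfolding is_lsop_def
  proof (intro ballI allI impI)
    fix F c e assume F: "F \<in> D" and c: "\<forall>i<r. (\<Sum>e\<in>F. c e * p (e, i)) = 0" and e: "e \<in> F"
    define x where "x e = (if e \<in> F then c e else 0)" for e
    have FE: "F \<subseteq> E" using F by (simp add: D_eq)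
    have x: "x (b l) = (if b l \<in> M then x (\<tau> (b l)) else 0)" if "l < r" for l
    proof -
      have "(\<Sum>e\<in>E. p (e, l) * x e) = (\<Sum>e\<in>F. p (e, l) * x e)"
        using FE finite_E by (intro sum.mono_neutral_right) (auto simp: x_def)
      also have "\<dots> = (\<Sum>e\<in>F. c e * p (e, l))" by (intro sum.cong) (auto simp: x_def mult.commute)
      finally show ?thesis using form[OF that, of x] c that by simp
    qed
    have x': "x a = (if a \<in> M then x (\<tau> a) else 0)" if a: "a \<in> E - V" for a
    proof -
      have "a \<in> b ` {..<r}" using b a by (simp add: bij_betw_def)
      then obtain l where "l < r" "a = b l" by blast
      then show ?thesis using x by simp
    qed
    have xV: "x v = 0" if v: "v \<in> V" for v
    proof -
      obtain z where z: "z \<in> M" "\<tau> z = v" "z \<notin> F" using F v by (auto simp: D_eq)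
      show ?thesis
      proof (cases "z \<in> V")
        case True
        have "z = v" using z(2) \<tau>_V[OF True] by simp
        then show ?thesis using z(3) by (simp add: x_def)
      next
        case False
        then have "z \<in> E - V" using z(1) M_sub by blast
        from x'[OF this] show ?thesis using z by (simp add: x_def)
      qed
    qed
    have "x e = 0"
    proof (cases "e \<in> V")
      case False
      then have "e \<in> E - V" using e FE by blast
      from x'[OF this] show ?thesis using xV by (cases "e \<in> M") auto
    qed (rule xV)
    then show "c e = 0" using e by (simp add: x_def)
  qed
  have var\<sigma>: "var v - \<sigma> v \<in> ?J" for v
  proof -
    consider "v \<in> V" | "v \<in> E - V" | "v \<notin> E" by blast
    then show ?thesis
    proof cases
      case 1
      then show ?thesis by (simp add: \<sigma>_V point_ideal_def)
    next
      case 2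
      then have "v \<in> b ` {..<r}" using b by (simp add: bij_betw_def)
      then obtain l where l: "l < r" "v = b l" by blast
      show ?thesis
        using generator_rel_ideal[OF l(1), of "\<lambda>l. one_form E (\<lambda>e. p (e, l))" D] l
        by (simp add: T point_ideal_def)
    next
      case 3
      then have "{v} \<notin> D" by (auto simp: D_eq)
      then have "(var v :: ('a, 'k) mpoly) \<in> nonface_ideal D" by (simp add: nonface_ideal_def var_def)
      moreover have "\<sigma> v = (0 :: ('a, 'k) mpoly)" using 3 M_sub by (auto simp: \<sigma>_def)
      ultimately show ?thesis by (simp add: nonface_rel_ideal point_ideal_def)
    qed
  qed
  note J_add = rel_ideal_add[where D = D and r = r and T = "\<lambda>l. one_form E (\<lambda>e. p (e, l))", folded point_ideal_def]
    and J_diff =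
        rel_ideal_diff[where D = D and r = r and T = "\<lambda>l. one_form E (\<lambda>e. p (e, l))", folded point_ideal_def]
    and J_mult =
        rel_ideal_mult[where D = D and r = r and T = "\<lambda>l. one_form E (\<lambda>e. p (e, l))", folded point_ideal_def, OF down_closed_D]
  have subst_mono: "single n c - subst_poly \<sigma> (single n c) \<in> ?J" for n c
  proof (induction "total_degree_monom n" arbitrary: n)
    case 0
    then have "n = 0"
      by (intro poly_mapping_eqI) (auto simp: total_degree_monom_def in_keys_iff)
    then show ?case by (simp add: subst_poly_single monomial_value_def const_def point_ideal_def)
  next
    case (Suc i)
    then obtain v where v: "v \<in> keys n" by (metis all_not_in_conv keys_eq_empty nat.distinct(1) total_degree_zero)
    let ?a = "single (n - single v 1) c"
    have "i = total_degree_monom (n - single v 1)"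
      using Suc.hyps(2) diff_single_add[OF v] total_degree_add[of "single v 1" "n - single v 1"] by simp
    then have IH: "?a - subst_poly \<sigma> ?a \<in> ?J" by (rule Suc.hyps(1))
    have n: "single n c = var v * ?a"
      using diff_single_add[OF v] by (simp add: var_def mult_single)
    have "single n c - subst_poly \<sigma> (single n c) =
        var v * (?a - subst_poly \<sigma> ?a) + subst_poly \<sigma> ?a * (var v - \<sigma> v)"
      unfolding n subst_poly_var_mult by (simp add: algebra_simps)
    then show ?case using J_add[OF J_mult[OF IH] J_mult[OF var\<sigma>]] by simp
  qed
  have subst_cong: "f - subst_poly \<sigma> f \<in> ?J" for f
  proof (induction f rule: mpoly_induct)
    case (add m c f)
    from J_add[OF subst_mono add] show ?case by (simp add: subst_poly_add algebra_simps)
  qed (simp add: point_ideal_def)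
  \<comment> \<open>The substitution kills the parameters, because \<sigma> fixes its own values,
    and sends the face ideal into the ideal of powers; with the converse \<open>van_J\<close> this
    identifies the two quotients.\<close>
  have subst_J: "vanishes_below V (\<lambda>v. card (circuit v)) (lookup (subst_poly \<sigma> f))" if f: "f \<in> ?J" for f
  proof -
    obtain g where g: "f - (\<Sum>l<r. one_form E (\<lambda>e. p (e, l)) * g l) \<in> nonface_ideal D"
      using f unfolding point_ideal_def by (rule rel_idealE)
    let ?h = "f - (\<Sum>l<r. one_form E (\<lambda>e. p (e, l)) * g l)"
    have "subst_poly \<sigma> (one_form E (\<lambda>e. p (e, l)) * g l) = 0" if "l < r" for l
    proof -
      have "subst_poly \<sigma> (\<sigma> (b l) * g l) = \<sigma> (b l) * subst_poly \<sigma> (g l)"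
        using \<tau>_in \<tau>_idem by (auto simp: \<sigma>_def subst_poly_var_mult)
      then show ?thesis
        by (simp add: T[OF that] left_diff_distrib subst_poly_diff subst_poly_var_mult)
    qed
    then have "subst_poly \<sigma> f = subst_poly \<sigma> ?h" by (simp add: subst_poly_diff subst_poly_sum)
    also have "\<dots> = (\<Sum>n\<in>keys ?h. subst_poly \<sigma> (single n (lookup ?h n)))"
      by (simp add: subst_poly_def[of \<sigma> ?h] subst_poly_single)
    finally have *: "subst_poly \<sigma> f = (\<Sum>n\<in>keys ?h. subst_poly \<sigma> (single n (lookup ?h n)))" .
    have "vanishes_below V (\<lambda>v. card (circuit v)) (lookup (subst_poly \<sigma> (single n (lookup ?h n))))"
      if "n \<in> keys ?h" for n
      using g that by (intro subst_nonface) (auto simp: nonface_ideal_def)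
    then show ?thesis unfolding * vanishes_below_def lookup_sum by simp
  qed
  \<comment> \<open>The monomial of a circuit lies in the face ideal and is congruent to its image
    under the substitution, which is this power.\<close>
  have power_J: "var v ^ card (circuit v) \<in> ?J" if v: "v \<in> V" for v
  proof -
    let ?x = "\<Prod>e\<in>circuit v. var e :: ('a, 'k) mpoly"
    have x: "?x = single (mon_of (circuit v)) 1" by (rule prod_var[OF finite_circuit])
    have "?x \<in> nonface_ideal D"
      unfolding x nonface_ideal_def using circuit_nonface[OF v] by (simp add: keys_mon_of[OF finite_circuit])
    then have xJ: "?x \<in> ?J" unfolding point_ideal_def by (rule nonface_rel_ideal)
    have "subst_poly \<sigma> ?x = (\<Prod>e\<in>circuit v. \<sigma> e)"
      unfolding x subst_poly_single monomial_value_def keys_mon_of[OF finite_circuit]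
      by (simp add: lookup_mon_of[OF finite_circuit])
    then show ?thesis
      using J_diff[OF xJ subst_cong[of ?x]] by (simp add: prod_\<sigma>_circuit[OF v])
  qed
  have van_J: "f \<in> ?J" if f: "vanishes_below V (\<lambda>v. card (circuit v)) (lookup f)" for f
  proof -
    have "single n (lookup f n) \<in> ?J" if n: "n \<in> keys f" for n
    proof -
      obtain v where v: "v \<in> V" "card (circuit v) \<le> lookup n v"
        using f n unfolding vanishes_below_def in_keys_iff by (meson not_less)
      have "single v (card (circuit v)) + (n - single v (card (circuit v))) = n"
        using v(2) add_eq_iff_diff[of "single v (card (circuit v))" "n - single v (card (circuit v))" n]
        by (simp add: lookup_single when_def)
      then have "single n (lookup f n) =
          single (n - single v (card (circuit v))) (lookup f n) * var v ^ card (circuit v)"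
        by (simp add: var_power mult_single add.commute)
      then show ?thesis using J_mult[OF power_J[OF v(1)]] by simp
    qed
    then have "(\<Sum>n\<in>keys f. single n (lookup f n)) \<in> ?J"
      unfolding point_ideal_def by (rule rel_ideal_sum)
    then show ?thesis using poly_sum_monomials[of f] by simp
  qed
  have "lefschetz E ?J (point_form E r p) t"
    unfolding lefschetz_def \<Omega>
  proof (intro allI impI)
    fix i k f assume ik: "2 * i + k \<le> t" and f: "f \<in> homogeneous E i" "one_form V (\<lambda>_. 1) ^ k * f \<in> ?J"
    have "t \<le> (\<Sum>v\<in>V. card (circuit v) - 1)" using t sum_circuits by simp
    then have ik': "2 * i + k \<le> (\<Sum>v\<in>V. card (circuit v) - 1)" using ik by simp
    have "vanishes_below V (\<lambda>v. card (circuit v)) (lookup (subst_poly \<sigma> f))"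
      using subst_J[OF f(2)] circuit_card unfolding subst_sum_form
      by (intro complete_intersection_lefschetz[OF finite_V _ subst_homogeneous[OF f(1)] ik'])
    then have "subst_poly \<sigma> f \<in> ?J" by (rule van_J)
    from J_add[OF subst_cong[of f] this] show "f \<in> ?J" by simp
  qed
  moreover have "p \<in> affine_space (E \<times> {..r})"
    by (simp add: affine_space_def PiE_def extensional_def p_def)
  ultimately have "p \<in> good_points E D r t" using \<theta> by (simp add: good_points_def)
  then show ?thesis by blast
qed

end

section \<open>Existence of good points\<close>

lemma (in matroid_complex) card_cone_points_le: "card (cone_points E D r) \<le> r"
proof -
  obtain B where B: "B \<in> D" "card B = r" using facet_exists by blast
  then have "cone_points E D r \<subseteq> B" by (auto simp: cone_points_def)
  then show ?thesis using card_mono[OF face_finite[OF B(1)]] B(2) by metis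
qed

text \<open>The classes are the circuits of a direct sum, and \<tau> picks an element of each. By
  the count of classes its top degree is \<open>r\<close> minus the number of cone points.\<close>

lemma (in matroid_complex) dependent_good_points:
  assumes dep: "\<And>S. series_class E D r S \<Longrightarrow> S \<notin> D"
    and t: "t + card (cone_points E D r) \<le> r"
  shows "(good_points E D r t :: ('a \<times> nat \<Rightarrow> 'k::field_char_0) set) \<noteq> {}"
proof -
  let ?P = "{S. series_class E D r S}"
  let ?M = "E - cone_points E D r"
  define cls where "cls e = (THE S. series_class E D r S \<and> e \<in> S)" for e
  define \<tau> where "\<tau> e = (SOME x. x \<in> cls e)" for e
  have cls: "cls e = S" if "series_class E D r S" "e \<in> S" for e S
    unfolding cls_def using that series_class_disjoint by (intro the_equality) blast+
  have clsM: "series_class E D r (cls e) \<and> e \<in> cls e" if "e \<in> ?M" for e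
    using series_class_exists[OF that] cls by metis
  have \<tau>_cls: "\<tau> e \<in> cls e" if "e \<in> ?M" for e
    unfolding \<tau>_def using clsM[OF that] by (metis someI)
  have sub: "S \<subseteq> ?M" if "series_class E D r S" for S
    using that by (auto simp: series_class_def series_def)
  have cls_\<tau>: "cls (\<tau> e) = cls e" if "e \<in> ?M" for e
    using cls clsM[OF that] \<tau>_cls[OF that] by blast
  have \<tau>M: "\<tau> e \<in> ?M" if "e \<in> ?M" for e
    using \<tau>_cls[OF that] clsM[OF that] sub by blast
  have fib: "{x \<in> ?M. \<tau> x = \<tau> e} = cls e" if e: "e \<in> ?M" for e
  proof (intro equalityI subsetI)
    fix x assume "x \<in> {x \<in> ?M. \<tau> x = \<tau> e}"
    then have x: "x \<in> ?M" "\<tau> x = \<tau> e" by blast+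
    have "cls x = cls (\<tau> x)" by (rule cls_\<tau>[OF x(1), symmetric])
    also have "\<dots> = cls e" unfolding x(2) by (rule cls_\<tau>[OF e])
    finally show "x \<in> cls e" using clsM[OF x(1)] by simp
  next
    fix x assume x: "x \<in> cls e"
    then have "x \<in> ?M" "cls x = cls e" using clsM[OF e] sub[of "cls e"] cls[of "cls e" x] by blast+
    then show "x \<in> {x \<in> ?M. \<tau> x = \<tau> e}" by (simp add: \<tau>_def)
  qed
  have classes: "{S. series_class E D r S} = cls ` ?M"
  proof (intro equalityI subsetI)
    fix S assume "S \<in> {S. series_class E D r S}"
    then have S: "series_class E D r S" by simp
    then obtain e where "e \<in> S" by (auto simp: series_class_def series_def)
    then show "S \<in> cls ` ?M" using cls[OF S] sub[OF S] by blast
  qed (use clsM in blast)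
  have "bij_betw (\<lambda>v. cls v) (\<tau> ` ?M) (cls ` ?M)"
  proof (rule bij_betw_imageI)
    show "inj_on cls (\<tau> ` ?M)"
    proof (rule inj_onI)
      fix v w assume "v \<in> \<tau> ` ?M" "w \<in> \<tau> ` ?M" and eq: "cls v = cls w"
      then obtain x y where xy: "x \<in> ?M" "v = \<tau> x" "y \<in> ?M" "w = \<tau> y" by blast
      have "cls x = cls y" using eq cls_\<tau>[OF xy(1)] cls_\<tau>[OF xy(3)] xy(2,4) by simp
      then show "v = w" unfolding xy(2,4) \<tau>_def by simp
    qed
    show "cls ` \<tau> ` ?M = cls ` ?M" unfolding image_image by (intro image_cong refl cls_\<tau>)
  qed
  then have cardP: "card (\<tau> ` ?M) = card ?P" unfolding classes by (rule bij_betw_same_card)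
  have "circuit_sum E ?M \<tau> D r"
  proof
    show "finite E" by (rule finite_ground)
    show "\<tau> (\<tau> e) = \<tau> e" if "e \<in> ?M" for e
    proof -
      have "\<tau> x = (SOME y. y \<in> cls x)" for x by (simp add: \<tau>_def)
      then show ?thesis using cls_\<tau>[OF that] by simp
    qed
    show "card E = r + card (\<tau> ` ?M)" using card_dependent_classes[OF dep] cardP by simp
    show "D = {F. F \<subseteq> E \<and> (\<forall>v\<in>\<tau> ` ?M. \<not> {e \<in> ?M. \<tau> e = v} \<subseteq> F)}"
    proof -
      have "(\<forall>v\<in>\<tau> ` ?M. \<not> {e \<in> ?M. \<tau> e = v} \<subseteq> F) \<longleftrightarrow> (\<forall>S\<in>?P. \<not> S \<subseteq> F)" for F
        unfolding classes using fib by simp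
      then show ?thesis using faces_of_dependent_classes[OF dep] by simp
    qed
  qed (use \<tau>M in auto)
  moreover have "t + card (\<tau> ` ?M) \<le> card ?M"
  proof -
    have "cone_points E D r \<subseteq> E" by (auto simp: cone_points_def)
    then have "card ?M + card (cone_points E D r) = card E"
      using finite_ground by (metis card_Diff_subset card_mono finite_subset le_add_diff_inverse2)
    then show ?thesis using t card_dependent_classes[OF dep] cardP by simp
  qed
  ultimately show ?thesis by (rule circuit_sum.good_point_exists)
qed

text \<open>If a power of \<omega> kills \<open>f\<close>, then \<open>f\<close> vanishes on the
  avoiding end, so it is congruent to the monomial of \<open>S\<close> times some \<open>h\<close>.
  The colon property moves the annihilation to the star, where \<open>h\<close> sits in degree
  \<open>i - card S\<close>.\<close>

lemma (in matroid_complex) good_points_step: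
  fixes p :: "'a \<times> nat \<Rightarrow> 'k::field_char_0"
  assumes S: "S \<in> D" "series E D r S"
    and st: "p \<in> good_points E (star D S) r (t - card S)"
    and av: "p \<in> good_points E (avoiding D S) r t"
  shows "p \<in> good_points E D r t"
proof -
  note fin = series_finite[OF S(2)]
  let ?x = "\<Prod>e\<in>S. var e :: ('a, 'k) mpoly" and ?\<omega> = "point_form E r p"
  have lst: "is_lsop (star D S) r (\<lambda>i e. p (e, i))" and lav: "is_lsop (avoiding D S) r (\<lambda>i e. p (e, i))"
    using st av by (simp_all add: good_points_def)
  \<comment> \<open>Faces containing \<open>S\<close> lie in the star and all others avoid
    \<open>S\<close>, so the l.s.o.p. condition can be tested on both ends.\<close>
  have "D = star D S \<union> avoiding D S"
    using star_subset[OF down_closed_faces, of S] by (auto simp: avoiding_def star_def Un_absorb2)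
  then have lsop: "is_lsop D r (\<lambda>i e. p (e, i))"
    using lst lav unfolding is_lsop_def by blast
  have kos: "koszul (avoiding D S) r (\<lambda>l. one_form E (\<lambda>e. p (e, l)))"
    using koszul_and_basis[OF matroid_complex_avoiding[OF S(2)], where ?'k = 'k] lav by blast
  have Lst: "lefschetz E (point_ideal E (star D S) r p) ?\<omega> (t - card S)"
    and Lav: "lefschetz E (point_ideal E (avoiding D S) r p) ?\<omega> t"
    using st av by (simp_all add: good_points_def)
  have "lefschetz E (point_ideal E D r p) ?\<omega> t"
    unfolding lefschetz_def
  proof (intro allI impI)
    fix i k f assume ik: "2 * i + k \<le> t" and f: "f \<in> homogeneous E i" "?\<omega> ^ k * f \<in> point_ideal E D r p"
    note J_add = rel_ideal_add[where D = D and r = r and T = "\<lambda>l. one_form E (\<lambda>e. p (e, l))", folded point_ideal_def]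
      and J_diff =
        rel_ideal_diff[where D = D and r = r and T = "\<lambda>l. one_form E (\<lambda>e. p (e, l))", folded point_ideal_def]
      and J_mult =
        rel_ideal_mult[where D = D and r = r and T = "\<lambda>l. one_form E (\<lambda>e. p (e, l))", folded point_ideal_def, OF down_closed_faces]
    have "?\<omega> ^ k * f \<in> point_ideal E (avoiding D S) r p"
      using f(2) rel_ideal_mono[OF avoiding_subset] unfolding point_ideal_def by blast
    then have "f \<in> point_ideal E (avoiding D S) r p"
      using Lav ik f(1) unfolding lefschetz_def by blast
    then obtain h where "f - ?x * h \<in> point_ideal E D r p"
      unfolding point_ideal_def by (rule rel_ideal_avoiding[OF fin])
    then have "hpart E i (f - ?x * h) \<in> point_ideal E D r p"
      unfolding point_ideal_def by (intro rel_ideal_hpart) auto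
    moreover have "S \<subseteq> E" using S(1) indep_ground by blast
    ultimately have fx: "f - (if card S \<le> i then ?x * hpart E (i - card S) h else 0) \<in> point_ideal E D r p"
      using hpart_id[OF f(1)] by (simp add: hpart_diff hpart_prod_var_mult[OF finite_ground])
    show "f \<in> point_ideal E D r p"
    proof (cases "card S \<le> i")
      case False
      then show ?thesis using fx by simp
    next
      case True
      let ?h = "hpart E (i - card S) h"
      have fx: "f - ?x * ?h \<in> point_ideal E D r p" using fx True by simp
      from J_diff[OF f(2) J_mult[OF this, of "?\<omega> ^ k"]]
      have "?x * (?\<omega> ^ k * ?h) \<in> point_ideal E D r p" by (simp add: algebra_simps)
      then have "?\<omega> ^ k * ?h \<in> point_ideal E (star D S) r p"
        unfolding point_ideal_def by (rule rel_ideal_colon[OF down_closed_faces fin kos])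
      \<comment> \<open>The left side falls by \<open>2 * card S\<close>, the bound only by
        \<open>card S\<close>.\<close>
      moreover have "2 * (i - card S) + k \<le> t - card S" using ik True by simp
      ultimately have "?h \<in> point_ideal E (star D S) r p"
        using Lst hpart_homogeneous unfolding lefschetz_def by blast
      then have "?x * ?h \<in> point_ideal E D r p"
        unfolding point_ideal_def by (rule rel_ideal_star_mult[OF fin])
      from J_add[OF fx this] show ?thesis by simp
    qed
  qed
  with lsop av show ?thesis by (simp add: good_points_def)
qed

theorem good_points_nonempty:
  assumes "matroid_complex E D r" "t + card (cone_points E D r) \<le> r"
  shows "(good_points E D r t :: ('a \<times> nat \<Rightarrow> 'k::field_char_0) set) \<noteq> {}"
  using assms
proof (induction D arbitrary: t rule: series_class_induct)
  case (dependent D)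
  then show ?case by (intro matroid_complex.dependent_good_points) auto
next
  case (step D S)
  interpret matroid_complex E D r by (rule step.hyps)
  have ser: "series E D r S" using step.hyps by (simp add: series_class_def)
  interpret st: matroid_complex E "star D S" r by (rule matroid_complex_star[OF step.hyps(2)])
  interpret av: matroid_complex E "avoiding D S" r by (rule matroid_complex_avoiding[OF ser])
  have finc: "finite (cone_points E D r)"
    using finite_ground by (rule finite_subset[rotated]) (auto simp: cone_points_def)
  have "S \<inter> cone_points E D r = {}" using ser by (simp add: series_def)
  then have "card (cone_points E (star D S) r) = card (cone_points E D r) + card S"
    unfolding cone_points_star[OF step.hyps(2)] using finc series_finite[OF ser]
    by (intro card_Un_disjoint) auto
  \<comment> \<open>The subtraction truncates when \<open>t < card S\<close>; the bound on the cone
    points of the star covers this case.\<close>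
  then have "t - card S + card (cone_points E (star D S) r) \<le> r"
    using st.card_cone_points_le step.prems by linarith
  then have ne1: "(good_points E (star D S) r (t - card S) :: ('a \<times> nat \<Rightarrow> 'k) set) \<noteq> {}"
    by (rule step.IH(1))
  have "card (cone_points E (avoiding D S) r) \<le> card (cone_points E D r)"
    using cone_points_avoiding[OF step.hyps(3)] finc by (intro card_mono)
  then have ne2: "(good_points E (avoiding D S) r t :: ('a \<times> nat \<Rightarrow> 'k) set) \<noteq> {}"
    using step.prems by (intro step.IH(2)) simp
  obtain p :: "'a \<times> nat \<Rightarrow> 'k" where
    "p \<in> good_points E (star D S) r (t - card S) \<inter> good_points E (avoiding D S) r t"
    using zariski_open_Int_nonempty[OF st.good_points_open av.good_points_open ne1 ne2] by blast
  then show ?case using good_points_step[OF step.hyps(2) ser] by blast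
qed

section \<open>The face ring and its reduction\<close>

lemma poly_ring_simps [simp]:
  "carrier (poly_ring V) = polys_in V" "f \<otimes>\<^bsub>poly_ring V\<^esub> g = f * g" "\<one>\<^bsub>poly_ring V\<^esub> = 1"
  "\<zero>\<^bsub>poly_ring V\<^esub> = 0" "f \<oplus>\<^bsub>poly_ring V\<^esub> g = f + g"
  by (simp_all add: poly_ring_def)

lemma ideal_poly_ringI:
  fixes I :: "('v, 'k::field) mpoly set"
  assumes "I \<subseteq> polys_in V" "0 \<in> I" and add: "\<And>f g. f \<in> I \<Longrightarrow> g \<in> I \<Longrightarrow> f + g \<in> I"
    and mult: "\<And>f g. f \<in> I \<Longrightarrow> g \<in> polys_in V \<Longrightarrow> g * f \<in> I"
  shows "ideal I (poly_ring V)"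
proof (rule idealI)
  interpret cring "poly_ring V :: ('v, 'k) mpoly ring" by (rule cring_poly_ring)
  show "ring (poly_ring V :: ('v, 'k) mpoly ring)" by (rule ring_axioms)
  have neg: "- f \<in> I" if "f \<in> I" for f
    using mult[OF that, of "- 1"] by (simp add: polys_in_uminus)
  show "subgroup I (add_monoid (poly_ring V))"
  proof (rule add.subgroupI)
    show "\<ominus>\<^bsub>poly_ring V\<^esub> f \<in> I" if "f \<in> I" for f
    proof -
      have "\<ominus>\<^bsub>poly_ring V\<^esub> f = - f"
        using that assms(1) neg by (intro minus_equality) auto
      then show ?thesis using neg[OF that] by simp
    qed
  qed (use assms in auto)
qed (use mult in \<open>auto simp: mult.commute\<close>)

lemma ideal_poly_ring_sum:
  fixes I :: "('v, 'k::field) mpoly set"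
  assumes "ideal I (poly_ring V)" "\<And>x. x \<in> A \<Longrightarrow> f x \<in> I"
  shows "sum f A \<in> I"
proof -
  note sub = ideal.axioms(1)[OF assms(1)]
  have "0 \<in> I" using additive_subgroup.zero_closed[OF sub] by simp
  moreover have "g + h \<in> I" if "g \<in> I" "h \<in> I" for g h
    using additive_subgroup.a_closed[OF sub that] by simp
  ultimately show ?thesis using assms(2)
    by (induction A rule: infinite_finite_induct) auto
qed

context
  fixes E :: "'a set" and D :: "'a set set"
  assumes finE: "finite E" and down: "down_closed D" and sub: "D \<subseteq> Pow E"
begin

text \<open>A monomial with nonface support is a multiple of the squarefree monomial of that
  support, which is one of the generators.\<close>

lemma face_ideal_eq:
  "face_ideal E D = (polys_in E \<inter> nonface_ideal D :: ('a, 'k::field) mpoly set)"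
proof (intro equalityI subsetI)
  interpret cring "poly_ring E :: ('a, 'k) mpoly ring" by (rule cring_poly_ring)
  let ?S = "{\<Prod>e\<in>A. var e | A. A \<subseteq> E \<and> A \<notin> D} :: ('a, 'k) mpoly set"
  let ?I = "polys_in E \<inter> nonface_ideal D :: ('a, 'k) mpoly set"
  have "ideal ?I (poly_ring E)"
    by (rule ideal_poly_ringI) (auto intro: polys_in_add polys_in_mult nonface_ideal_add nonface_ideal_mult[OF down])
  moreover have "?S \<subseteq> ?I"
  proof clarify
    fix A assume A: "A \<subseteq> E" "A \<notin> D"
    have "finite A" using A(1) finE finite_subset by blast
    then have "(\<Prod>e\<in>A. var e :: ('a, 'k) mpoly) \<in> nonface_ideal D"
      using A(2) by (simp add: prod_var nonface_ideal_def keys_mon_of)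
    moreover have "(\<Prod>e\<in>A. var e :: ('a, 'k) mpoly) \<in> polys_in E"
      using A(1) by (intro polys_in_prod var_in) auto
    ultimately show "(\<Prod>e\<in>A. var e) \<in> ?I" by blast
  qed
  ultimately show "f \<in> ?I" if "f \<in> face_ideal E D" for f :: "('a, 'k) mpoly"
    using genideal_minimal that unfolding face_ideal_def by blast
next
  fix f :: "('a, 'k) mpoly" assume f: "f \<in> polys_in E \<inter> nonface_ideal D"
  interpret cring "poly_ring E :: ('a, 'k) mpoly ring" by (rule cring_poly_ring)
  interpret I: ideal "face_ideal E D" "poly_ring E :: ('a, 'k) mpoly ring" by (rule ideal_face_ideal)
  have "single n (lookup f n) \<in> face_ideal E D" if n: "n \<in> keys f" for n
  proof -
    let ?x = "\<Prod>e\<in>keys n. var e :: ('a, 'k) mpoly"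
    have nE: "keys n \<subseteq> E" "keys n \<notin> D" using f n by (auto simp: polys_in_def nonface_ideal_def)
    have S: "{\<Prod>e\<in>A. var e | A. A \<subseteq> E \<and> A \<notin> D} \<subseteq> carrier (poly_ring E :: ('a, 'k) mpoly ring)"
      by (auto intro!: polys_in_prod intro: var_in)
    have x: "?x \<in> face_ideal E D"
      unfolding face_ideal_def by (rule subsetD[OF genideal_self[OF S]]) (use nE in blast)
    have "mon_of (keys n) + (n - mon_of (keys n)) = n"
      using add_eq_iff_diff[of "mon_of (keys n)" "n - mon_of (keys n)" n]
      by (auto simp: lookup_mon_of in_keys_iff Suc_le_eq)
    then have e: "single n (lookup f n) = single (n - mon_of (keys n)) (lookup f n) * ?x"
      by (simp add: prod_var mult_single add.commute)
    have "keys (n - mon_of (keys n)) \<subseteq> E"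
      using nE(1) by (auto simp: in_keys_iff lookup_minus)
    then have "single (n - mon_of (keys n)) (lookup f n) \<in> polys_in E" by (simp add: polys_in_def)
    then show ?thesis using I.I_l_closed[OF x] unfolding e by simp
  qed
  then have "(\<Sum>n\<in>keys f. single n (lookup f n)) \<in> face_ideal E D"
    by (rule ideal_poly_ring_sum[OF ideal_face_ideal])
  then show "f \<in> face_ideal E D" using poly_sum_monomials[of f] by simp
qed

lemma poly_ring_minus: "f \<in> polys_in V \<Longrightarrow> g \<in> polys_in V \<Longrightarrow> f \<ominus>\<^bsub>poly_ring V\<^esub> g = f - g"
  for f g :: "('v, 'k::field) mpoly"
proof -
  assume fg: "f \<in> polys_in V" "g \<in> polys_in V"
  interpret cring "poly_ring V :: ('v, 'k) mpoly ring" by (rule cring_poly_ring)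
  have "\<ominus>\<^bsub>poly_ring V\<^esub> g = - g" using fg(2) by (intro minus_equality) (auto simp: polys_in_uminus)
  then show ?thesis by (simp add: a_minus_def)
qed

lemma to_face_ring_eq_iff:
  fixes f g :: "('a, 'k::field) mpoly"
  assumes "f \<in> polys_in E" "g \<in> polys_in E"
  shows "to_face_ring E D f = to_face_ring E D g \<longleftrightarrow> f - g \<in> face_ideal E D"
proof -
  interpret cring "poly_ring E :: ('a, 'k) mpoly ring" by (rule cring_poly_ring)
  show ?thesis
    using quotient_eq_iff_same_a_r_cos[OF ideal_face_ideal[of E D], of f g] assms
    by (simp add: poly_ring_minus to_face_ring_def)
qed

lemma carrier_face_ring: "carrier (face_ring E D) = to_face_ring E D ` polys_in E"
  by (auto simp: face_ring_def FactRing_def A_RCOSETS_def' to_face_ring_def)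

lemma hom_face_ring:
  "ring_hom_ring (poly_ring E) (face_ring E D) (to_face_ring E D :: ('a, 'k::field) mpoly \<Rightarrow> _)"
  by (rule ring_hom_ringI2[OF cring.axioms(1)[OF cring_poly_ring] cring.axioms(1)[OF cring_face_ring]
        to_face_ring_hom])

context
  fixes r :: nat and \<theta> :: "nat \<Rightarrow> 'a \<Rightarrow> 'k::field"
begin

abbreviation "J \<equiv> rel_ideal D r (\<lambda>l. one_form E (\<theta> l))"

text \<open>The image of \<open>polys_in E \<inter> J\<close> in the face ring is an ideal
  containing the parameters, so it contains \<open>param_ideal\<close> by minimality.\<close>

lemma param_ideal_imp_rel:
  assumes f: "f \<in> polys_in E" "to_face_ring E D f \<in> param_ideal E D r \<theta>"
  shows "f \<in> J"
proof -
  interpret R: cring "poly_ring E :: ('a, 'k) mpoly ring" by (rule cring_poly_ring)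
  interpret F: cring "face_ring E D :: ('a, 'k) mpoly set ring" by (rule cring_face_ring)
  interpret h: ring_hom_ring "poly_ring E" "face_ring E D" "to_face_ring E D :: ('a, 'k) mpoly \<Rightarrow> _"
    by (rule hom_face_ring)
  let ?I = "polys_in E \<inter> J"
  have I: "ideal ?I (poly_ring E)"
    by (rule ideal_poly_ringI) (auto intro: polys_in_add polys_in_mult rel_ideal_add rel_ideal_mult[OF down])
  let ?K = "to_face_ring E D ` ?I"
  have "ideal ?K (face_ring E D)"
  proof (rule idealI)
    show "ring (face_ring E D :: ('a, 'k) mpoly set ring)" by (rule F.ring_axioms)
    show "subgroup ?K (add_monoid (face_ring E D))"
      using I by (intro h.img_is_add_subgroup additive_subgroup.a_subgroup ideal.axioms(1))
    show *: "x \<otimes>\<^bsub>face_ring E D\<^esub> a \<in> ?K" if a: "a \<in> ?K" and x: "x \<in> carrier (face_ring E D)" for a x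
    proof -
      obtain g where g: "g \<in> ?I" "a = to_face_ring E D g" using a by blast
      obtain q where q: "q \<in> polys_in E" "x = to_face_ring E D q"
        using x unfolding carrier_face_ring by blast
      have "x \<otimes>\<^bsub>face_ring E D\<^esub> a = to_face_ring E D (q * g)"
        using h.hom_mult[of q g] g q by simp
      moreover have "q * g \<in> ?I" using g q by (auto intro: polys_in_mult rel_ideal_mult[OF down])
      ultimately show ?thesis by blast
    qed
    show "a \<otimes>\<^bsub>face_ring E D\<^esub> x \<in> ?K" if a: "a \<in> ?K" and x: "x \<in> carrier (face_ring E D)" for a x
    proof -
      have "a \<in> carrier (face_ring E D)" using a unfolding carrier_face_ring by blast
      then show ?thesis using *[OF a x] F.m_comm[OF _ x] by simp
    qed
  qed
  moreover have "{to_face_ring E D (one_form E (\<theta> i)) | i. i < r} \<subseteq> ?K"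
    using generator_rel_ideal[of _ r "\<lambda>l. one_form E (\<theta> l)" D] one_form_in by blast
  ultimately have "param_ideal E D r \<theta> \<subseteq> ?K"
    unfolding param_ideal_def by (rule F.genideal_minimal)
  then obtain g where g: "g \<in> ?I" "to_face_ring E D f = to_face_ring E D g" using f(2) by blast
  then have "f - g \<in> face_ideal E D" using to_face_ring_eq_iff[of f g] f(1) by blast
  then have "f - g \<in> J" unfolding face_ideal_eq by (blast intro: nonface_rel_ideal)
  then show ?thesis using rel_ideal_add[of "f - g" D r _ g] g(1) by simp
qed

text \<open>The cofactors in \<open>rel_ideal\<close> may involve variables outside
  \<open>E\<close>. For homogeneous \<open>f\<close> they can be replaced by their components under
  \<open>hpart\<close>, which lie in the polynomial ring on \<open>E\<close>.\<close>

lemma rel_imp_param_ideal: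
  assumes f: "f \<in> homogeneous E i" "f \<in> J"
  shows "to_face_ring E D f \<in> param_ideal E D r \<theta>"
proof -
  interpret R: cring "poly_ring E :: ('a, 'k) mpoly ring" by (rule cring_poly_ring)
  interpret F: cring "face_ring E D :: ('a, 'k) mpoly set ring" by (rule cring_face_ring)
  interpret h: ring_hom_ring "poly_ring E" "face_ring E D" "to_face_ring E D :: ('a, 'k) mpoly \<Rightarrow> _"
    by (rule hom_face_ring)
  have hp: "hpart E j g \<in> polys_in E" for j and g :: "('a, 'k) mpoly"
    using hpart_homogeneous[of E j g] by (simp add: homogeneous_def)
  have V: "ideal {q \<in> carrier (poly_ring E). to_face_ring E D q \<in> param_ideal E D r \<theta>} (poly_ring E)"
    by (rule h.ideal_vimage[OF ideal_param_ideal])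
  let ?V = "{q \<in> polys_in E. to_face_ring E D q \<in> param_ideal E D r \<theta>}"
  interpret V: ideal ?V "poly_ring E" using V by simp
  have S: "{to_face_ring E D (one_form E (\<theta> i)) | i. i < r} \<subseteq> carrier (face_ring E D)"
    unfolding carrier_face_ring using one_form_in by blast
  have T: "one_form E (\<theta> l) \<in> ?V" if "l < r" for l
    using F.genideal_self[OF S] that one_form_in unfolding param_ideal_def by blast
  have I: "q \<in> ?V" if q: "q \<in> polys_in E" "q \<in> nonface_ideal D" for q
  proof -
    have "to_face_ring E D q = to_face_ring E D 0"
      using to_face_ring_eq_iff[of q 0] q by (simp add: face_ideal_eq)
    also have "\<dots> \<in> param_ideal E D r \<theta>" using V.zero_closed by simp
    finally show ?thesis using q by simp
  qed
  obtain g where g: "f - (\<Sum>l<r. one_form E (\<theta> l) * g l) \<in> nonface_ideal D"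
    using f(2) by (rule rel_idealE)
  have fE: "f \<in> polys_in E" using f(1) by (simp add: homogeneous_def)
  have "f \<in> ?V"
  proof (cases i)
    case 0
    then have "f \<in> nonface_ideal D"
      using hpart_rel_ideal(2)[OF _ g, of E \<theta>] hpart_id[OF f(1)] by simp
    then show ?thesis using I fE by blast
  next
    case (Suc j)
    let ?s = "\<Sum>l<r. one_form E (\<theta> l) * hpart E j (g l)"
    have nf: "f - ?s \<in> nonface_ideal D"
      using hpart_rel_ideal(1)[OF _ g, of E \<theta> j] hpart_id[OF f(1)] Suc by simp
    have sV: "?s \<in> ?V"
    proof (rule ideal_poly_ring_sum[OF V.ideal_axioms])
      fix l assume "l \<in> {..<r}"
      then have "one_form E (\<theta> l) \<in> ?V" using T by simp
      from V.I_l_closed[OF this, of "hpart E j (g l)"]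
      show "one_form E (\<theta> l) * hpart E j (g l) \<in> ?V" using hp by (simp add: mult.commute)
    qed
    have "f - ?s \<in> polys_in E"
      using polys_in_add[OF fE polys_in_uminus[of ?s E]] sV by simp
    then have "f - ?s \<in> ?V" using nf by (rule I)
    from V.a_closed[OF this sV] show ?thesis by simp
  qed
  then show ?thesis by blast
qed

lemma to_artinian_reduction_eq_iff:
  assumes f: "f \<in> homogeneous E i" and g: "g \<in> homogeneous E i"
  shows "to_artinian_reduction E D r \<theta> f = to_artinian_reduction E D r \<theta> g \<longleftrightarrow> f - g \<in> J"
proof -
  interpret F: cring "face_ring E D :: ('a, 'k) mpoly set ring" by (rule cring_face_ring)
  interpret h: ring_hom_ring "poly_ring E" "face_ring E D" "to_face_ring E D :: ('a, 'k) mpoly \<Rightarrow> _"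
    by (rule hom_face_ring)
  have fg: "f \<in> polys_in E" "g \<in> polys_in E" "f - g \<in> polys_in E"
    using f g homogeneous_diff[OF f g] by (auto simp: homogeneous_def)
  have c: "to_face_ring E D f \<in> carrier (face_ring E D)" "to_face_ring E D g \<in> carrier (face_ring E D)"
    using fg unfolding carrier_face_ring by blast+
  have "to_face_ring E D (f - g) = to_face_ring E D f \<ominus>\<^bsub>face_ring E D\<^esub> to_face_ring E D g"
    using fg h.hom_add[of f "\<ominus>\<^bsub>poly_ring E\<^esub> g"] poly_ring_minus[of f E g] h.hom_a_inv[of g]
      h.R.a_inv_closed[of g] by (simp add: a_minus_def)
  then show ?thesis
    using F.quotient_eq_iff_same_a_r_cos[OF ideal_param_ideal[of E D r \<theta>] c]
      param_ideal_imp_rel[OF fg(3)] rel_imp_param_ideal[OF homogeneous_diff[OF f g]]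
    by (auto simp: to_artinian_reduction_def)
qed

lemma reduction_grading_zero_iff:
  "reduction_grading E D r \<theta> i = {\<zero>\<^bsub>reduction_module E D r \<theta>\<^esub>} \<longleftrightarrow> homogeneous E i \<subseteq> J"
proof -
  interpret ring_hom_ring "poly_ring E" "artinian_reduction E D r \<theta>" "to_artinian_reduction E D r \<theta>"
    by (rule ring_hom_ringI2[OF cring.axioms(1)[OF cring_poly_ring]
          cring.axioms(1)[OF cring_artinian_reduction] to_artinian_reduction_hom])
  have z: "\<zero>\<^bsub>reduction_module E D r \<theta>\<^esub> = to_artinian_reduction E D r \<theta> 0"
    using hom_zero by (simp add: reduction_module_def module_via_def)
  have eq: "to_artinian_reduction E D r \<theta> f = to_artinian_reduction E D r \<theta> 0 \<longleftrightarrow> f \<in> J"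
    if "f \<in> homogeneous E i" for f
    using to_artinian_reduction_eq_iff[OF that homogeneous_zero] by simp
  show ?thesis unfolding reduction_grading_def z
  proof
    assume *: "to_artinian_reduction E D r \<theta> ` homogeneous E i = {to_artinian_reduction E D r \<theta> 0}"
    show "homogeneous E i \<subseteq> J"
    proof
      fix f :: "('a, 'k) mpoly" assume f: "f \<in> homogeneous E i"
      then have "to_artinian_reduction E D r \<theta> f \<in> {to_artinian_reduction E D r \<theta> 0}"
        unfolding *[symmetric] by (rule imageI)
      then show "f \<in> J" using eq[OF f] by simp
    qed
  next
    assume "homogeneous E i \<subseteq> J"
    then have c: "to_artinian_reduction E D r \<theta> f = to_artinian_reduction E D r \<theta> 0"
      if "f \<in> homogeneous E i" for f using eq[OF that] that by blast
    have "to_artinian_reduction E D r \<theta> ` homogeneous E i =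
        (\<lambda>_ :: ('a, 'k) mpoly. to_artinian_reduction E D r \<theta> 0) ` homogeneous E i"
      by (rule image_cong[OF refl], rule c)
    also have "\<dots> = {to_artinian_reduction E D r \<theta> 0}"
      by (rule image_constant[OF homogeneous_zero])
    finally show "to_artinian_reduction E D r \<theta> ` homogeneous E i = {to_artinian_reduction E D r \<theta> 0}" .
  qed
qed

lemma reduction_smult:
  assumes "\<omega> \<in> polys_in E" "f \<in> polys_in E"
  shows "\<omega> \<odot>\<^bsub>reduction_module E D r \<theta>\<^esub> to_artinian_reduction E D r \<theta> f =
    to_artinian_reduction E D r \<theta> (\<omega> * f)"
  using ring_hom_mult[OF to_artinian_reduction_hom[of E D r \<theta>], of \<omega> f] assms
  by (simp add: reduction_module_def module_via_def)

text \<open>The hypotheses make \<open>d\<close> the only possible top degree. Injectivity on a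
  graded piece becomes a trivial kernel because homogeneous elements of one degree are closed under
  differences.\<close>

lemma g_element_iff_lefschetz:
  assumes \<omega>: "\<omega> \<in> homogeneous E 1" and top: "\<not> homogeneous E d \<subseteq> J" "\<And>j. j > d \<Longrightarrow> homogeneous E j \<subseteq> J"
  shows "g_element E (reduction_module E D r \<theta>) (reduction_grading E D r \<theta>) \<omega> \<longleftrightarrow> lefschetz E J \<omega> d"
proof -
  let ?N = "reduction_module E D r \<theta>" and ?gr = "reduction_grading E D r \<theta>"
    and ?\<pi> = "to_artinian_reduction E D r \<theta>"
  have td: "top_degree ?N ?gr d' \<longleftrightarrow> d' = d" for d'
    unfolding top_degree_def reduction_grading_zero_iff using top by (metis linorder_neqE_nat)
  have pw: "\<omega> ^ k \<in> homogeneous E k" for k by (rule homogeneous_power[OF \<omega>])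
  have pin: "f \<in> polys_in E" if "f \<in> homogeneous E i" for f :: "('a, 'k) mpoly" and i
    using that by (simp add: homogeneous_def)
  have sm: "\<omega> ^ k \<odot>\<^bsub>?N\<^esub> ?\<pi> f = ?\<pi> (\<omega> ^ k * f)" if "f \<in> homogeneous E i" for f i k
    by (rule reduction_smult[OF pin[OF pw] pin[OF that]])
  have inj: "inj_on (\<lambda>x. \<omega> ^ k \<odot>\<^bsub>?N\<^esub> x) (?gr i) \<longleftrightarrow>
      (\<forall>f\<in>homogeneous E i. \<omega> ^ k * f \<in> J \<longrightarrow> f \<in> J)" for k i
  proof
    assume inj: "inj_on (\<lambda>x. \<omega> ^ k \<odot>\<^bsub>?N\<^esub> x) (?gr i)"
    show "\<forall>f\<in>homogeneous E i. \<omega> ^ k * f \<in> J \<longrightarrow> f \<in> J"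
    proof (intro ballI impI)
      fix f assume f: "f \<in> homogeneous E i" "\<omega> ^ k * f \<in> J"
      note z = homogeneous_zero[of E i]
      have "?\<pi> (\<omega> ^ k * f) = ?\<pi> (\<omega> ^ k * 0)"
        using to_artinian_reduction_eq_iff[OF homogeneous_mult[OF pw f(1)] homogeneous_mult[OF pw z]] f(2)
        by simp
      then have "\<omega> ^ k \<odot>\<^bsub>?N\<^esub> ?\<pi> f = \<omega> ^ k \<odot>\<^bsub>?N\<^esub> ?\<pi> 0"
        unfolding sm[OF f(1)] sm[OF z] .
      from inj_onD[OF inj this] have "?\<pi> f = ?\<pi> 0"
        using f(1) z unfolding reduction_grading_def by blast
      then show "f \<in> J" using to_artinian_reduction_eq_iff[OF f(1) z] by simp
    qed
  next
    assume *: "\<forall>f\<in>homogeneous E i. \<omega> ^ k * f \<in> J \<longrightarrow> f \<in> J"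
    show "inj_on (\<lambda>x. \<omega> ^ k \<odot>\<^bsub>?N\<^esub> x) (?gr i)"
    proof (rule inj_onI)
      fix x y assume "x \<in> ?gr i" "y \<in> ?gr i" and eq: "\<omega> ^ k \<odot>\<^bsub>?N\<^esub> x = \<omega> ^ k \<odot>\<^bsub>?N\<^esub> y"
      then obtain f g where fg: "f \<in> homogeneous E i" "x = ?\<pi> f" "g \<in> homogeneous E i" "y = ?\<pi> g"
        unfolding reduction_grading_def by blast
      have "?\<pi> (\<omega> ^ k * f) = ?\<pi> (\<omega> ^ k * g)"
        using eq unfolding fg(2,4) sm[OF fg(1)] sm[OF fg(3)] .
      then have "\<omega> ^ k * (f - g) \<in> J"
        using to_artinian_reduction_eq_iff[OF homogeneous_mult[OF pw fg(1)] homogeneous_mult[OF pw fg(3)]]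
        by (simp add: right_diff_distrib)
      then have "f - g \<in> J" using * homogeneous_diff[OF fg(1,3)] by blast
      then show "x = y" using to_artinian_reduction_eq_iff[OF fg(1,3)] fg(2,4) by simp
    qed
  qed
  have img: "(\<lambda>x. \<omega> ^ (d - 2 * i) \<odot>\<^bsub>?N\<^esub> x) ` ?gr i \<subseteq> ?gr (d - i)" if i: "2 * i \<le> d" for i
  proof clarify
    fix x assume "x \<in> ?gr i"
    then obtain f where f: "f \<in> homogeneous E i" "x = ?\<pi> f" unfolding reduction_grading_def by blast
    have "\<omega> ^ (d - 2 * i) * f \<in> homogeneous E (d - 2 * i + i)" by (rule homogeneous_mult[OF pw f(1)])
    then have "\<omega> ^ (d - 2 * i) * f \<in> homogeneous E (d - i)" using i by simp
    then show "\<omega> ^ (d - 2 * i) \<odot>\<^bsub>?N\<^esub> x \<in> ?gr (d - i)"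
      unfolding f(2) sm[OF f(1)] reduction_grading_def by blast
  qed
  have "g_element E ?N ?gr \<omega> \<longleftrightarrow>
      (\<forall>i. 2 * i \<le> d \<longrightarrow> (\<forall>f\<in>homogeneous E i. \<omega> ^ (d - 2 * i) * f \<in> J \<longrightarrow> f \<in> J))"
    unfolding g_element_def td using \<omega> img by (simp add: inj)
  also have "\<dots> \<longleftrightarrow> lefschetz E J \<omega> d"
    by (rule lefschetz_iff[OF rel_ideal_mult[OF down], symmetric])
  finally show ?thesis .
qed

end

end

text \<open>Whether degree \<open>r\<close> is nonzero can be read off from \<B>, which is common to
  all parameters. At one good point the \<open>r\<close>-th power of \<omega> does not kill
  \<open>1\<close>, so \<B> has a monomial of degree \<open>r\<close>.\<close>

lemma (in matroid_complex) top_degree_nonzero: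
  fixes p :: "'a \<times> nat \<Rightarrow> 'k::field_char_0"
  assumes cone: "cone_points E D r = {}" and lsop: "is_lsop D r (\<lambda>i e. p (e, i))"
  shows "\<not> homogeneous E r \<subseteq> point_ideal E D r p"
proof -
  obtain \<B> where B: "\<And>m. m \<in> \<B> \<Longrightarrow> keys m \<in> D \<and> total_degree_monom m \<le> r"
    and basis: "\<And>p :: 'a \<times> nat \<Rightarrow> 'k. is_lsop D r (\<lambda>i e. p (e, i)) \<Longrightarrow>
      monomial_basis (point_ideal E D r p) \<B>"
    by (rule face_basis[where ?'k = 'k]) blast
  have gq: "graded_quotient E (point_ideal E D r p) \<B>" if "is_lsop D r (\<lambda>i e. p (e, i))"
    for p :: "'a \<times> nat \<Rightarrow> 'k"
    using graded_quotient_point[OF basis[OF that]] B by blast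
  obtain q :: "'a \<times> nat \<Rightarrow> 'k" where q: "q \<in> good_points E D r r"
    using good_points_nonempty[OF matroid_complex_axioms, of r, where ?'k = 'k] cone by auto
  then have lq: "is_lsop D r (\<lambda>i e. q (e, i))"
    and lef: "lefschetz E (point_ideal E D r q) (point_form E r q) r"
    by (simp_all add: good_points_def)
  interpret q: graded_quotient E "point_ideal E D r q" \<B> by (rule gq[OF lq])
  interpret p: graded_quotient E "point_ideal E D r p" \<B> by (rule gq[OF lsop])
  have one: "(1 :: ('a, 'k) mpoly) \<in> homogeneous E 0"
    using homogeneous_power[OF one_form_homogeneous, of E _ 0] by simp
  have one_notin: "(1 :: ('a, 'k) mpoly) \<notin> point_ideal E D r q"
    using lookup_rel_ideal_zero[OF indep_empty, of 1 r E "\<lambda>l e. q (e, l)"] unfolding point_ideal_def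
    by auto
  have nz: "point_form E r q ^ r \<notin> point_ideal E D r q"
  proof
    assume "point_form E r q ^ r \<in> point_ideal E D r q"
    then have *: "point_form E r q ^ r * 1 \<in> point_ideal E D r q" by simp
    have "2 * 0 + r \<le> r" by simp
    from lef[unfolded lefschetz_def, rule_format, OF this one *] one_notin show False by contradiction
  qed
  have "point_form E r q ^ r \<in> homogeneous E r"
    unfolding point_form_def by (intro homogeneous_power one_form_homogeneous)
  then obtain c where "point_form E r q ^ r - (\<Sum>m\<in>q.graded_basis r. single m (c m)) \<in> point_ideal E D r q"
    by (rule q.normal_form)
  with nz have "q.graded_basis r \<noteq> {}" by auto
  then obtain m where m: "m \<in> p.graded_basis r" by blast
  have "single m 1 \<notin> point_ideal E D r p"
  proof
    assume "single m 1 \<in> point_ideal E D r p"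
    moreover have "(\<Sum>n\<in>p.graded_basis r. single n (if n = m then 1 else 0 :: 'k)) =
        (\<Sum>n\<in>p.graded_basis r. if n = m then single m 1 else 0)"
      by (intro sum.cong) auto
    ultimately have "(\<Sum>n\<in>p.graded_basis r. single n (if n = m then 1 else 0 :: 'k)) \<in> point_ideal E D r p"
      using m p.finite_graded_basis by simp
    from p.graded_basis_indep[OF this m] show False by simp
  qed
  then show ?thesis using p.graded_basis_homogeneous[OF m, of 1] by blast
qed

lemma (in matroid_complex) lsop_g_element_set_eq:
  assumes cone: "cone_points E D r = {}"
    and D: "D = independence_complex E indep"
  shows "(lsop_g_element_set E indep r :: ('a \<times> nat \<Rightarrow> 'k::field_char_0) set) = good_points E D r r"
proof -
  have "g_element E (reduction_module E D r (\<lambda>i e. p (e, i))) (reduction_grading E D r (\<lambda>i e. p (e, i)))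
      (one_form E (\<lambda>e. p (e, r))) \<longleftrightarrow> lefschetz E (point_ideal E D r p) (point_form E r p) r"
    if "is_lsop D r (\<lambda>i e. p (e, i))" for p :: "'a \<times> nat \<Rightarrow> 'k"
    unfolding point_ideal_def point_form_def
  proof (rule g_element_iff_lefschetz[OF finite_ground down_closed_faces _ one_form_homogeneous])
    show "D \<subseteq> Pow E" using indep_ground by blast
    show "\<not> homogeneous E r \<subseteq> rel_ideal D r (\<lambda>l. one_form E (\<lambda>e. p (e, l)))"
      using top_degree_nonzero[OF cone that] by (simp add: point_ideal_def)
    show "homogeneous E j \<subseteq> rel_ideal D r (\<lambda>l. one_form E (\<lambda>e. p (e, l)))" if "r < j" for j
      using high_degree_in_ideal[OF \<open>is_lsop D r (\<lambda>i e. p (e, i))\<close> _ that] by (auto simp: point_ideal_def)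
  qed
  then show ?thesis unfolding lsop_g_element_set_def good_points_def D[symmetric] Let_def by auto
qed

lemma matroid_complex_independence:
  assumes "matroid E indep" "matroid_rank E indep = r"
  shows "matroid_complex E (independence_complex E indep) r"
proof -
  interpret matroid E indep by (rule assms(1))
  let ?D = "independence_complex E indep"
  have eq: "(\<lambda>X. X \<in> ?D) = indep" using indep_ground by (auto simp: independence_complex_def)
  have "finite ?D" using finite_ground by (simp add: independence_complex_def)
  then have fin: "finite (card ` ?D)" by simp
  have ne: "card ` ?D \<noteq> {}" using indep_empty by (auto simp: independence_complex_def)
  have r: "r = Max (card ` ?D)"
    using assms(2) by (simp add: matroid_rank_def independence_complex_def)
  show ?thesis
  proof
    show "\<exists>B\<in>?D. card B = r" using Max_in[OF fin ne] unfolding r by auto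
    show "card X \<le> r" if "X \<in> ?D" for X using Max_ge[OF fin] that unfolding r by blast
  qed (use matroid_axioms eq in \<open>auto simp: matroid_def independence_complex_def\<close>)
qed

theorem theorem4p2:
  fixes E :: "'a set" and indep :: "'a set \<Rightarrow> bool" and r :: nat
    and U :: "('a \<times> nat \<Rightarrow> 'k::field_char_0) set"
  assumes "matroid E indep"
    and "matroid_rank E indep = r"
    and "\<forall>e\<in>E. \<not> coloop E indep e"
    and "U = lsop_g_element_set E indep r"
  shows "U \<noteq> {} \<and> openin (zariski_topology (E \<times> {..r})) U"
proof -
  let ?D = "independence_complex E indep"
  interpret matroid_complex E ?D r by (rule matroid_complex_independence[OF assms(1,2)])
  have "e \<notin> cone_points E ?D r" for e
  proof
    assume e: "e \<in> cone_points E ?D r"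
    \<comment> \<open>Coloops refer to maximal independent sets, cone points to faces of size
      \<open>r\<close>; extending a basis to such a face shows that it already is one.\<close>
    have "e \<in> B" if B: "matroid_basis E indep B" for B
    proof -
      have BD: "B \<in> ?D" using B by (simp add: matroid_basis_def independence_complex_def)
      obtain B0 where "B0 \<in> ?D" "card B0 = r" using facet_exists by blast
      then obtain B' where B': "B' \<in> ?D" "card B' = r" "B \<subseteq> B'" using extend_to_facet[OF BD] by blast
      then have "B' = B" using B by (simp add: matroid_basis_def independence_complex_def)
      then show ?thesis using e B' by (auto simp: cone_points_def)
    qed
    moreover have "e \<in> E" using e by (simp add: cone_points_def)
    ultimately show False using assms(3) by (auto simp: coloop_def)
  qed
  then have cone: "cone_points E ?D r = {}" by blast
  have "U = good_points E ?D r r"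
    unfolding assms(4) by (rule lsop_g_element_set_eq[OF cone refl])
  then show ?thesis
    using good_points_nonempty[OF matroid_complex_axioms, of r, where ?'k = 'k] cone good_points_open
    by (simp add: openin_zariski)
qed

end
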